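(* Let $M^3$ be a connected positive definite affine hypersurface of $\mathbb{R}^4$ which admits a pointwise $SO(2)$-symmetry or a pointwise $Z_3$-symmetry, and suppose that the globally defined functions $b,\eta,\lambda$ satisfy $b=-\eta^2+\lambda^2$ but $b\not\equiv0$ on $M^3$. Then $M^3$ is (locally, around each point) affine equivalent to $$F:I\times N^2\to\mathbb{R}^4:\ (t,u,v)\mapsto(\gamma_1(t)u,\ \gamma_1(t)v,\ \gamma_1(t)f(u,v)+\gamma_2(t),\ \gamma_1(t)),$$ where $\psi:N^2\to\mathbb{R}^3:(u,v)\mapsto(u,v,f(u,v))$ is an improper affine sphere with affine normal $(0,0,1)$ and $\gamma=(\gamma_1,\gamma_2):I\to\mathbb{R}^2$ is a curve ($I\subset\mathbb{R}$ an interval). Moreover, if $M^3$ admits a pointwise $SO(2)$-symmetry, then $N^2$ is (an open part of) an elliptic paraboloid.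
   Context: A nondegenerate affine hypersurface $F:M^3\to\mathbb{R}^4$ is an immersion with (equi)affine (Blaschke) normal field $\xi$, inducing $\nabla$, $h$, $S$ by $D_XY=\nabla_XY+h(X,Y)\xi$, $D_X\xi=-SX$ ($D$ the flat connection of $\mathbb{R}^4$), where $h$ (affine metric) is nondegenerate and $|\det(X_1,X_2,X_3,\xi)|=1$ for $h$-orthonormal $X_1,X_2,X_3$; $S$ is the affine shape operator. The difference tensor is $K(X,Y)=\nabla_XY-\widehat\nabla_XY$ ($\widehat\nabla$ the Levi-Civita connection of $h$). Positive definite means $h$ is positive definite. For $p\in M$, $G_p$ is the group of orientation-preserving linear isometries of $(T_pM,h)$ preserving $K$ and $S$. $M$ admits a pointwise $SO(2)$-symmetry (resp. $Z_3$-symmetry) if for every $p$, $G_p$ is the group of all rotations about some axis $\mathbb{R}e_1\subset T_pM$ (resp. the order 3 group generated by the rotation by $2\pi/3$ about $\mathbb{R}e_1$). Equivalently, around each point there is a smooth $h$-orthonormal frame $\{e_1,e_2,e_3\}$ with $$K_{e_1}=\begin{pmatrix}2\lambda&0&0\\0&-\lambda&0\\0&0&-\lambda\end{pmatrix},\ K_{e_2}=\begin{pmatrix}0&-\lambda&0\\-\lambda&\mu&0\\0&0&-\mu\end{pmatrix},\ K_{e_3}=\begin{pmatrix}0&0&-\lambda\\0&0&-\mu\\-\lambda&-\mu&0\end{pmatrix},\ S=\begin{pmatrix}a&0&0\\0&b&0\\0&0&b\end{pmatrix},$$ $\lambda>0$, where for $SO(2)$ $\mu=0$ everywhere, and for $Z_3$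 $\mu>0$ everywhere and $a\neq b$ wherever $\mu=\sqrt2\lambda$. The unit vector field $e_1$ and the functions $\lambda,\mu,a,b$ are globally defined, and $\eta$ is the globally defined function $\eta=h(\widehat\nabla_{e_2}e_1,e_2)=h(\widehat\nabla_{e_3}e_1,e_3)$. An improper affine sphere in $\mathbb{R}^3$ is a nondegenerate affine surface whose affine normal is constant. *)

theory Defs
  imports "HOL-Analysis.Analysis"
begin

section \<open>Smooth maps and smooth manifolds\<close>

text \<open>All derivatives are full derivatives, so these notions are meant for open sets \<open>S\<close>.\<close>

primrec Ck_on ::
  "nat \<Rightarrow> 'a::real_normed_vector set \<Rightarrow> ('a \<Rightarrow> 'b::real_normed_vector) \<Rightarrow> bool" where
  "Ck_on 0 S f \<longleftrightarrow> continuous_on S f"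
| "Ck_on (Suc k) S f \<longleftrightarrow> (\<forall>x\<in>S. f differentiable (at x)) \<and>
     (\<forall>v. Ck_on k S (\<lambda>x. frechet_derivative f (at x) v))"

definition smooth_on ::
  "'a::real_normed_vector set \<Rightarrow> ('a \<Rightarrow> 'b::real_normed_vector) \<Rightarrow> bool" where
  "smooth_on S f \<longleftrightarrow> (\<forall>k. Ck_on k S f)"

type_synonym ('m, 'n) chart = "'m set \<times> ('m \<Rightarrow> real^'n)"

definition chart_image :: "('m, 'n) chart \<Rightarrow> (real^'n) set" where
  "chart_image c = snd c ` fst c"

definition param :: "('m, 'n) chart \<Rightarrow> real^'n \<Rightarrow> 'm" where
  "param c = inv_into (fst c) (snd c)"

definition is_chart :: "('m::topological_space, 'n::finite) chart \<Rightarrow> bool" where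
  "is_chart c \<longleftrightarrow> open (fst c) \<and> open (chart_image c) \<and>
     homeomorphism (fst c) (chart_image c) (snd c) (param c)"

definition compatible :: "('m, 'n::finite) chart \<Rightarrow> ('m, 'n) chart \<Rightarrow> bool" where
  "compatible c c' \<longleftrightarrow>
     smooth_on (snd c ` (fst c \<inter> fst c')) (snd c' \<circ> param c) \<and>
     smooth_on (snd c' ` (fst c \<inter> fst c')) (snd c \<circ> param c')"

text \<open>The manifold described by an atlas is the union of the chart domains, with the topology of
  the ambient type (which is Hausdorff and second countable wherever this is used).\<close>

definition smooth_atlas :: "('m::topological_space, 'n::finite) chart set \<Rightarrow> bool" where
  "smooth_atlas A \<longleftrightarrow> (\<forall>c\<in>A. is_chart c) \<and> (\<forall>c\<in>A. \<forall>c'\<in>A. compatible c c')"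

definition carrier :: "('m, 'n) chart set \<Rightarrow> 'm set" where
  "carrier A = (\<Union>c\<in>A. fst c)"

definition smooth_chart :: "('m::topological_space, 'n::finite) chart set \<Rightarrow> ('m, 'n) chart \<Rightarrow> bool" where
  "smooth_chart A c \<longleftrightarrow> is_chart c \<and> fst c \<subseteq> carrier A \<and> (\<forall>c'\<in>A. compatible c c')"


section \<open>Equiaffine hypersurfaces in local coordinates\<close>

text \<open>
  \<open>G\<close> is a hypersurface immersion of an open subset of \<open>real^'n\<close> into \<open>real^'k\<close>, with
  \<open>CARD('k) = CARD('n) + 1\<close>, and \<open>\<xi>\<close> a transversal field along it. Tangent vectors are written in
  coordinates; a tangent vector \<open>X\<close> is constantly extended where a vector field is needed.
  The descriptions below determine their objects uniquely when \<open>G\<close> is an immersion and \<open>\<xi>\<close> is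
  transversal (for \<open>christoffel\<close>: when \<open>h\<close> is nondegenerate).
\<close>

abbreviation deriv_along ::
  "('a::real_normed_vector \<Rightarrow> 'b::real_normed_vector) \<Rightarrow> 'a \<Rightarrow> 'a \<Rightarrow> 'b" where
  "deriv_along f y X \<equiv> frechet_derivative f (at y) X"

text \<open>The Gauss formula \<open>D_X Y = \<nabla>_X Y + h(X,Y) \<xi>\<close>.\<close>

definition induced_connection ::
  "(real^'n \<Rightarrow> real^'k) \<Rightarrow> (real^'n \<Rightarrow> real^'k) \<Rightarrow>
   (real^'n \<Rightarrow> real^'n) \<Rightarrow> (real^'n \<Rightarrow> real^'n) \<Rightarrow> real^'n::finite \<Rightarrow> real^'n" where
  "induced_connection G \<xi> X Y y =
     (THE Z. \<exists>r. deriv_along (\<lambda>z. deriv_along G z (Y z)) y (X y) = deriv_along G y Z + r *\<^sub>R \<xi> y)"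

definition affine_metric ::
  "(real^'n \<Rightarrow> real^'k) \<Rightarrow> (real^'n \<Rightarrow> real^'k) \<Rightarrow>
   real^'n::finite \<Rightarrow> real^'n \<Rightarrow> real^'n \<Rightarrow> real" where
  "affine_metric G \<xi> y X Y =
     (THE r. \<exists>Z. deriv_along (\<lambda>z. deriv_along G z Y) y X = deriv_along G y Z + r *\<^sub>R \<xi> y)"

text \<open>The Weingarten formula \<open>D_X \<xi> = - S X\<close>.\<close>

definition shape_operator ::
  "(real^'n \<Rightarrow> real^'k) \<Rightarrow> (real^'n \<Rightarrow> real^'k) \<Rightarrow> real^'n::finite \<Rightarrow> real^'n \<Rightarrow> real^'n" where
  "shape_operator G \<xi> y X = (THE Z. deriv_along \<xi> y X = - deriv_along G y Z)"

definition christoffel ::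
  "(real^'n \<Rightarrow> real^'n \<Rightarrow> real^'n \<Rightarrow> real) \<Rightarrow> real^'n::finite \<Rightarrow> real^'n \<Rightarrow> real^'n \<Rightarrow> real^'n" where
  "christoffel h y X Y =
     (THE W. \<forall>Z. 2 * h y W Z = deriv_along (\<lambda>z. h z Y Z) y X + deriv_along (\<lambda>z. h z X Z) y Y
                              - deriv_along (\<lambda>z. h z X Y) y Z)"

definition levi_civita ::
  "(real^'n \<Rightarrow> real^'n \<Rightarrow> real^'n \<Rightarrow> real) \<Rightarrow>
   (real^'n \<Rightarrow> real^'n) \<Rightarrow> (real^'n \<Rightarrow> real^'n) \<Rightarrow> real^'n::finite \<Rightarrow> real^'n" where
  "levi_civita h X Y y = deriv_along Y y (X y) + christoffel h y (X y) (Y y)"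

definition difference_tensor ::
  "(real^'n \<Rightarrow> real^'k) \<Rightarrow> (real^'n \<Rightarrow> real^'k) \<Rightarrow>
   real^'n::finite \<Rightarrow> real^'n \<Rightarrow> real^'n \<Rightarrow> real^'n" where
  "difference_tensor G \<xi> y X Y =
     induced_connection G \<xi> (\<lambda>_. X) (\<lambda>_. Y) y - levi_civita (affine_metric G \<xi>) (\<lambda>_. X) (\<lambda>_. Y) y"

definition immersion_on :: "(real^'n) set \<Rightarrow> (real^'n::finite \<Rightarrow> real^'k::finite) \<Rightarrow> bool" where
  "immersion_on V G \<longleftrightarrow> smooth_on V G \<and> (\<forall>y\<in>V. inj (frechet_derivative G (at y)))"

text \<open>Orthonormality with respect to a possibly indefinite scalar product.\<close>

definition orthonormal_list :: "('v \<Rightarrow> 'v \<Rightarrow> real) \<Rightarrow> 'v list \<Rightarrow> bool" where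
  "orthonormal_list g Xs \<longleftrightarrow>
     (\<forall>i<length Xs. \<forall>j<length Xs. \<bar>g (Xs ! i) (Xs ! j)\<bar> = (if i = j then 1 else 0))"

text \<open>Nondegeneracy of the immersion is part of being equipped with an affine (Blaschke) normal.\<close>

definition affine_normal_on ::
  "(real^'n) set \<Rightarrow> (real^'n \<Rightarrow> (real, 'k::{finite,numeral}) vec) \<Rightarrow>
   (real^'n \<Rightarrow> (real, 'k) vec) \<Rightarrow> bool" where
  "affine_normal_on V G \<xi> \<longleftrightarrow>
     smooth_on V \<xi> \<and>
     (\<forall>y\<in>V.
        \<xi> y \<notin> range (frechet_derivative G (at y)) \<and>
        range (frechet_derivative \<xi> (at y)) \<subseteq> range (frechet_derivative G (at y)) \<and>
        (\<forall>X. X \<noteq> 0 \<longrightarrow> (\<exists>Y. affine_metric G \<xi> y X Y \<noteq> 0)) \<and>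
        (\<forall>Xs. length Xs = CARD('n) \<and> orthonormal_list (affine_metric G \<xi> y) Xs \<longrightarrow>
           \<bar>det (vector (map (frechet_derivative G (at y)) Xs @ [\<xi> y]) :: ((real, 'k) vec, 'k) vec)\<bar> = 1))"


section \<open>Affine hypersurfaces of \<open>\<real>\<^sup>4\<close> and their pointwise symmetries\<close>

text \<open>Every object on the manifold is read in the charts of the atlas; tangent vectors at
  \<open>p\<close> are represented by their components in the chart.\<close>

definition affine_hypersurface ::
  "('m::topological_space, 3) chart set \<Rightarrow> ('m \<Rightarrow> real^4) \<Rightarrow> ('m \<Rightarrow> real^4) \<Rightarrow> bool" where
  "affine_hypersurface A F \<xi> \<longleftrightarrow> smooth_atlas A \<and>
     (\<forall>c\<in>A. immersion_on (chart_image c) (F \<circ> param c) \<and>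
            affine_normal_on (chart_image c) (F \<circ> param c) (\<xi> \<circ> param c))"

abbreviation metric_in ::
  "('m, 3) chart \<Rightarrow> ('m \<Rightarrow> real^4) \<Rightarrow> ('m \<Rightarrow> real^4) \<Rightarrow> real^3 \<Rightarrow> real^3 \<Rightarrow> real^3 \<Rightarrow> real" where
  "metric_in c F \<xi> \<equiv> affine_metric (F \<circ> param c) (\<xi> \<circ> param c)"

abbreviation K_in ::
  "('m, 3) chart \<Rightarrow> ('m \<Rightarrow> real^4) \<Rightarrow> ('m \<Rightarrow> real^4) \<Rightarrow> real^3 \<Rightarrow> real^3 \<Rightarrow> real^3 \<Rightarrow> real^3" where
  "K_in c F \<xi> \<equiv> difference_tensor (F \<circ> param c) (\<xi> \<circ> param c)"

abbreviation S_in ::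
  "('m, 3) chart \<Rightarrow> ('m \<Rightarrow> real^4) \<Rightarrow> ('m \<Rightarrow> real^4) \<Rightarrow> real^3 \<Rightarrow> real^3 \<Rightarrow> real^3" where
  "S_in c F \<xi> \<equiv> shape_operator (F \<circ> param c) (\<xi> \<circ> param c)"

definition positive_definite ::
  "('m, 3) chart set \<Rightarrow> ('m \<Rightarrow> real^4) \<Rightarrow> ('m \<Rightarrow> real^4) \<Rightarrow> bool" where
  "positive_definite A F \<xi> \<longleftrightarrow>
     (\<forall>c\<in>A. \<forall>y\<in>chart_image c. \<forall>X. X \<noteq> 0 \<longrightarrow> metric_in c F \<xi> y X X > 0)"

definition symmetry_group ::
  "(real^3 \<Rightarrow> real^3 \<Rightarrow> real) \<Rightarrow> (real^3 \<Rightarrow> real^3 \<Rightarrow> real^3) \<Rightarrow> (real^3 \<Rightarrow> real^3) \<Rightarrow>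
   (real^3 \<Rightarrow> real^3) set" where
  "symmetry_group g K S =
     {L. linear L \<and> det (matrix L) > 0 \<and> (\<forall>X Y. g (L X) (L Y) = g X Y) \<and>
         (\<forall>X Y. K (L X) (L Y) = L (K X Y)) \<and> (\<forall>X. S (L X) = L (S X))}"

definition orthonormal_frame :: "(real^3 \<Rightarrow> real^3 \<Rightarrow> real) \<Rightarrow> (3 \<Rightarrow> real^3) \<Rightarrow> bool" where
  "orthonormal_frame g e \<longleftrightarrow> (\<forall>i j. g (e i) (e j) = (if i = j then 1 else 0))"

text \<open>The rotation by the angle \<open>\<theta>\<close> about the axis spanned by \<open>e 1\<close>.\<close>

definition rotation ::
  "(real^3 \<Rightarrow> real^3 \<Rightarrow> real) \<Rightarrow> (3 \<Rightarrow> real^3) \<Rightarrow> real \<Rightarrow> real^3 \<Rightarrow> real^3" where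
  "rotation g e \<theta> X = g X (e 1) *\<^sub>R e 1
     + g X (e 2) *\<^sub>R (cos \<theta> *\<^sub>R e 2 + sin \<theta> *\<^sub>R e 3)
     + g X (e 3) *\<^sub>R (- sin \<theta> *\<^sub>R e 2 + cos \<theta> *\<^sub>R e 3)"

definition pointwise_SO2_symmetry ::
  "('m, 3) chart set \<Rightarrow> ('m \<Rightarrow> real^4) \<Rightarrow> ('m \<Rightarrow> real^4) \<Rightarrow> bool" where
  "pointwise_SO2_symmetry A F \<xi> \<longleftrightarrow>
     (\<forall>c\<in>A. \<forall>y\<in>chart_image c. \<exists>e. orthonormal_frame (metric_in c F \<xi> y) e \<and>
        symmetry_group (metric_in c F \<xi> y) (K_in c F \<xi> y) (S_in c F \<xi> y) =
        range (rotation (metric_in c F \<xi> y) e))"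

definition pointwise_Z3_symmetry ::
  "('m, 3) chart set \<Rightarrow> ('m \<Rightarrow> real^4) \<Rightarrow> ('m \<Rightarrow> real^4) \<Rightarrow> bool" where
  "pointwise_Z3_symmetry A F \<xi> \<longleftrightarrow>
     (\<forall>c\<in>A. \<forall>y\<in>chart_image c. \<exists>e. orthonormal_frame (metric_in c F \<xi> y) e \<and>
        symmetry_group (metric_in c F \<xi> y) (K_in c F \<xi> y) (S_in c F \<xi> y) =
        rotation (metric_in c F \<xi> y) e ` {0, 2 * pi / 3, 4 * pi / 3})"

definition has_matrix :: "(real^3 \<Rightarrow> real^3) \<Rightarrow> (3 \<Rightarrow> real^3) \<Rightarrow> real^3^3 \<Rightarrow> bool" where
  "has_matrix L e B \<longleftrightarrow> (\<forall>j. L (e j) = (\<Sum>i\<in>UNIV. (B $ i $ j) *\<^sub>R e i))"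

definition normal_form ::
  "(real^3 \<Rightarrow> real^3 \<Rightarrow> real) \<Rightarrow> (real^3 \<Rightarrow> real^3 \<Rightarrow> real^3) \<Rightarrow> (real^3 \<Rightarrow> real^3) \<Rightarrow>
   (3 \<Rightarrow> real^3) \<Rightarrow> real \<Rightarrow> real \<Rightarrow> real \<Rightarrow> real \<Rightarrow> bool" where
  "normal_form g K S e lam mu a b \<longleftrightarrow>
     orthonormal_frame g e \<and>
     has_matrix (K (e 1)) e (vector [vector [2 * lam, 0, 0],
                                     vector [0, - lam, 0],
                                     vector [0, 0, - lam]]) \<and>
     has_matrix (K (e 2)) e (vector [vector [0, - lam, 0],
                                     vector [- lam, mu, 0],
                                     vector [0, 0, - mu]]) \<and>
     has_matrix (K (e 3)) e (vector [vector [0, 0, - lam],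
                                     vector [0, 0, - mu],
                                     vector [- lam, - mu, 0]]) \<and>
     has_matrix S e (vector [vector [a, 0, 0],
                             vector [0, b, 0],
                             vector [0, 0, b]])"

text \<open>The functions \<open>\<lambda>, \<mu>, a, b, \<eta>\<close> on the manifold that are attached to a pointwise \<open>SO(2)\<close>- or
  \<open>Z\<^sub>3\<close>-symmetry by means of smooth local frames in normal form. The normalisations of \<open>\<mu>\<close>,
  which distinguish the two symmetries, are not included.\<close>

definition symmetry_functions ::
  "('m, 3) chart set \<Rightarrow> ('m \<Rightarrow> real^4) \<Rightarrow> ('m \<Rightarrow> real^4) \<Rightarrow>
   ('m \<Rightarrow> real) \<Rightarrow> ('m \<Rightarrow> real) \<Rightarrow> ('m \<Rightarrow> real) \<Rightarrow> ('m \<Rightarrow> real) \<Rightarrow> ('m \<Rightarrow> real) \<Rightarrow> bool" where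
  "symmetry_functions A F \<xi> lam mu a b eta \<longleftrightarrow>
     (\<forall>p\<in>carrier A. lam p > 0) \<and>
     (\<forall>p\<in>carrier A. \<exists>c\<in>A. \<exists>V e. p \<in> fst c \<and> open V \<and> V \<subseteq> chart_image c \<and> snd c p \<in> V \<and>
        (\<forall>i. smooth_on V (e i)) \<and>
        (\<forall>y\<in>V.
           normal_form (metric_in c F \<xi> y) (K_in c F \<xi> y) (S_in c F \<xi> y) (\<lambda>i. e i y)
             (lam (param c y)) (mu (param c y)) (a (param c y)) (b (param c y)) \<and>
           eta (param c y) =
             metric_in c F \<xi> y (levi_civita (metric_in c F \<xi>) (e 2) (e 1) y) (e 2 y) \<and>
           eta (param c y) =
             metric_in c F \<xi> y (levi_civita (metric_in c F \<xi>) (e 3) (e 1) y) (e 3 y)))"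


section \<open>Improper affine spheres and the model hypersurfaces\<close>

definition graph_surface :: "(real^2 \<Rightarrow> real) \<Rightarrow> real^2 \<Rightarrow> real^3" where
  "graph_surface f w = vector [w $ 1, w $ 2, f w]"

text \<open>A nondegenerate surface patch whose affine normal is constantly \<open>\<zeta>\<close>.\<close>

definition improper_affine_sphere_on ::
  "(real^2) set \<Rightarrow> (real^2 \<Rightarrow> real^3) \<Rightarrow> real^3 \<Rightarrow> bool" where
  "improper_affine_sphere_on N \<psi> \<zeta> \<longleftrightarrow> immersion_on N \<psi> \<and> affine_normal_on N \<psi> (\<lambda>_. \<zeta>)"

definition affine_iso :: "(real^'k \<Rightarrow> real^'k::finite) \<Rightarrow> bool" where
  "affine_iso T \<longleftrightarrow> (\<exists>L v. linear L \<and> bij L \<and> T = (\<lambda>x. L x + v))"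

definition elliptic_paraboloid :: "(real^3) set \<Rightarrow> bool" where
  "elliptic_paraboloid Q \<longleftrightarrow>
     (\<exists>T. affine_iso T \<and> Q = T ` {x. x $ 3 = (x $ 1)\<^sup>2 + (x $ 2)\<^sup>2})"

text \<open>\<open>I \<times> N\<close> as a set of triples \<open>(t,u,v)\<close>, and the model hypersurface on it.\<close>

definition prod_domain :: "real set \<Rightarrow> (real^2) set \<Rightarrow> (real^3) set" where
  "prod_domain I N = {x. x $ 1 \<in> I \<and> vector [x $ 2, x $ 3] \<in> N}"

definition model_hypersurface ::
  "(real \<Rightarrow> real^2) \<Rightarrow> (real^2 \<Rightarrow> real) \<Rightarrow> real^3 \<Rightarrow> real^4" where
  "model_hypersurface \<gamma> f x =
     (let t = x $ 1; u = x $ 2; v = x $ 3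
      in vector [\<gamma> t $ 1 * u, \<gamma> t $ 1 * v, \<gamma> t $ 1 * f (vector [u, v]) + \<gamma> t $ 2, \<gamma> t $ 1])"

end

theory Submission
  imports Defs
begin

text \<open>
  Put \<open>E\<^sub>i = dF(e\<^sub>i)\<close>, \<open>W = \<xi> - (\<lambda> + \<eta>) E\<^sub>1\<close> and \<open>\<delta> = \<eta> - \<lambda>\<close>. The Codazzi equations for \<open>K\<close> make
  \<open>e\<^sub>1\<close> geodesic, span(\<open>e\<^sub>2, e\<^sub>3\<close>) integrable and umbilical, and \<open>\<lambda>\<close> constant on its leaves. Flatness
  of \<open>D\<close> and \<open>b = \<lambda>\<^sup>2 - \<eta>\<^sup>2\<close> then say that \<open>W\<close> is parallel up to scaling, that
  span(\<open>E\<^sub>2, E\<^sub>3, W\<close>) is a fixed hyperplane direction, and that \<open>\<delta>\<close> satisfies a homogeneous linear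
  equation, so that \<open>\<delta>\<close> vanishes nowhere as soon as \<open>b\<close> is not identically zero. The point
  \<open>F - E\<^sub>1/\<delta>\<close> moves on a line in the fixed direction of \<open>W\<close>. If this line is the third coordinate
  axis and the fixed hyperplane is \<open>x\<^sub>4 = 0\<close>, then along \<open>E\<^sub>1\<close> the quotients \<open>x\<^sub>1/x\<^sub>4\<close> and
  \<open>x\<^sub>2/x\<^sub>4\<close> are constant while \<open>x\<^sub>3/x\<^sub>4\<close> changes by a function of \<open>x\<^sub>4\<close> alone, which is the asserted
  form with \<open>\<gamma>\<^sub>1(t) = t\<close>. The metric on a leaf is the Hessian of \<open>f\<close> up to a factor, so
  \<open>det Hess f = 1\<close> follows from the tracelessness of \<open>K\<close>, and \<open>Hess f\<close> is constant when \<open>\<mu> = 0\<close>.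
\<close>

section \<open>Calculus of smooth maps\<close>

text \<open>The connection coefficients \<open>om i 2 3\<close>, which rotate \<open>E 2\<close> and
  \<open>E 3\<close> into each other, are never determined. They cancel in the 2x2 minors of the
  pair (\<open>E 2\<close>, \<open>E 3\<close>), which is why the fixed hyperplane and the volume of
  the leaves are reached through minors. No differential equation is solved: constancy claims
  compare two functions with the same logarithmic derivatives along the frame, and linear
  coordinates normalised at one base point supply the constant. The point F - E_1/\<delta> can be
  formed only once \<delta> is known to have no zeros, so the coordinates come in two stages. The
  first does not divide by \<delta>; it shows that \<delta> times the square of a nonvanishing minor
  is locally constant, and connectedness turns "zero" or "nonzero" into a global alternative. The
  second stage takes F - E_1/\<delta> at the base point as origin.\<close>

lemma Ck_on_cong_imp:
  assumes S: "open S"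
  shows "Ck_on k S f \<Longrightarrow> (\<And>x. x \<in> S \<Longrightarrow> f x = g x) \<Longrightarrow> Ck_on k S g"
proof (induction k arbitrary: f g)
  case 0
  then show ?case by (metis Ck_on.simps(1) continuous_on_eq)
next
  case (Suc k)
  have d: "f differentiable (at x)" if "x \<in> S" for x
    using Suc.prems that by simp
  have d': "g differentiable (at x)" if "x \<in> S" for x
    using d[OF that] S that Suc.prems(2)
    by (meson differentiable_def has_derivative_transform_within_open)
  have e: "frechet_derivative f (at x) = frechet_derivative g (at x)" if "x \<in> S" for x
    using frechet_derivative_transform_within_open[OF d[OF that] S that] Suc.prems(2) by blast
  have "Ck_on k S (\<lambda>x. frechet_derivative g (at x) v)" for v
    using Suc.IH[of "\<lambda>x. frechet_derivative f (at x) v" "\<lambda>x. frechet_derivative g (at x) v"]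
      Suc.prems(1) e by simp
  then show ?case using d' by simp
qed

lemma Ck_on_cong:
  assumes "open S" "\<And>x. x \<in> S \<Longrightarrow> f x = g x"
  shows "Ck_on k S f \<longleftrightarrow> Ck_on k S g"
  using Ck_on_cong_imp[OF assms(1)] assms(2) by metis

lemma Ck_on_imp_continuous_on: "Ck_on k S f \<Longrightarrow> continuous_on S f"
  by (cases k) (auto intro!: continuous_at_imp_continuous_on differentiable_imp_continuous_within)

lemma Ck_on_SucD: "Ck_on (Suc k) S f \<Longrightarrow> Ck_on k S f"
proof (induction k arbitrary: f)
  case 0
  then show ?case using Ck_on_imp_continuous_on[of "Suc 0"] by simp
next
  case (Suc k)
  then show ?case by (metis Ck_on.simps(2))
qed

lemma Ck_on_subset: "Ck_on k S f \<Longrightarrow> T \<subseteq> S \<Longrightarrow> Ck_on k T f"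
proof (induction k arbitrary: f)
  case 0
  then show ?case by (auto intro: continuous_on_subset)
next
  case (Suc k)
  then show ?case by auto
qed

text \<open>\<open>Ck_on\<close> is phrased with the choice operator
  \<open>frechet_derivative\<close>. This rule accepts any explicit formula for the derivative, so
  the closure lemmas below can supply the sum, product or chain rule directly.\<close>

lemma Ck_on_SucI:
  assumes S: "open S"
    and f: "\<And>x. x \<in> S \<Longrightarrow> (f has_derivative f' x) (at x)"
    and k: "\<And>v. Ck_on k S (\<lambda>x. f' x v)"
  shows "Ck_on (Suc k) S f"
proof -
  have "frechet_derivative f (at x) = f' x" if "x \<in> S" for x
    using frechet_derivative_at[OF f[OF that]] by simp
  then have "Ck_on k S (\<lambda>x. frechet_derivative f (at x) v)" for v
    using Ck_on_cong_imp[OF S k, of v "\<lambda>x. frechet_derivative f (at x) v"] by simp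
  then show ?thesis using f by (auto simp: differentiable_def)
qed

lemma Ck_on_Suc_has_derivative:
  "Ck_on (Suc k) S f \<Longrightarrow> x \<in> S \<Longrightarrow> (f has_derivative frechet_derivative f (at x)) (at x)"
  using frechet_derivative_works by auto

lemma Ck_on_const: "open S \<Longrightarrow> Ck_on k S (\<lambda>_. c)"
proof (induction k arbitrary: c)
  case (Suc k)
  show ?case by (rule Ck_on_SucI[OF Suc.prems has_derivative_const]) (use Suc in auto)
qed simp

lemma Ck_on_add:
  "open S \<Longrightarrow> Ck_on k S f \<Longrightarrow> Ck_on k S g \<Longrightarrow> Ck_on k S (\<lambda>x. f x + g x)"
proof (induction k arbitrary: f g)
  case (Suc k)
  show ?case
    by (rule Ck_on_SucI[OF Suc.prems(1)
        has_derivative_add[OF Ck_on_Suc_has_derivative[OF Suc.prems(2)] Ck_on_Suc_has_derivative[OF Suc.prems(3)]]])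
      (use Suc.prems in \<open>auto intro: Suc.IH\<close>)
qed (auto intro: continuous_on_add)

lemma Ck_on_bounded_linear:
  assumes L: "bounded_linear L" and S: "open S"
  shows "Ck_on k S f \<Longrightarrow> Ck_on k S (\<lambda>x. L (f x))"
proof (induction k arbitrary: f)
  case 0
  then show ?case using bounded_linear.continuous_on[OF L] by simp
next
  case (Suc k)
  show ?case
    by (rule Ck_on_SucI[OF S bounded_linear.has_derivative[OF L Ck_on_Suc_has_derivative[OF Suc.prems]]])
      (use Suc in auto)
qed

lemma Ck_on_bounded_bilinear:
  assumes B: "bounded_bilinear B" and S: "open S"
  shows "Ck_on k S f \<Longrightarrow> Ck_on k S g \<Longrightarrow> Ck_on k S (\<lambda>x. B (f x) (g x))"
proof (induction k arbitrary: f g)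
  case 0
  then show ?case using bounded_bilinear.continuous_on[OF B] by simp
next
  case (Suc k)
  show ?case
    by (rule Ck_on_SucI[OF S bounded_bilinear.FDERIV[OF B Ck_on_Suc_has_derivative[OF Suc.prems(1)]
            Ck_on_Suc_has_derivative[OF Suc.prems(2)]]])
      (use Suc.prems Suc.prems[THEN Ck_on_SucD] in \<open>auto intro!: Ck_on_add[OF S] Suc.IH\<close>)
qed

lemma Ck_on_sum:
  assumes S: "open S"
  shows "finite I \<Longrightarrow> (\<And>i. i \<in> I \<Longrightarrow> Ck_on k S (f i)) \<Longrightarrow> Ck_on k S (\<lambda>x. \<Sum>i\<in>I. f i x)"
  by (induction I rule: finite_induct) (auto intro!: Ck_on_add[OF S] Ck_on_const[OF S])

lemma Ck_on_prod:
  fixes f :: "'i \<Rightarrow> 'a::real_normed_vector \<Rightarrow> real"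
  assumes S: "open S"
  shows "finite I \<Longrightarrow> (\<And>i. i \<in> I \<Longrightarrow> Ck_on k S (f i)) \<Longrightarrow> Ck_on k S (\<lambda>x. \<Prod>i\<in>I. f i x)"
  by (induction I rule: finite_induct)
    (auto intro!: Ck_on_bounded_bilinear[OF bounded_bilinear_mult S] Ck_on_const[OF S])

text \<open>The derivative of 1/f contains 1/f again, but it is needed there only in class k, which
  the induction hypothesis supplies.\<close>

lemma Ck_on_inverse:
  fixes f :: "'a::real_normed_vector \<Rightarrow> real"
  assumes S: "open S" and nz: "\<And>x. x \<in> S \<Longrightarrow> f x \<noteq> 0"
  shows "Ck_on k S f \<Longrightarrow> Ck_on k S (\<lambda>x. inverse (f x))"
proof (induction k)
  case 0
  then show ?case using nz by (auto intro!: continuous_on_inverse)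
next
  case (Suc k)
  have 1: "Ck_on k S (\<lambda>x. inverse (f x))" using Suc Ck_on_SucD by blast
  have 2: "Ck_on k S (\<lambda>x. frechet_derivative f (at x) v)" for v using Suc.prems by simp
  have 3: "Ck_on k S (\<lambda>x. - (inverse (f x) * frechet_derivative f (at x) v * inverse (f x)))" for v
    by (intro Ck_on_bounded_linear[OF bounded_linear_minus[OF bounded_linear_ident] S]
      Ck_on_bounded_bilinear[OF bounded_bilinear_mult S] 1 2)
  show ?case
    by (rule Ck_on_SucI[OF S Deriv.has_derivative_inverse[OF nz Ck_on_Suc_has_derivative[OF Suc.prems]]])
      (auto intro: 3)
qed

lemma Ck_on_compose:
  fixes f :: "'b::euclidean_space \<Rightarrow> 'c::real_normed_vector"
  assumes S: "open S" and gS: "g ` S \<subseteq> T"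
  shows "Ck_on k T f \<Longrightarrow> Ck_on k S g \<Longrightarrow> Ck_on k S (\<lambda>x. f (g x))"
proof (induction k arbitrary: f)
  case 0
  then show ?case using gS by (auto intro: continuous_on_compose2)
next
  case (Suc k)
  have lin: "linear (frechet_derivative f (at (g x)))" if "x \<in> S" for x
    using Suc.prems(1) gS that by (auto intro: linear_frechet_derivative)
  \<comment> \<open>In the chain rule the direction fed to the derivative of \<open>f\<close> varies
    with \<open>x\<close>, while \<open>Ck_on\<close> speaks of fixed directions. Expansion in the
    finite basis moves the variation into scalar coefficients.\<close>
  have "Ck_on k S (\<lambda>x. \<Sum>b\<in>Basis. (frechet_derivative g (at x) v \<bullet> b) *\<^sub>R frechet_derivative f (at (g x)) b)" for v
  proof (intro Ck_on_sum[OF S] finite_Basis Ck_on_bounded_bilinear[OF bounded_bilinear_scaleR S]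
      Ck_on_bounded_linear[OF bounded_linear_inner_left S])
    show "Ck_on k S (\<lambda>x. frechet_derivative g (at x) v)" using Suc.prems by simp
    show "Ck_on k S (\<lambda>x. frechet_derivative f (at (g x)) b)" for b
      using Suc.IH[of "\<lambda>y. frechet_derivative f (at y) b"] Suc.prems Ck_on_SucD by auto
  qed
  moreover have "(\<Sum>b\<in>Basis. (frechet_derivative g (at x) v \<bullet> b) *\<^sub>R frechet_derivative f (at (g x)) b)
      = frechet_derivative f (at (g x)) (frechet_derivative g (at x) v)" if "x \<in> S" for x v
    using linear_sum[OF lin[OF that]] linear_scale[OF lin[OF that]]
    by (subst (3) euclidean_representation[symmetric]) (auto intro!: sum.cong simp: linear_sum[OF lin[OF that]] linear_scale[OF lin[OF that]])
  ultimately have k: "Ck_on k S (\<lambda>x. frechet_derivative f (at (g x)) (frechet_derivative g (at x) v))" for v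
    using Ck_on_cong[OF S] by (metis (no_types, lifting))
  show ?case
  proof (rule Ck_on_SucI[OF S _ k])
    fix x assume x: "x \<in> S"
    then have "(f has_derivative frechet_derivative f (at (g x))) (at (g x))"
      using gS Suc.prems(1) by (intro Ck_on_Suc_has_derivative) auto
    then show "((\<lambda>x. f (g x)) has_derivative (\<lambda>v. frechet_derivative f (at (g x)) (frechet_derivative g (at x) v))) (at x)"
      using diff_chain_at[OF Ck_on_Suc_has_derivative[OF Suc.prems(2) x]]
      by (simp add: o_def)
  qed
qed

section \<open>Infinitely differentiable maps\<close>

lemma smooth_on_cong: "open S \<Longrightarrow> (\<And>x. x \<in> S \<Longrightarrow> f x = g x) \<Longrightarrow> smooth_on S f \<longleftrightarrow> smooth_on S g"
  unfolding smooth_on_def using Ck_on_cong by blast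

lemma smooth_on_subset: "smooth_on S f \<Longrightarrow> T \<subseteq> S \<Longrightarrow> smooth_on T f"
  unfolding smooth_on_def using Ck_on_subset by blast

lemma smooth_on_differentiable: "smooth_on S f \<Longrightarrow> x \<in> S \<Longrightarrow> f differentiable (at x)"
  unfolding smooth_on_def by (metis Ck_on.simps(2))

lemma smooth_on_has_derivative:
  "smooth_on S f \<Longrightarrow> x \<in> S \<Longrightarrow> (f has_derivative frechet_derivative f (at x)) (at x)"
  using smooth_on_differentiable frechet_derivative_works by blast

lemma smooth_on_linear_deriv: "smooth_on S f \<Longrightarrow> x \<in> S \<Longrightarrow> linear (frechet_derivative f (at x))"
  using smooth_on_differentiable linear_frechet_derivative by blast

lemma smooth_on_continuous_on: "smooth_on S f \<Longrightarrow> continuous_on S f"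
  unfolding smooth_on_def using Ck_on_imp_continuous_on by blast

lemma smooth_on_deriv: "smooth_on S f \<Longrightarrow> smooth_on S (\<lambda>x. frechet_derivative f (at x) v)"
  unfolding smooth_on_def by (metis Ck_on.simps(2))

lemma smooth_on_const: "open S \<Longrightarrow> smooth_on S (\<lambda>_. c)"
  unfolding smooth_on_def using Ck_on_const by blast

lemma smooth_on_add: "open S \<Longrightarrow> smooth_on S f \<Longrightarrow> smooth_on S g \<Longrightarrow> smooth_on S (\<lambda>x. f x + g x)"
  unfolding smooth_on_def using Ck_on_add by blast

lemma smooth_on_bounded_linear: "bounded_linear L \<Longrightarrow> open S \<Longrightarrow> smooth_on S f \<Longrightarrow> smooth_on S (\<lambda>x. L (f x))"
  unfolding smooth_on_def using Ck_on_bounded_linear by blast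

lemma smooth_on_bounded_bilinear:
  "bounded_bilinear B \<Longrightarrow> open S \<Longrightarrow> smooth_on S f \<Longrightarrow> smooth_on S g \<Longrightarrow> smooth_on S (\<lambda>x. B (f x) (g x))"
  unfolding smooth_on_def using Ck_on_bounded_bilinear by blast

lemma smooth_on_id:
  assumes "open S"
  shows "smooth_on S (\<lambda>x. x)"
proof -
  have "Ck_on k S (\<lambda>x. x)" for k
  proof (cases k)
    case (Suc n)
    show ?thesis unfolding Suc
      by (rule Ck_on_SucI[OF assms has_derivative_ident]) (rule Ck_on_const[OF assms])
  qed simp
  then show ?thesis unfolding smooth_on_def by blast
qed

lemma smooth_on_linear:
  fixes L :: "'a::euclidean_space \<Rightarrow> 'b::real_normed_vector"
  shows "linear L \<Longrightarrow> open S \<Longrightarrow> smooth_on S f \<Longrightarrow> smooth_on S (\<lambda>x. L (f x))"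
  using smooth_on_bounded_linear linear_conv_bounded_linear by blast

lemma smooth_on_minus: "open S \<Longrightarrow> smooth_on S f \<Longrightarrow> smooth_on S (\<lambda>x. - f x)"
  using smooth_on_bounded_linear[OF bounded_linear_minus[OF bounded_linear_ident]] .

lemma smooth_on_diff: "open S \<Longrightarrow> smooth_on S f \<Longrightarrow> smooth_on S g \<Longrightarrow> smooth_on S (\<lambda>x. f x - g x)"
  using smooth_on_add[OF _ _ smooth_on_minus, of S f g] by simp

lemma smooth_on_mult:
  fixes f :: "'a::real_normed_vector \<Rightarrow> real"
  shows "open S \<Longrightarrow> smooth_on S f \<Longrightarrow> smooth_on S g \<Longrightarrow> smooth_on S (\<lambda>x. f x * g x)"
  using smooth_on_bounded_bilinear[OF bounded_bilinear_mult] .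

lemma smooth_on_scaleR:
  "open S \<Longrightarrow> smooth_on S f \<Longrightarrow> smooth_on S g \<Longrightarrow> smooth_on S (\<lambda>x. f x *\<^sub>R g x)"
  using smooth_on_bounded_bilinear[OF bounded_bilinear_scaleR] .

lemma smooth_on_sum:
  "open S \<Longrightarrow> finite I \<Longrightarrow> (\<And>i. i \<in> I \<Longrightarrow> smooth_on S (f i)) \<Longrightarrow> smooth_on S (\<lambda>x. \<Sum>i\<in>I. f i x)"
  unfolding smooth_on_def using Ck_on_sum by blast

lemma smooth_on_prod:
  fixes f :: "'i \<Rightarrow> 'a::real_normed_vector \<Rightarrow> real"
  shows "open S \<Longrightarrow> finite I \<Longrightarrow> (\<And>i. i \<in> I \<Longrightarrow> smooth_on S (f i)) \<Longrightarrow> smooth_on S (\<lambda>x. \<Prod>i\<in>I. f i x)"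
  unfolding smooth_on_def using Ck_on_prod by blast

lemma smooth_on_divide:
  fixes f :: "'a::real_normed_vector \<Rightarrow> real"
  assumes "open S" "smooth_on S f" "smooth_on S g" "\<And>x. x \<in> S \<Longrightarrow> g x \<noteq> 0"
  shows "smooth_on S (\<lambda>x. f x / g x)"
  unfolding divide_inverse
  using assms Ck_on_inverse[of S g] by (intro smooth_on_mult) (simp_all add: smooth_on_def)

lemma smooth_on_compose:
  fixes f :: "'b::euclidean_space \<Rightarrow> 'c::real_normed_vector"
  shows "open S \<Longrightarrow> smooth_on T f \<Longrightarrow> smooth_on S g \<Longrightarrow> g ` S \<subseteq> T \<Longrightarrow> smooth_on S (\<lambda>x. f (g x))"
  unfolding smooth_on_def using Ck_on_compose by blast

lemma smooth_on_component: "open S \<Longrightarrow> smooth_on S f \<Longrightarrow> smooth_on S (\<lambda>x. f x $ i)"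
  using smooth_on_bounded_linear[OF bounded_linear_vec_nth] .

lemma smooth_on_vec:
  fixes f :: "'a::real_normed_vector \<Rightarrow> real^'n"
  assumes S: "open S" and f: "\<And>i. smooth_on S (\<lambda>x. f x $ i)"
  shows "smooth_on S f"
proof -
  have "smooth_on S (\<lambda>x. \<Sum>i\<in>UNIV. f x $ i *\<^sub>R (axis i 1 :: real^'n))"
    by (intro smooth_on_sum smooth_on_scaleR S f smooth_on_const) auto
  moreover have "(\<Sum>i\<in>UNIV. f x $ i *\<^sub>R (axis i 1 :: real^'n)) = f x" for x
    by (simp add: vec_eq_iff axis_def if_distrib cong: if_cong)
  ultimately show ?thesis by simp
qed

text \<open>The derivative of an inverse map is a vector field composed with the inverse map itself, so
  its differentiability class can be raised step by step.\<close>

lemma smooth_on_bootstrap: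
  fixes \<psi> :: "'a::real_normed_vector \<Rightarrow> 'b::euclidean_space"
  assumes T: "open T" and \<psi>T: "\<psi> ` T \<subseteq> S"
    and der: "\<And>z. z \<in> T \<Longrightarrow> (\<psi> has_derivative (\<lambda>v. U v (\<psi> z))) (at z)"
    and U: "\<And>v. smooth_on S (U v)"
  shows "smooth_on T \<psi>"
proof -
  have "Ck_on k T \<psi>" for k
  proof (induction k)
    case 0
    show ?case using der by (auto intro!: continuous_at_imp_continuous_on intro: has_derivative_continuous)
  next
    case (Suc k)
    have "Ck_on k T (\<lambda>z. U v (\<psi> z))" for v
      using Ck_on_compose[OF T \<psi>T _ Suc] U unfolding smooth_on_def by blast
    then show ?case using Ck_on_SucI[OF T der] by blast
  qed
  then show ?thesis unfolding smooth_on_def by blast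
qed

text \<open>Cramer's rule writes each coefficient as a quotient of determinants with smooth entries.
  It upgrades coefficient functions that are given only pointwise; the smoothness of the metric, of
  the connection coefficients and of \<open>lam\<close>, \<open>mu\<close>, \<open>eta\<close> all
  rests on it.\<close>

lemma smooth_on_coefficient:
  fixes B :: "'n::finite \<Rightarrow> 'a::real_normed_vector \<Rightarrow> real^'n"
  assumes S: "open S" and B: "\<And>j. smooth_on S (B j)" and \<Phi>: "smooth_on S \<Phi>"
    and indep: "\<And>x d. x \<in> S \<Longrightarrow> (\<Sum>j\<in>UNIV. d j *\<^sub>R B j x) = 0 \<Longrightarrow> (\<forall>j. d j = 0)"
    and eq: "\<And>x. x \<in> S \<Longrightarrow> \<Phi> x = (\<Sum>j\<in>UNIV. c j x *\<^sub>R B j x)"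
  shows "smooth_on S (c k)"
proof -
  define M where "M x = (\<chi> i j. B j x $ i)" for x
  have Mv: "M x *v v = (\<Sum>j\<in>UNIV. v $ j *\<^sub>R B j x)" for x v
    by (simp add: M_def matrix_vector_mult_def vec_eq_iff mult.commute)
  have nz: "det (M x) \<noteq> 0" if x: "x \<in> S" for x
  proof -
    have "inj ((*v) (M x))"
    proof (rule linear_injective_0[THEN iffD2, OF matrix_vector_mul_linear, rule_format])
      fix v assume "M x *v v = 0"
      then have "\<forall>j. v $ j = 0" using indep[OF x, of "\<lambda>j. v $ j"] Mv by simp
      then show "v = 0" by (simp add: vec_eq_iff)
    qed
    then show ?thesis
      by (metis det_nz_iff_inj matrix_of_matrix_vector_mul matrix_vector_mul_linear)
  qed
  have sd: "smooth_on S (\<lambda>x. det (N x))" if N: "\<And>i j. smooth_on S (\<lambda>x. N x $ i $ j)"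
    for N :: "'a \<Rightarrow> real^'n^'n"
    unfolding det_def
    by (intro smooth_on_sum S smooth_on_mult smooth_on_const smooth_on_prod N) (auto simp: finite_permutations)
  have "smooth_on S (\<lambda>x. det (\<chi> i j. if j = k then \<Phi> x $ i else M x $ i $ j) / det (M x))"
  proof (intro smooth_on_divide S sd nz)
    fix i j
    show "smooth_on S (\<lambda>x. M x $ i $ j)"
      by (simp add: M_def smooth_on_component S B)
    then show "smooth_on S (\<lambda>x. (\<chi> i j. if j = k then \<Phi> x $ i else M x $ i $ j) $ i $ j)"
      by (cases "j = k") (simp_all add: smooth_on_component S \<Phi>)
  qed
  moreover have "det (\<chi> i j. if j = k then \<Phi> x $ i else M x $ i $ j) / det (M x) = c k x"
    if x: "x \<in> S" for x
  proof -
    have "M x *v (\<chi> j. c j x) = \<Phi> x" using Mv eq[OF x] by simp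
    then have "(\<chi> j. c j x) = (\<chi> k. det (\<chi> i j. if j = k then \<Phi> x $ i else M x $ i $ j) / det (M x))"
      using cramer[OF nz[OF x]] by blast
    then show ?thesis by (simp add: vec_eq_iff)
  qed
  ultimately show ?thesis using smooth_on_cong[OF S] by (metis (no_types, lifting))
qed

section \<open>Second derivatives and moving frames\<close>

text \<open>Two applications of the mean value theorem, first in the direction \<open>u\<close>,
  then in the direction \<open>v\<close>. The second difference itself is symmetric in
  \<open>u\<close> and \<open>v\<close>, and the next lemma exploits this.\<close>

lemma second_difference_mean_value:
  fixes f :: "'a::euclidean_space \<Rightarrow> real"
  assumes S: "open S" and f: "smooth_on S f" and h: "h > 0"
    and par: "\<And>s t. 0 \<le> s \<Longrightarrow> s \<le> h \<Longrightarrow> 0 \<le> t \<Longrightarrow> t \<le> h \<Longrightarrow> x + s *\<^sub>R u + t *\<^sub>R v \<in> S"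
  shows "\<exists>s t. 0 < s \<and> s < h \<and> 0 < t \<and> t < h \<and>
    f (x + h *\<^sub>R u + h *\<^sub>R v) - f (x + h *\<^sub>R u) - f (x + h *\<^sub>R v) + f x =
    h * h * frechet_derivative (\<lambda>z. frechet_derivative f (at z) u) (at (x + s *\<^sub>R u + t *\<^sub>R v)) v"
proof -
  have line: "((\<lambda>s. g (p + s *\<^sub>R w)) has_real_derivative frechet_derivative g (at (p + s *\<^sub>R w)) w) (at s)"
    if g: "smooth_on S g" and p: "p + s *\<^sub>R w \<in> S" for g :: "'a \<Rightarrow> real" and p w s
  proof -
    have "((\<lambda>s. p + s *\<^sub>R w) has_derivative (\<lambda>s. s *\<^sub>R w)) (at s)"
      by (auto intro!: derivative_eq_intros)
    from diff_chain_at[OF this smooth_on_has_derivative[OF g p]]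
    have "((\<lambda>s. g (p + s *\<^sub>R w)) has_derivative (\<lambda>r. frechet_derivative g (at (p + s *\<^sub>R w)) (r *\<^sub>R w))) (at s)"
      by (simp add: o_def)
    then show ?thesis
      using linear_scale[OF smooth_on_linear_deriv[OF g p]]
      by (simp add: has_field_derivative_def mult_commute_abs)
  qed
  define g where "g s = f (x + h *\<^sub>R v + s *\<^sub>R u) - f (x + s *\<^sub>R u)" for s
  have "\<exists>s>0. s < h \<and> g h - g 0 = (h - 0) * (frechet_derivative f (at (x + h *\<^sub>R v + s *\<^sub>R u)) u
      - frechet_derivative f (at (x + s *\<^sub>R u)) u)"
  proof (rule MVT2[OF h])
    fix s assume "0 \<le> s" "s \<le> h"
    then show "(g has_real_derivative frechet_derivative f (at (x + h *\<^sub>R v + s *\<^sub>R u)) u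
      - frechet_derivative f (at (x + s *\<^sub>R u)) u) (at s)"
      unfolding g_def using par[of s h] par[of s 0] h
      by (intro DERIV_diff line f) (auto simp: algebra_simps)
  qed
  then obtain s where s: "0 < s" "s < h"
    "g h - g 0 = h * (frechet_derivative f (at (x + h *\<^sub>R v + s *\<^sub>R u)) u - frechet_derivative f (at (x + s *\<^sub>R u)) u)"
    by auto
  define k where "k t = frechet_derivative f (at (x + s *\<^sub>R u + t *\<^sub>R v)) u" for t
  have "\<exists>t>0. t < h \<and> k h - k 0 = (h - 0) *
      frechet_derivative (\<lambda>z. frechet_derivative f (at z) u) (at (x + s *\<^sub>R u + t *\<^sub>R v)) v"
  proof (rule MVT2[OF h])
    fix t assume "0 \<le> t" "t \<le> h"
    then show "(k has_real_derivative
      frechet_derivative (\<lambda>z. frechet_derivative f (at z) u) (at (x + s *\<^sub>R u + t *\<^sub>R v)) v) (at t)"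
      unfolding k_def using par[of s t] s
      by (intro line smooth_on_deriv f) auto
  qed
  then obtain t where t: "0 < t" "t < h" "k h - k 0 = h *
      frechet_derivative (\<lambda>z. frechet_derivative f (at z) u) (at (x + s *\<^sub>R u + t *\<^sub>R v)) v"
    by auto
  have "g h - g 0 = h * (k h - k 0)" using s(3) by (simp add: k_def algebra_simps)
  then have "g h - g 0 = h * h *
      frechet_derivative (\<lambda>z. frechet_derivative f (at z) u) (at (x + s *\<^sub>R u + t *\<^sub>R v)) v"
    using t(3) by simp
  moreover have "g h - g 0 = f (x + h *\<^sub>R u + h *\<^sub>R v) - f (x + h *\<^sub>R u) - f (x + h *\<^sub>R v) + f x"
    by (simp add: g_def algebra_simps)
  ultimately show ?thesis using s t by metis
qed

text \<open>Swapping \<open>u\<close> and \<open>v\<close> in the preceding lemma yields two points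
  near \<open>x\<close>, one for each order of differentiation, at which the two mixed derivatives
  coincide. Their continuity at \<open>x\<close> rules out a gap there.\<close>

lemma second_derivative_commute_real:
  fixes f :: "'a::euclidean_space \<Rightarrow> real"
  assumes S: "open S" and f: "smooth_on S f" and x: "x \<in> S"
  shows "frechet_derivative (\<lambda>z. frechet_derivative f (at z) u) (at x) v =
    frechet_derivative (\<lambda>z. frechet_derivative f (at z) v) (at x) u"
proof (rule ccontr)
  define A where "A u v y = frechet_derivative (\<lambda>z. frechet_derivative f (at z) u) (at y) v" for u v y
  assume "\<not> ?thesis"
  then have ne: "A u v x \<noteq> A v u x" by (simp add: A_def)
  define \<epsilon> where "\<epsilon> = \<bar>A u v x - A v u x\<bar> / 2"
  have \<epsilon>: "\<epsilon> > 0" using ne by (simp add: \<epsilon>_def)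
  have cont: "isCont (A u v) x" for u v
    unfolding A_def using smooth_on_continuous_on[OF smooth_on_deriv[OF smooth_on_deriv[OF f]]] S x
    by (simp add: continuous_on_eq_continuous_at)
  obtain d where d: "d > 0" "ball x d \<subseteq> S"
    "\<And>y. dist y x < d \<Longrightarrow> dist (A u v y) (A u v x) < \<epsilon>"
    "\<And>y. dist y x < d \<Longrightarrow> dist (A v u y) (A v u x) < \<epsilon>"
  proof -
    obtain d1 where "d1 > 0" "ball x d1 \<subseteq> S" using S x openE by blast
    moreover obtain d2 where "d2 > 0" "\<And>y. dist y x < d2 \<Longrightarrow> dist (A u v y) (A u v x) < \<epsilon>"
      using cont[of u v] \<epsilon> unfolding continuous_at_eps_delta by blast
    moreover obtain d3 where "d3 > 0" "\<And>y. dist y x < d3 \<Longrightarrow> dist (A v u y) (A v u x) < \<epsilon>"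
      using cont[of v u] \<epsilon> unfolding continuous_at_eps_delta by blast
    ultimately show ?thesis by (intro that[of "min d1 (min d2 d3)"]) auto
  qed
  \<comment> \<open>The summand 1 keeps \<open>n\<close> positive when both vectors vanish; with h =
    d / (2 n) the whole parallelogram stays within distance d/2 of \<open>x\<close>.\<close>
  define n where "n = norm u + norm v + 1"
  define h where "h = d / (2 * n)"
  have np: "n > 0" unfolding n_def by (smt (verit) norm_ge_zero)
  have h: "h > 0" using d np by (simp add: h_def)
  have near: "dist (x + s *\<^sub>R u + t *\<^sub>R v) x < d" if "0 \<le> s" "s \<le> h" "0 \<le> t" "t \<le> h" for s t
  proof -
    have "norm (s *\<^sub>R u + t *\<^sub>R v) \<le> \<bar>s\<bar> * norm u + \<bar>t\<bar> * norm v"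
      using norm_triangle_ineq[of "s *\<^sub>R u" "t *\<^sub>R v"] by simp
    also have "\<dots> \<le> h * norm u + h * norm v"
      using that by (intro add_mono mult_right_mono) auto
    also have "\<dots> \<le> h * n" using h by (simp add: n_def algebra_simps)
    also have "\<dots> < d" using d np by (simp add: h_def)
    finally show ?thesis by (simp add: dist_norm add.assoc)
  qed
  have near': "dist (x + s *\<^sub>R v + t *\<^sub>R u) x < d" if "0 \<le> s" "s \<le> h" "0 \<le> t" "t \<le> h" for s t
    using near[OF that(3,4,1,2)] by (simp add: add_ac)
  have in1: "x + s *\<^sub>R u + t *\<^sub>R v \<in> S" if "0 \<le> s" "s \<le> h" "0 \<le> t" "t \<le> h" for s t
    using near[OF that] d(2) by (auto simp: dist_commute)
  have in2: "x + s *\<^sub>R v + t *\<^sub>R u \<in> S" if "0 \<le> s" "s \<le> h" "0 \<le> t" "t \<le> h" for s t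
    using near'[OF that] d(2) by (auto simp: dist_commute)
  let ?D = "f (x + h *\<^sub>R u + h *\<^sub>R v) - f (x + h *\<^sub>R u) - f (x + h *\<^sub>R v) + f x"
  obtain s t where st: "0 < s" "s < h" "0 < t" "t < h" "?D = h * h * A u v (x + s *\<^sub>R u + t *\<^sub>R v)"
    using second_difference_mean_value[OF S f h, of x u v] in1 unfolding A_def by blast
  obtain s' t' where st': "0 < s'" "s' < h" "0 < t'" "t' < h"
    "f (x + h *\<^sub>R v + h *\<^sub>R u) - f (x + h *\<^sub>R v) - f (x + h *\<^sub>R u) + f x = h * h * A v u (x + s' *\<^sub>R v + t' *\<^sub>R u)"
    using second_difference_mean_value[OF S f h, of x v u] in2 unfolding A_def by blast
  have "?D = h * h * A v u (x + s' *\<^sub>R v + t' *\<^sub>R u)"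
    using st'(5) by (simp add: add_ac algebra_simps)
  then have "A u v (x + s *\<^sub>R u + t *\<^sub>R v) = A v u (x + s' *\<^sub>R v + t' *\<^sub>R u)"
    using st(5) h by simp
  moreover have "dist (A u v (x + s *\<^sub>R u + t *\<^sub>R v)) (A u v x) < \<epsilon>"
    using d(3) near st by auto
  moreover have "dist (A v u (x + s' *\<^sub>R v + t' *\<^sub>R u)) (A v u x) < \<epsilon>"
    using d(4) near' st' by auto
  ultimately show False unfolding \<epsilon>_def dist_real_def by (smt (verit) field_sum_of_halves)
qed

lemma frechet_derivative_bounded_linear:
  assumes "bounded_linear L" "f differentiable (at x)"
  shows "frechet_derivative (\<lambda>z. L (f z)) (at x) v = L (frechet_derivative f (at x) v)"
  using frechet_derivative_at[OF bounded_linear.has_derivative[OF assms(1)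
    assms(2)[unfolded frechet_derivative_works]]] by metis

lemma second_derivative_commute:
  fixes f :: "'a::euclidean_space \<Rightarrow> 'b::euclidean_space"
  assumes S: "open S" and f: "smooth_on S f" and x: "x \<in> S"
  shows "frechet_derivative (\<lambda>z. frechet_derivative f (at z) u) (at x) v =
    frechet_derivative (\<lambda>z. frechet_derivative f (at z) v) (at x) u"
proof (rule euclidean_eqI)
  fix b :: 'b
  have bl: "bounded_linear (\<lambda>w. w \<bullet> b)" by (rule bounded_linear_inner_left)
  have sb: "smooth_on S (\<lambda>z. f z \<bullet> b)" by (rule smooth_on_bounded_linear[OF bl S f])
  have 1: "frechet_derivative (\<lambda>z. f z \<bullet> b) (at z) u = frechet_derivative f (at z) u \<bullet> b" if "z \<in> S" for u z
    by (rule frechet_derivative_bounded_linear[OF bl smooth_on_differentiable[OF f that]])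
  have 2: "frechet_derivative (\<lambda>z. frechet_derivative (\<lambda>z. f z \<bullet> b) (at z) u) (at x) v =
     frechet_derivative (\<lambda>z. frechet_derivative f (at z) u) (at x) v \<bullet> b" for u v
  proof -
    have "frechet_derivative (\<lambda>z. frechet_derivative (\<lambda>z. f z \<bullet> b) (at z) u) (at x) =
       frechet_derivative (\<lambda>z. frechet_derivative f (at z) u \<bullet> b) (at x)"
      by (rule frechet_derivative_transform_within_open[OF smooth_on_differentiable[OF smooth_on_deriv[OF sb] x] S x])
        (rule 1)
    then show ?thesis
      using frechet_derivative_bounded_linear[OF bl smooth_on_differentiable[OF smooth_on_deriv[OF f] x]] by simp
  qed
  show "frechet_derivative (\<lambda>z. frechet_derivative f (at z) u) (at x) v \<bullet> b =
    frechet_derivative (\<lambda>z. frechet_derivative f (at z) v) (at x) u \<bullet> b"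
    using second_derivative_commute_real[OF S sb x, of u v] 2 by simp
qed

text \<open>A product rule for a varying linear map applied to a moving vector. Smoothness of
  \<open>A\<close> is available only for each fixed argument, so the argument is expanded in the
  basis. It is applied to differentials of maps and to each slot of the affine metric.\<close>

lemma
  fixes A :: "'a::euclidean_space \<Rightarrow> 'v::euclidean_space \<Rightarrow> 'w::real_normed_vector"
  assumes S: "open S" and lin: "\<And>z. z \<in> S \<Longrightarrow> linear (A z)"
    and A: "\<And>w. smooth_on S (\<lambda>z. A z w)" and X: "smooth_on S X"
  shows smooth_on_linear_family: "smooth_on S (\<lambda>z. A z (X z))"
    and frechet_derivative_linear_family: "x \<in> S \<Longrightarrow>
      frechet_derivative (\<lambda>z. A z (X z)) (at x) v =
      frechet_derivative (\<lambda>z. A z (X x)) (at x) v + A x (frechet_derivative X (at x) v)"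
proof -
  have expand: "A z w = (\<Sum>b\<in>Basis. (w \<bullet> b) *\<^sub>R A z b)" if "z \<in> S" for z w
    using linear_sum[OF lin[OF that], of "\<lambda>b. (w \<bullet> b) *\<^sub>R b" Basis]
      linear_scale[OF lin[OF that]] by (simp add: euclidean_representation)
  have "smooth_on S (\<lambda>z. \<Sum>b\<in>Basis. (X z \<bullet> b) *\<^sub>R A z b)"
    by (intro smooth_on_sum S finite_Basis smooth_on_scaleR smooth_on_bounded_linear[OF bounded_linear_inner_left] X A)
  then show "smooth_on S (\<lambda>z. A z (X z))"
    using smooth_on_cong[OF S, of "\<lambda>z. A z (X z)" "\<lambda>z. \<Sum>b\<in>Basis. (X z \<bullet> b) *\<^sub>R A z b"] expand by metis
  assume x: "x \<in> S"
  have d: "((\<lambda>z. \<Sum>b\<in>Basis. (Y z \<bullet> b) *\<^sub>R A z b) has_derivative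
      (\<lambda>v. \<Sum>b\<in>Basis. (Y x \<bullet> b) *\<^sub>R frechet_derivative (\<lambda>z. A z b) (at x) v +
         (frechet_derivative Y (at x) v \<bullet> b) *\<^sub>R A x b)) (at x)" if Y: "smooth_on S Y" for Y
    by (intro has_derivative_sum has_derivative_scaleR
       bounded_linear.has_derivative[OF bounded_linear_inner_left] smooth_on_has_derivative[OF Y x]
       smooth_on_has_derivative[OF A x])
  have e: "frechet_derivative (\<lambda>z. A z (Y z)) (at x) v =
     (\<Sum>b\<in>Basis. (Y x \<bullet> b) *\<^sub>R frechet_derivative (\<lambda>z. A z b) (at x) v +
         (frechet_derivative Y (at x) v \<bullet> b) *\<^sub>R A x b)" if Y: "smooth_on S Y" for Y
  proof -
    have "((\<lambda>z. A z (Y z)) has_derivative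
      (\<lambda>v. \<Sum>b\<in>Basis. (Y x \<bullet> b) *\<^sub>R frechet_derivative (\<lambda>z. A z b) (at x) v +
         (frechet_derivative Y (at x) v \<bullet> b) *\<^sub>R A x b)) (at x)"
      by (rule has_derivative_transform_within_open[OF d[OF Y] S x]) (rule expand[symmetric])
    from fun_cong[OF frechet_derivative_at[OF this], of v, symmetric] show ?thesis .
  qed
  show "frechet_derivative (\<lambda>z. A z (X z)) (at x) v =
      frechet_derivative (\<lambda>z. A z (X x)) (at x) v + A x (frechet_derivative X (at x) v)"
    unfolding e[OF X] e[OF smooth_on_const[OF S], of "X x"] expand[OF x, of "frechet_derivative X (at x) v"]
    by (simp add: sum.distrib)
qed

lemma frechet_derivative_deriv_along:
  fixes f :: "'a::euclidean_space \<Rightarrow> 'b::real_normed_vector"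
  assumes S: "open S" and f: "smooth_on S f" and X: "smooth_on S X" and x: "x \<in> S"
  shows "frechet_derivative (\<lambda>z. frechet_derivative f (at z) (X z)) (at x) v =
    frechet_derivative (\<lambda>z. frechet_derivative f (at z) (X x)) (at x) v +
    frechet_derivative f (at x) (frechet_derivative X (at x) v)"
  by (rule frechet_derivative_linear_family[OF S smooth_on_linear_deriv[OF f] smooth_on_deriv[OF f] X x])

section \<open>Calculus along a moving frame\<close>

locale frame_on =
  fixes V :: "(real^3) set" and e :: "3 \<Rightarrow> real^3 \<Rightarrow> real^3"
  assumes open_V: "open V"
    and smooth_e: "smooth_on V (e i)"
    and indep_e: "y \<in> V \<Longrightarrow> (\<Sum>i\<in>UNIV. d i *\<^sub>R e i y) = 0 \<Longrightarrow> d j = 0"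
begin

definition dd :: "3 \<Rightarrow> (real^3 \<Rightarrow> 'b::real_normed_vector) \<Rightarrow> real^3 \<Rightarrow> 'b" where
  "dd i \<Phi> y = frechet_derivative \<Phi> (at y) (e i y)"

lemma smooth_dd: "smooth_on V \<Phi> \<Longrightarrow> smooth_on V (dd i \<Phi>)"
  unfolding dd_def[abs_def]
  by (rule smooth_on_linear_family[OF open_V smooth_on_linear_deriv smooth_on_deriv smooth_e])

lemma dd_eqI: "(\<Phi> has_derivative D) (at y) \<Longrightarrow> dd i \<Phi> y = D (e i y)"
  unfolding dd_def using frechet_derivative_at by metis

lemma dd_const: "dd i (\<lambda>_. c) y = 0"
  by (simp add: dd_def)

lemma dd_cong:
  assumes "smooth_on V \<Phi>" "y \<in> V" "\<And>z. z \<in> V \<Longrightarrow> \<Phi> z = \<Psi> z"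
  shows "dd i \<Phi> y = dd i \<Psi> y"
  unfolding dd_def
  using frechet_derivative_transform_within_open[OF smooth_on_differentiable[OF assms(1,2)] open_V assms(2,3)]
  by simp

lemma dd_zero:
  assumes "y \<in> V" "\<And>z. z \<in> V \<Longrightarrow> \<Phi> z = c"
  shows "dd i \<Phi> y = 0"
  using dd_cong[OF smooth_on_const[OF open_V] assms(1), of c \<Phi>] assms(2) dd_const by metis

lemma
  assumes f: "smooth_on V f" and g: "smooth_on V g" and y: "y \<in> V"
  shows dd_add: "dd i (\<lambda>z. f z + g z) y = dd i f y + dd i g y"
    and dd_diff: "dd i (\<lambda>z. f z - g z) y = dd i f y - dd i g y"
  using dd_eqI[OF has_derivative_add[OF smooth_on_has_derivative[OF f y] smooth_on_has_derivative[OF g y]]]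
    dd_eqI[OF has_derivative_diff[OF smooth_on_has_derivative[OF f y] smooth_on_has_derivative[OF g y]]]
  by (simp_all add: dd_def)

lemma dd_sum:
  assumes f: "\<And>k. k \<in> I \<Longrightarrow> smooth_on V (f k)" and y: "y \<in> V"
  shows "dd i (\<lambda>z. \<Sum>k\<in>I. f k z) y = (\<Sum>k\<in>I. dd i (f k) y)"
  using dd_eqI[OF has_derivative_sum[OF smooth_on_has_derivative[OF f y]]] by (simp add: dd_def)

lemma dd_linear:
  assumes L: "bounded_linear L" and f: "smooth_on V f" and y: "y \<in> V"
  shows "dd i (\<lambda>z. L (f z)) y = L (dd i f y)"
  unfolding dd_def by (rule frechet_derivative_bounded_linear[OF L smooth_on_differentiable[OF f y]])

lemma dd_component: "smooth_on V f \<Longrightarrow> y \<in> V \<Longrightarrow> dd i (\<lambda>z. f z $ k) y = dd i f y $ k"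
  by (rule dd_linear[OF bounded_linear_vec_nth])

lemma dd_minus: "smooth_on V f \<Longrightarrow> y \<in> V \<Longrightarrow> dd i (\<lambda>z. - f z) y = - dd i f y"
  by (rule dd_linear[OF bounded_linear_minus[OF bounded_linear_ident]])

lemma dd_scaleR:
  assumes f: "smooth_on V f" and g: "smooth_on V g" and y: "y \<in> V"
  shows "dd i (\<lambda>z. f z *\<^sub>R g z) y = dd i f y *\<^sub>R g y + f y *\<^sub>R dd i g y"
  using dd_eqI[OF has_derivative_scaleR[OF smooth_on_has_derivative[OF f y] smooth_on_has_derivative[OF g y]]]
  by (simp add: dd_def)

lemma dd_mult:
  fixes f g :: "real^3 \<Rightarrow> real"
  assumes f: "smooth_on V f" and g: "smooth_on V g" and y: "y \<in> V"
  shows "dd i (\<lambda>z. f z * g z) y = dd i f y * g y + f y * dd i g y"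
  using dd_scaleR[OF assms] by simp

lemma dd_divide:
  fixes f g :: "real^3 \<Rightarrow> real"
  assumes f: "smooth_on V f" and g: "smooth_on V g" and y: "y \<in> V" and nz: "\<And>z. z \<in> V \<Longrightarrow> g z \<noteq> 0"
  shows "dd i (\<lambda>z. f z / g z) y = (dd i f y * g y - f y * dd i g y) / (g y)\<^sup>2"
proof -
  have q: "smooth_on V (\<lambda>z. f z / g z)" by (rule smooth_on_divide[OF open_V f g nz])
  have "dd i f y = dd i (\<lambda>z. f z / g z * g z) y"
    using dd_cong[OF f y, of "\<lambda>z. f z / g z * g z"] nz by simp
  also have "\<dots> = dd i (\<lambda>z. f z / g z) y * g y + f y / g y * dd i g y"
    by (rule dd_mult[OF q g y])
  finally show ?thesis using nz[OF y] by (simp add: field_simps power2_eq_square)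
qed

text \<open>The second-order terms cancel by symmetry. What remains is the derivative along the
  bracket of \<open>e i\<close> and \<open>e j\<close>, whose coordinate expression is the argument
  on the right.\<close>

lemma dd_commute:
  fixes \<Phi> :: "real^3 \<Rightarrow> 'b::euclidean_space"
  assumes \<Phi>: "smooth_on V \<Phi>" and y: "y \<in> V"
  shows "dd i (dd j \<Phi>) y - dd j (dd i \<Phi>) y =
    frechet_derivative \<Phi> (at y) (dd i (e j) y - dd j (e i) y)"
  unfolding dd_def[abs_def] frechet_derivative_deriv_along[OF open_V \<Phi> smooth_e y]
    linear_diff[OF smooth_on_linear_deriv[OF \<Phi> y]]
  using second_derivative_commute[OF open_V \<Phi> y, of "e j y" "e i y"] by simp

lemma span_e:
  assumes y: "y \<in> V"
  obtains d where "v = (\<Sum>i\<in>UNIV. d i *\<^sub>R e i y)"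
proof -
  define M where "M = (\<chi> i j. e j y $ i)"
  have Mv: "M *v v = (\<Sum>j\<in>UNIV. v $ j *\<^sub>R e j y)" for v
    by (simp add: M_def matrix_vector_mult_def vec_eq_iff mult.commute)
  have "inj ((*v) M)"
  proof (rule linear_injective_0[THEN iffD2, OF matrix_vector_mul_linear, rule_format])
    fix v assume "M *v v = 0"
    then have "\<forall>j. v $ j = 0" using indep_e[OF y, of "\<lambda>j. v $ j"] Mv by simp
    then show "v = 0" by (simp add: vec_eq_iff)
  qed
  then have "surj ((*v) M)" using linear_injective_imp_surjective by blast
  then obtain d where "v = M *v d" by (metis surjD)
  then show ?thesis using that[of "\<lambda>j. d $ j"] Mv by simp
qed

lemma dd_zero_imp_constant:
  fixes f :: "real^3 \<Rightarrow> 'b::real_normed_vector"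
  assumes f: "smooth_on V f" and V: "convex V" and z: "\<And>i y. y \<in> V \<Longrightarrow> dd i f y = 0"
    and x: "x \<in> V" "y \<in> V"
  shows "f x = f y"
proof (rule has_derivative_zero_unique[OF V _ x])
  fix y assume y: "y \<in> V"
  have "frechet_derivative f (at y) v = 0" for v
  proof -
    obtain d where v: "v = (\<Sum>i\<in>UNIV. d i *\<^sub>R e i y)" using span_e[OF y] .
    have "frechet_derivative f (at y) v = (\<Sum>i\<in>UNIV. d i *\<^sub>R dd i f y)"
      unfolding v dd_def using smooth_on_linear_deriv[OF f y] by (simp add: linear_sum linear_scale)
    then show ?thesis using z[OF y] by simp
  qed
  then have "frechet_derivative f (at y) = (\<lambda>_. 0)" by blast
  then show "(f has_derivative (\<lambda>_. 0)) (at y within V)"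
    using smooth_on_has_derivative[OF f y] has_derivative_at_withinI by metis
qed

text \<open>The functions \<open>c i\<close> are common logarithmic derivatives, so
  \<open>f / g\<close> is constant along the frame. In cross-multiplied form the lemma yields both
  vanishing everywhere from one zero and an identity from one normalised value. It takes the place
  of the uniqueness theorem for linear differential equations.\<close>

lemma proportional:
  fixes f g :: "real^3 \<Rightarrow> real"
  assumes f: "smooth_on V f" and g: "smooth_on V g" and V: "convex V"
    and nz: "\<And>z. z \<in> V \<Longrightarrow> g z \<noteq> 0"
    and df: "\<And>i y. y \<in> V \<Longrightarrow> dd i f y = c i y * f y"
    and dg: "\<And>i y. y \<in> V \<Longrightarrow> dd i g y = c i y * g y"
    and x: "x \<in> V" "y \<in> V"
  shows "f x * g y = f y * g x"
proof -
  have "f x / g x = f y / g y"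
  proof (rule dd_zero_imp_constant[OF smooth_on_divide[OF open_V f g nz] V _ x])
    fix i y assume y: "y \<in> V"
    show "dd i (\<lambda>x. f x / g x) y = 0"
      using dd_divide[OF f g y nz] df[OF y] dg[OF y] by simp
  qed
  then show ?thesis using nz x by (simp add: field_simps)
qed

end

section \<open>The structure equations of an equiaffine hypersurface\<close>

locale patch = frame_on V e for V :: "(real^3) set" and e :: "3 \<Rightarrow> real^3 \<Rightarrow> real^3" +
  fixes G \<xi> :: "real^3 \<Rightarrow> real^4"
  assumes smooth_G: "smooth_on V G" and smooth_\<xi>: "smooth_on V \<xi>"
    and inj_dG: "y \<in> V \<Longrightarrow> inj (frechet_derivative G (at y))"
    and transversal: "y \<in> V \<Longrightarrow> \<xi> y \<notin> range (frechet_derivative G (at y))"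
    and equiaffine: "y \<in> V \<Longrightarrow> range (frechet_derivative \<xi> (at y)) \<subseteq> range (frechet_derivative G (at y))"
begin

abbreviation dG :: "real^3 \<Rightarrow> real^3 \<Rightarrow> real^4" where
  "dG y \<equiv> frechet_derivative G (at y)"

definition E :: "3 \<Rightarrow> real^3 \<Rightarrow> real^4" where "E i = dd i G"

lemma E_eq: "E i y = dG y (e i y)"
  by (simp add: E_def dd_def)

lemma smooth_E: "smooth_on V (E i)"
  unfolding E_def by (rule smooth_dd[OF smooth_G])

lemma linear_dG: "y \<in> V \<Longrightarrow> linear (dG y)"
  by (rule smooth_on_linear_deriv[OF smooth_G])

lemma decomposition_unique:
  assumes y: "y \<in> V" and eq: "dG y Z + r *\<^sub>R \<xi> y = dG y Z' + r' *\<^sub>R \<xi> y"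
  shows "Z = Z'" "r = r'"
proof -
  have eq': "dG y (Z - Z') = (r' - r) *\<^sub>R \<xi> y"
    using eq by (simp add: linear_diff[OF linear_dG[OF y]] algebra_simps)
  show r: "r = r'"
  proof (rule ccontr)
    assume "r \<noteq> r'"
    then have "\<xi> y = dG y ((1 / (r' - r)) *\<^sub>R (Z - Z'))"
      unfolding linear_scale[OF linear_dG[OF y]] eq' by simp
    then show False using transversal[OF y] by blast
  qed
  then show "Z = Z'" using eq inj_dG[OF y] by (simp add: inj_eq)
qed

lemma decomposition_exists:
  assumes y: "y \<in> V"
  obtains Z r where "\<Phi> = dG y Z + r *\<^sub>R \<xi> y"
proof -
  define L :: "real^4 \<Rightarrow> real^4" where "L v = dG y (vector [v $ 1, v $ 2, v $ 3]) + (v $ 4) *\<^sub>R \<xi> y" for v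
  have v3: "vector [a + a', b + b', c + c'] = (vector [a, b, c] + vector [a', b', c'] :: real^3)"
    "vector [k * a, k * b, k * c] = k *\<^sub>R (vector [a, b, c] :: real^3)" for a b c a' b' c' k :: real
    by (simp_all add: vec_eq_iff forall_3)
  have "linear L"
    unfolding L_def
    by (rule linearI) (simp_all add: v3 linear_add[OF linear_dG[OF y]] linear_scale[OF linear_dG[OF y]] algebra_simps)
  moreover have "inj L"
  proof (rule injI)
    fix v w assume "L v = L w"
    from decomposition_unique[OF y this[unfolded L_def]]
    show "v = w" by (simp add: vec_eq_iff forall_3 forall_4)
  qed
  ultimately have "surj L" using linear_injective_imp_surjective by blast
  then obtain v where "\<Phi> = L v" by (metis surjD)
  then show ?thesis using that unfolding L_def by blast
qed

lemma frame_coefficients_unique: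
  assumes y: "y \<in> V"
    and eq: "(\<Sum>i\<in>UNIV. c i *\<^sub>R E i y) + r *\<^sub>R \<xi> y = (\<Sum>i\<in>UNIV. c' i *\<^sub>R E i y) + r' *\<^sub>R \<xi> y"
  shows "c i = c' i" "r = r'"
proof -
  have E: "(\<Sum>i\<in>UNIV. c i *\<^sub>R E i y) = dG y (\<Sum>i\<in>UNIV. c i *\<^sub>R e i y)" for c
    by (simp add: E_eq linear_sum[OF linear_dG[OF y]] linear_scale[OF linear_dG[OF y]])
  note u = decomposition_unique[OF y eq[unfolded E]]
  show "r = r'" by (rule u)
  have "(\<Sum>i\<in>UNIV. (c i - c' i) *\<^sub>R e i y) = 0"
    using u(1) by (simp add: scaleR_left_diff_distrib sum_subtractf)
  then show "c i = c' i" using indep_e[OF y, of "\<lambda>i. c i - c' i" i] by simp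
qed

lemma smooth_frame_coefficients:
  assumes \<Phi>: "smooth_on V \<Phi>"
    and eq: "\<And>y. y \<in> V \<Longrightarrow> \<Phi> y = (\<Sum>i\<in>UNIV. c i y *\<^sub>R E i y) + r y *\<^sub>R \<xi> y"
  shows "smooth_on V (c i)" "smooth_on V r"
proof -
  \<comment> \<open>The three tangent fields and the transversal field are relabelled as one family
    over the index type \<open>4\<close>, the format of \<open>smooth_on_coefficient\<close>;
    \<open>d\<close> relabels the coefficients accordingly.\<close>
  define B :: "4 \<Rightarrow> real^3 \<Rightarrow> real^4" where
    "B j = (if j = 1 then E 1 else if j = 2 then E 2 else if j = 3 then E 3 else \<xi>)" for j
  define d :: "4 \<Rightarrow> real^3 \<Rightarrow> real" where
    "d j = (if j = 1 then c 1 else if j = 2 then c 2 else if j = 3 then c 3 else r)" for j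
  have B: "smooth_on V (B j)" for j by (simp add: B_def smooth_E smooth_\<xi>)
  have d: "smooth_on V (d j)" for j
  proof (rule smooth_on_coefficient[OF open_V B \<Phi>])
    fix y and k :: "4 \<Rightarrow> real" assume y: "y \<in> V" and z: "(\<Sum>j\<in>UNIV. k j *\<^sub>R B j y) = 0"
    define k' :: "3 \<Rightarrow> real" where "k' i = (if i = 1 then k 1 else if i = 2 then k 2 else k 3)" for i
    have "(\<Sum>i\<in>UNIV. k' i *\<^sub>R E i y) + k 4 *\<^sub>R \<xi> y = (\<Sum>i\<in>UNIV. 0 *\<^sub>R E i y) + 0 *\<^sub>R \<xi> y"
      using z by (simp add: sum_3 sum_4 B_def k'_def)
    from frame_coefficients_unique[OF y this] have "k 4 = 0" "k' 1 = 0" "k' 2 = 0" "k' 3 = 0" by blast+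
    then show "\<forall>j. k j = 0" by (simp add: forall_4 k'_def)
  next
    fix y assume "y \<in> V"
    then show "\<Phi> y = (\<Sum>j\<in>UNIV. d j y *\<^sub>R B j y)"
      using eq by (simp add: sum_3 sum_4 B_def d_def)
  qed
  show "smooth_on V r" using d[of 4] by (simp add: d_def)
  have "smooth_on V (c 1)" "smooth_on V (c 2)" "smooth_on V (c 3)"
    using d[of 1] d[of 2] d[of 3] by (simp_all add: d_def)
  then show "smooth_on V (c i)" using exhaust_3[of i] by auto
qed

abbreviation h :: "real^3 \<Rightarrow> real^3 \<Rightarrow> real^3 \<Rightarrow> real" where
  "h \<equiv> affine_metric G \<xi>"

abbreviation D2 :: "real^3 \<Rightarrow> real^3 \<Rightarrow> real^3 \<Rightarrow> real^4" where
  "D2 y X Y \<equiv> frechet_derivative (\<lambda>z. dG z Y) (at y) X"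

lemma affine_metric_eqI:
  assumes y: "y \<in> V" and eq: "D2 y X Y = dG y Z + r *\<^sub>R \<xi> y"
  shows "h y X Y = r" "induced_connection G \<xi> (\<lambda>_. X) (\<lambda>_. Y) y = Z"
proof -
  show "h y X Y = r"
    unfolding affine_metric_def
  proof (rule the_equality)
    show "\<exists>Z. D2 y X Y = dG y Z + r *\<^sub>R \<xi> y" using eq by blast
    show "r' = r" if "\<exists>Z. D2 y X Y = dG y Z + r' *\<^sub>R \<xi> y" for r'
      using that eq decomposition_unique(2)[OF y] by metis
  qed
  show "induced_connection G \<xi> (\<lambda>_. X) (\<lambda>_. Y) y = Z"
    unfolding induced_connection_def
  proof (rule the_equality)
    show "\<exists>r. D2 y X Y = dG y Z + r *\<^sub>R \<xi> y" using eq by blast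
    show "Z' = Z" if "\<exists>r. D2 y X Y = dG y Z' + r *\<^sub>R \<xi> y" for Z'
      using that eq decomposition_unique(1)[OF y] by metis
  qed
qed

lemma gauss_const:
  assumes y: "y \<in> V"
  shows "D2 y X Y = dG y (induced_connection G \<xi> (\<lambda>_. X) (\<lambda>_. Y) y) + h y X Y *\<^sub>R \<xi> y"
proof -
  obtain Z r where *: "D2 y X Y = dG y Z + r *\<^sub>R \<xi> y" using decomposition_exists[OF y] .
  show ?thesis using * affine_metric_eqI[OF y *] by simp
qed

lemma D2_linear_left: "y \<in> V \<Longrightarrow> linear (\<lambda>X. D2 y X Y)"
  by (rule smooth_on_linear_deriv[OF smooth_on_deriv[OF smooth_G]])

lemma D2_sym: "y \<in> V \<Longrightarrow> D2 y X Y = D2 y Y X"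
  by (rule second_derivative_commute[OF open_V smooth_G])

lemma h_sym: "y \<in> V \<Longrightarrow> h y X Y = h y Y X"
  unfolding affine_metric_def by (simp add: D2_sym)

lemma h_linear_left:
  assumes y: "y \<in> V"
  shows "linear (\<lambda>X. h y X Y)"
proof (rule linearI)
  let ?I = "\<lambda>X. induced_connection G \<xi> (\<lambda>_. X) (\<lambda>_. Y) y"
  fix X X' r
  show "h y (X + X') Y = h y X Y + h y X' Y"
    by (rule affine_metric_eqI(1)[OF y, of _ _ "?I X + ?I X'"])
      (simp add: linear_add[OF D2_linear_left[OF y]] gauss_const[OF y, where X=X and Y=Y] gauss_const[OF y, where X=X' and Y=Y]
        linear_add[OF linear_dG[OF y]] algebra_simps)
  show "h y (r *\<^sub>R X) Y = r *\<^sub>R h y X Y"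
    by (rule affine_metric_eqI(1)[OF y, of _ _ "r *\<^sub>R ?I X"])
      (simp add: linear_scale[OF D2_linear_left[OF y]] gauss_const[OF y, where X=X and Y=Y]
        linear_scale[OF linear_dG[OF y]] algebra_simps)
qed

lemma h_linear_right: "y \<in> V \<Longrightarrow> linear (\<lambda>Y. h y X Y)"
  using h_linear_left[of y X] h_sym[of y X] by simp

lemma smooth_h: "smooth_on V (\<lambda>z. h z X Y)"
proof -
  \<comment> \<open>The tangential coefficients are merely chosen pointwise; Cramer's rule then
    makes the transversal coefficient, which is the metric, smooth.\<close>
  have "\<forall>y. \<exists>c. y \<in> V \<longrightarrow> D2 y X Y = (\<Sum>i\<in>UNIV. c i *\<^sub>R E i y) + h y X Y *\<^sub>R \<xi> y"
  proof
    fix y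
    show "\<exists>c. y \<in> V \<longrightarrow> D2 y X Y = (\<Sum>i\<in>UNIV. c i *\<^sub>R E i y) + h y X Y *\<^sub>R \<xi> y"
    proof (cases "y \<in> V")
      case y: True
      obtain c where c: "induced_connection G \<xi> (\<lambda>_. X) (\<lambda>_. Y) y = (\<Sum>i\<in>UNIV. c i *\<^sub>R e i y)"
        using span_e[OF y] .
      show ?thesis
        using gauss_const[OF y, where X=X and Y=Y]
        by (intro exI[of _ c]) (simp add: c E_eq linear_sum[OF linear_dG[OF y]] linear_scale[OF linear_dG[OF y]])
    qed simp
  qed
  from choice[OF this] obtain c where
    c: "\<forall>y. y \<in> V \<longrightarrow> D2 y X Y = (\<Sum>i\<in>UNIV. c y i *\<^sub>R E i y) + h y X Y *\<^sub>R \<xi> y" by blast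
  show ?thesis
    by (rule smooth_frame_coefficients(2)[OF smooth_on_deriv[OF smooth_on_deriv[OF smooth_G]],
      where c = "\<lambda>i y. c y i"]) (use c in blast)
qed

text \<open>\<open>difference_tensor\<close> is defined with constant fields. The additional term
  caused by the moving field \<open>e j\<close> is the derivative part of
  \<open>levi_civita\<close>, so the two combine into the covariant derivative of
  \<open>e j\<close>.\<close>

lemma gauss_frame:
  assumes y: "y \<in> V"
  shows "dd i (E j) y = dG y (difference_tensor G \<xi> y (e i y) (e j y) + levi_civita h (e i) (e j) y)
     + h y (e i y) (e j y) *\<^sub>R \<xi> y"
proof -
  have "dd i (E j) y = D2 y (e i y) (e j y) + dG y (dd i (e j) y)"
    unfolding E_def dd_def[abs_def]
    by (rule frechet_derivative_deriv_along[OF open_V smooth_G smooth_e y])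
  then show ?thesis
    unfolding gauss_const[OF y]
    by (simp add: difference_tensor_def levi_civita_def dd_def linear_add[OF linear_dG[OF y]]
        linear_diff[OF linear_dG[OF y]] frechet_derivative_const)
qed

lemma weingarten_frame:
  assumes y: "y \<in> V"
  shows "dd i \<xi> y = - dG y (shape_operator G \<xi> y (e i y))"
proof -
  obtain Z where Z: "frechet_derivative \<xi> (at y) (e i y) = dG y Z"
    using equiaffine[OF y] by blast
  have "shape_operator G \<xi> y (e i y) = - Z"
    unfolding shape_operator_def
  proof (rule the_equality)
    show "frechet_derivative \<xi> (at y) (e i y) = - dG y (- Z)"
      unfolding Z by (simp add: linear_neg[OF linear_dG[OF y]])
    show "Z' = - Z" if "frechet_derivative \<xi> (at y) (e i y) = - dG y Z'" for Z'
    proof -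
      have "dG y (- Z') = dG y Z"
        using that unfolding Z linear_neg[OF linear_dG[OF y]] by simp
      then have "- Z' = Z" by (rule injD[OF inj_dG[OF y]])
      then show ?thesis by (metis minus_minus)
    qed
  qed
  then show ?thesis by (simp add: dd_def Z linear_neg[OF linear_dG[OF y]])
qed

end

section \<open>The Levi-Civita connection of the affine metric\<close>

locale orthonormal_patch = patch +
  assumes orthonormal: "y \<in> V \<Longrightarrow> h y (e i y) (e j y) = (if i = j then 1 else 0)"
begin

lemma h_expand:
  assumes y: "y \<in> V"
  shows "X = (\<Sum>i\<in>UNIV. h y X (e i y) *\<^sub>R e i y)"
proof -
  obtain d where d: "X = (\<Sum>i\<in>UNIV. d i *\<^sub>R e i y)" using span_e[OF y] .
  have "h y X (e k y) = d k" for k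
    unfolding d linear_sum[OF h_linear_left[OF y]] linear_scale[OF h_linear_left[OF y]]
    by (simp add: orthonormal[OF y] if_distrib cong: if_cong)
  then show ?thesis using d by simp
qed

lemma h_cancel:
  assumes y: "y \<in> V" and eq: "\<And>i. h y X (e i y) = h y Y (e i y)"
  shows "X = Y"
  using h_expand[OF y, of X] h_expand[OF y, of Y] eq by simp

lemma dh_linear:
  assumes y: "y \<in> V"
  shows "linear (\<lambda>Z. frechet_derivative (\<lambda>z. h z Y Z) (at y) X)"
proof (rule linearI)
  fix Z Z' r
  let ?d = "\<lambda>f. frechet_derivative f (at y) X"
  note d = smooth_on_has_derivative[OF smooth_h y]
  have 1: "((\<lambda>z. h z Y (Z + Z')) has_derivative
     (\<lambda>X. frechet_derivative (\<lambda>z. h z Y Z) (at y) X + frechet_derivative (\<lambda>z. h z Y Z') (at y) X)) (at y)"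
    by (rule has_derivative_transform_within_open[OF has_derivative_add[OF d[of Y Z] d[of Y Z']] open_V y])
      (simp add: linear_add[OF h_linear_right])
  from fun_cong[OF frechet_derivative_at[OF 1], of X, symmetric]
  show "?d (\<lambda>z. h z Y (Z + Z')) = ?d (\<lambda>z. h z Y Z) + ?d (\<lambda>z. h z Y Z')" .
  have 2: "((\<lambda>z. h z Y (r *\<^sub>R Z)) has_derivative
     (\<lambda>X. r *\<^sub>R frechet_derivative (\<lambda>z. h z Y Z) (at y) X)) (at y)"
    by (rule has_derivative_transform_within_open[OF has_derivative_scaleR_right[OF d[of Y Z]] open_V y])
      (simp add: linear_scale[OF h_linear_right])
  from fun_cong[OF frechet_derivative_at[OF 2], of X, symmetric]
  show "?d (\<lambda>z. h z Y (r *\<^sub>R Z)) = r *\<^sub>R ?d (\<lambda>z. h z Y Z)" .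
qed

text \<open>The right side is a linear form in \<open>Z\<close>. Its expansion in the orthonormal
  frame gives the vector that the definite description in \<open>christoffel\<close> asks for, and
  \<open>h_cancel\<close> gives its uniqueness.\<close>

lemma koszul:
  assumes y: "y \<in> V"
  shows "2 * h y (christoffel h y X Y) Z = frechet_derivative (\<lambda>z. h z Y Z) (at y) X
     + frechet_derivative (\<lambda>z. h z X Z) (at y) Y - frechet_derivative (\<lambda>z. h z X Y) (at y) Z"
proof -
  let ?R = "\<lambda>Z. frechet_derivative (\<lambda>z. h z Y Z) (at y) X
     + frechet_derivative (\<lambda>z. h z X Z) (at y) Y - frechet_derivative (\<lambda>z. h z X Y) (at y) Z"
  have lin: "linear ?R"
    by (intro linear_compose_sub linear_compose_add dh_linear[OF y] smooth_on_linear_deriv[OF smooth_h y])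
  define W where "W = (\<Sum>i\<in>UNIV. (?R (e i y) / 2) *\<^sub>R e i y)"
  have W: "2 * h y W Z = ?R Z" for Z
  proof -
    have "2 * h y W Z = (\<Sum>i\<in>UNIV. h y Z (e i y) * ?R (e i y))"
      unfolding W_def linear_sum[OF h_linear_left[OF y]] linear_scale[OF h_linear_left[OF y]] sum_distrib_left
      by (intro sum.cong refl) (simp add: h_sym[OF y, of Z])
    also have "\<dots> = ?R (\<Sum>i\<in>UNIV. h y Z (e i y) *\<^sub>R e i y)"
      unfolding linear_sum[OF lin] linear_scale[OF lin] by simp
    finally show ?thesis using h_expand[OF y, of Z] by simp
  qed
  have "christoffel h y X Y = W"
    unfolding christoffel_def
  proof (rule the_equality)
    show "\<forall>Z. 2 * h y W Z = ?R Z" using W by blast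
    fix W' assume W': "\<forall>Z. 2 * h y W' Z = ?R Z"
    show "W' = W"
    proof (rule h_cancel[OF y])
      fix i
      show "h y W' (e i y) = h y W (e i y)" using W'[rule_format, of "e i y"] W[of "e i y"] by simp
    qed
  qed
  then show ?thesis using W by simp
qed

lemma christoffel_sym:
  assumes y: "y \<in> V"
  shows "christoffel h y X Y = christoffel h y Y X"
proof (rule h_cancel[OF y])
  fix i
  have eq: "frechet_derivative (\<lambda>z. h z X Y) (at y) = frechet_derivative (\<lambda>z. h z Y X) (at y)"
    by (rule frechet_derivative_transform_within_open[OF smooth_on_differentiable[OF smooth_h y] open_V y])
      (rule h_sym)
  have "2 * h y (christoffel h y X Y) (e i y) = 2 * h y (christoffel h y Y X) (e i y)"
    unfolding koszul[OF y] eq by simp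
  then show "h y (christoffel h y X Y) (e i y) = h y (christoffel h y Y X) (e i y)" by simp
qed

lemma torsion_free:
  assumes y: "y \<in> V"
  shows "dd i (e j) y - dd j (e i) y = levi_civita h (e i) (e j) y - levi_civita h (e j) (e i) y"
  unfolding levi_civita_def dd_def using christoffel_sym[OF y, of "e i y" "e j y"] by simp

text \<open>The products of the frame fields are constant. Differentiating one of them with both
  slots moving leaves the derivative of the metric on fixed vectors, and this equals the sum of two
  Christoffel terms by the Koszul formula.\<close>

lemma metric_compatible:
  assumes y: "y \<in> V"
  shows "h y (levi_civita h (e i) (e j) y) (e k y) + h y (levi_civita h (e i) (e k) y) (e j y) = 0"
proof -
  let ?X = "e i y" and ?d = "\<lambda>f. frechet_derivative f (at y) (e i y)"
  have s1: "smooth_on V (\<lambda>z. h z Y (e k z))" for Y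
    by (rule smooth_on_linear_family[OF open_V h_linear_right smooth_h smooth_e])
  have "?d (\<lambda>z. h z (e j z) (e k z)) = ?d (\<lambda>z. h z (e j y) (e k z)) + h y (dd i (e j) y) (e k y)"
    unfolding dd_def
    by (rule frechet_derivative_linear_family[where A = "\<lambda>z X. h z X (e k z)", OF open_V h_linear_left s1 smooth_e y])
  also have "?d (\<lambda>z. h z (e j y) (e k z)) = ?d (\<lambda>z. h z (e j y) (e k y)) + h y (e j y) (dd i (e k) y)"
    unfolding dd_def
    by (rule frechet_derivative_linear_family[OF open_V h_linear_right smooth_h smooth_e y])
  finally have eq: "?d (\<lambda>z. h z (e j z) (e k z)) = ?d (\<lambda>z. h z (e j y) (e k y)) +
     h y (dd i (e k) y) (e j y) + h y (dd i (e j) y) (e k y)"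
    using h_sym[OF y, of "e j y"] by simp
  have z: "?d (\<lambda>z. h z (e j z) (e k z)) = 0"
    using dd_zero[OF y, of "\<lambda>z. h z (e j z) (e k z)" "if j = k then 1 else 0" i] orthonormal
    unfolding dd_def by blast
  have sw: "?d (\<lambda>z. h z (e k y) (e j y)) = ?d (\<lambda>z. h z (e j y) (e k y))"
    using dd_cong[OF smooth_h y, of "e k y" "e j y" "\<lambda>z. h z (e j y) (e k y)" i] h_sym
    unfolding dd_def by blast
  have sw2: "frechet_derivative (\<lambda>z. h z (e i y) (e j y)) (at y) = frechet_derivative (\<lambda>z. h z (e j y) (e i y)) (at y)" for i j
    by (rule frechet_derivative_transform_within_open[OF smooth_on_differentiable[OF smooth_h y] open_V y])
      (rule h_sym)
  have "2 * (h y (christoffel h y ?X (e j y)) (e k y) + h y (christoffel h y ?X (e k y)) (e j y)) =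
     2 * ?d (\<lambda>z. h z (e j y) (e k y))"
    unfolding distrib_left koszul[OF y] using sw sw2 by simp
  then show ?thesis
    using eq z by (simp add: levi_civita_def dd_def linear_add[OF h_linear_left[OF y]])
qed

end

section \<open>The Codazzi equations of a symmetry frame\<close>

text \<open>In the column convention of \<open>has_matrix\<close>, entry (k, j) is the component
  along \<open>e k\<close> of the difference tensor on \<open>e i\<close> and
  \<open>e j\<close>.\<close>

definition K_matrix :: "real \<Rightarrow> real \<Rightarrow> 3 \<Rightarrow> real^3^3" where
  "K_matrix l m i =
     (if i = 1 then vector [vector [2 * l, 0, 0], vector [0, - l, 0], vector [0, 0, - l]]
      else if i = 2 then vector [vector [0, - l, 0], vector [- l, m, 0], vector [0, 0, - m]]
      else vector [vector [0, 0, - l], vector [0, 0, - m], vector [- l, - m, 0]])"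

text \<open>Linearity in the two parameters lets the derivative of an entry be the same entry formed
  with the derivatives of \<open>lam\<close> and \<open>mu\<close>, as in
  \<open>dd_Gam\<close>.\<close>

lemma K_matrix_linear: "K_matrix l m i $ j $ k = l * K_matrix 1 0 i $ j $ k + m * K_matrix 0 1 i $ j $ k"
  using exhaust_3[of j] exhaust_3[of k] by (auto simp: K_matrix_def)

locale symmetry_frame = orthonormal_patch V e G \<xi>
  for V :: "(real^3) set" and e :: "3 \<Rightarrow> real^3 \<Rightarrow> real^3" and G \<xi> :: "real^3 \<Rightarrow> real^4" +
  fixes lam mu a b eta :: "real^3 \<Rightarrow> real"
  assumes normal: "y \<in> V \<Longrightarrow> normal_form (h y) (difference_tensor G \<xi> y) (shape_operator G \<xi> y)
      (\<lambda>i. e i y) (lam y) (mu y) (a y) (b y)"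
    and eta2: "y \<in> V \<Longrightarrow> eta y = h y (levi_civita h (e 2) (e 1) y) (e 2 y)"
    and eta3: "y \<in> V \<Longrightarrow> eta y = h y (levi_civita h (e 3) (e 1) y) (e 3 y)"
    and lam_pos: "y \<in> V \<Longrightarrow> lam y > 0"
    and b_eq: "y \<in> V \<Longrightarrow> b y = - (eta y)\<^sup>2 + (lam y)\<^sup>2"
begin

definition om :: "3 \<Rightarrow> 3 \<Rightarrow> 3 \<Rightarrow> real^3 \<Rightarrow> real" where
  "om i j k y = h y (levi_civita h (e i) (e j) y) (e k y)"

text \<open>The frame coefficients of the induced connection: Levi-Civita part plus difference
  tensor.\<close>

definition Gam :: "3 \<Rightarrow> 3 \<Rightarrow> 3 \<Rightarrow> real^3 \<Rightarrow> real" where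
  "Gam i j k y = om i j k y + K_matrix (lam y) (mu y) i $ k $ j"

definition sh :: "3 \<Rightarrow> real^3 \<Rightarrow> real" where
  "sh i = (if i = 1 then a else b)"

lemma om_antisym: "y \<in> V \<Longrightarrow> om i j k y = - om i k j y"
  using metric_compatible[of y i j k] by (simp add: om_def)

lemma om_diag: "y \<in> V \<Longrightarrow> om i j j y = 0"
  using om_antisym[of y i j j] by simp

lemma levi_civita_expand: "y \<in> V \<Longrightarrow> levi_civita h (e i) (e j) y = (\<Sum>k\<in>UNIV. om i j k y *\<^sub>R e k y)"
  unfolding om_def using h_expand by blast

lemma K_expand:
  assumes y: "y \<in> V"
  shows "difference_tensor G \<xi> y (e i y) (e j y) = (\<Sum>k\<in>UNIV. K_matrix (lam y) (mu y) i $ k $ j *\<^sub>R e k y)"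
  using normal[OF y] exhaust_3[of i]
  unfolding normal_form_def has_matrix_def K_matrix_def by auto

lemma dd_E:
  assumes y: "y \<in> V"
  shows "dd i (E j) y = (\<Sum>k\<in>UNIV. Gam i j k y *\<^sub>R E k y) + (if i = j then 1 else 0) *\<^sub>R \<xi> y"
  unfolding gauss_frame[OF y] levi_civita_expand[OF y] K_expand[OF y] orthonormal[OF y]
  by (simp add: E_eq Gam_def linear_add[OF linear_dG[OF y]] linear_sum[OF linear_dG[OF y]]
      linear_scale[OF linear_dG[OF y]] sum.distrib scaleR_left_distrib add.commute)

lemma dd_xi:
  assumes y: "y \<in> V"
  shows "dd i \<xi> y = - sh i y *\<^sub>R E i y"
proof -
  have "shape_operator G \<xi> y (e i y) = sh i y *\<^sub>R e i y"
    using normal[OF y] exhaust_3[of i]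
    unfolding normal_form_def has_matrix_def sh_def by (auto simp: sum_3)
  then show ?thesis
    unfolding weingarten_frame[OF y] by (simp add: E_eq linear_scale[OF linear_dG[OF y]])
qed

lemma bracket:
  assumes y: "y \<in> V"
  shows "dd i (e j) y - dd j (e i) y = (\<Sum>k\<in>UNIV. (om i j k y - om j i k y) *\<^sub>R e k y)"
  unfolding torsion_free[OF y] levi_civita_expand[OF y]
  by (simp add: sum_subtractf scaleR_left_diff_distrib)

lemma smooth_Gam: "smooth_on V (Gam i j k)"
  by (rule smooth_frame_coefficients(1)[OF smooth_dd[OF smooth_E] dd_E])

text \<open>The smoothness of \<open>lam\<close> is read off a connection coefficient:
  \<open>Gam 1 1 1\<close> is 2 lam, because its metric part vanishes by antisymmetry. In the same
  way \<open>mu\<close> is \<open>Gam 2 2 2\<close> and \<open>eta\<close> is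
  \<open>om 2 1 2\<close>.\<close>

lemma smooth_lam: "smooth_on V lam"
proof -
  have "smooth_on V (\<lambda>y. Gam 1 1 1 y / 2)"
    by (intro smooth_on_divide open_V smooth_Gam smooth_on_const) auto
  then show ?thesis
    using smooth_on_cong[OF open_V, of "\<lambda>y. Gam 1 1 1 y / 2" lam] by (simp add: Gam_def om_diag K_matrix_def)
qed

lemma smooth_mu: "smooth_on V mu"
  by (rule smooth_on_cong[OF open_V, THEN iffD1, OF _ smooth_Gam[of 2 2 2]])
    (simp add: Gam_def om_diag K_matrix_def)

lemma smooth_K: "smooth_on V (\<lambda>y. K_matrix (lam y) (mu y) i $ j $ k)"
  by (subst K_matrix_linear)
    (intro smooth_on_add smooth_on_mult open_V smooth_lam smooth_mu smooth_on_const)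

lemma smooth_om: "smooth_on V (om i j k)"
  using smooth_on_diff[OF open_V smooth_Gam smooth_K, of i j k i k j] by (simp add: Gam_def)

lemma smooth_eta: "smooth_on V eta"
  by (rule smooth_on_cong[OF open_V, THEN iffD1, OF _ smooth_om[of 2 1 2]]) (simp add: om_def eta2)

lemma dd_Gam:
  assumes y: "y \<in> V"
  shows "dd m (Gam i j k) y = dd m (om i j k) y + K_matrix (dd m lam y) (dd m mu y) i $ k $ j"
proof -
  have "dd m (\<lambda>y. K_matrix (lam y) (mu y) i $ k $ j) y = K_matrix (dd m lam y) (dd m mu y) i $ k $ j"
    by (subst (1 2) K_matrix_linear)
      (simp add: dd_add dd_mult dd_const smooth_on_mult open_V smooth_lam smooth_mu smooth_on_const y)
  then show ?thesis
    using dd_add[OF smooth_om smooth_K y, of m i j k i k j] unfolding Gam_def[abs_def] by simp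
qed

lemma dd_dd_E:
  assumes y: "y \<in> V"
  shows "dd i (dd j (E k)) y =
    (\<Sum>l\<in>UNIV. (dd i (Gam j k l) y + (\<Sum>m\<in>UNIV. Gam j k m y * Gam i m l y)
        - (if j = k \<and> i = l then sh i y else 0)) *\<^sub>R E l y) + Gam j k i y *\<^sub>R \<xi> y"
proof -
  let ?\<delta> = "if j = k then 1 else 0 :: real"
  have s: "smooth_on V (\<lambda>z. Gam j k l z *\<^sub>R E l z)" for l
    by (intro smooth_on_scaleR open_V smooth_Gam smooth_E)
  have s2: "smooth_on V (\<lambda>z. \<Sum>l\<in>UNIV. Gam j k l z *\<^sub>R E l z)"
    by (intro smooth_on_sum open_V s) simp
  have s3: "smooth_on V (\<lambda>z. ?\<delta> *\<^sub>R \<xi> z)"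
    by (intro smooth_on_scaleR open_V smooth_on_const smooth_\<xi>)
  have "dd i (dd j (E k)) y = dd i (\<lambda>z. (\<Sum>l\<in>UNIV. Gam j k l z *\<^sub>R E l z) + ?\<delta> *\<^sub>R \<xi> z) y"
    by (rule dd_cong[OF smooth_dd[OF smooth_E] y dd_E])
  also have "\<dots> = dd i (\<lambda>z. \<Sum>l\<in>UNIV. Gam j k l z *\<^sub>R E l z) y + dd i (\<lambda>z. ?\<delta> *\<^sub>R \<xi> z) y"
    by (rule dd_add[OF s2 s3 y])
  also have "\<dots> = (\<Sum>l\<in>UNIV. dd i (Gam j k l) y *\<^sub>R E l y + Gam j k l y *\<^sub>R dd i (E l) y) + ?\<delta> *\<^sub>R dd i \<xi> y"
    unfolding dd_sum[OF s y] dd_scaleR[OF smooth_Gam smooth_E y]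
      dd_scaleR[OF smooth_on_const[OF open_V] smooth_\<xi> y] by (simp add: dd_const)
  also have "(\<Sum>l\<in>UNIV. dd i (Gam j k l) y *\<^sub>R E l y + Gam j k l y *\<^sub>R dd i (E l) y) =
      (\<Sum>l\<in>UNIV. (dd i (Gam j k l) y + (\<Sum>m\<in>UNIV. Gam j k m y * Gam i m l y)) *\<^sub>R E l y) + Gam j k i y *\<^sub>R \<xi> y"
  proof -
    have "(\<Sum>l\<in>UNIV. Gam j k l y *\<^sub>R dd i (E l) y) =
        (\<Sum>l\<in>UNIV. \<Sum>m\<in>UNIV. (Gam j k l y * Gam i l m y) *\<^sub>R E m y) +
        (\<Sum>l\<in>UNIV. (if i = l then Gam j k l y else 0) *\<^sub>R \<xi> y)"
      unfolding dd_E[OF y] scaleR_right_distrib sum.distrib scaleR_sum_right scaleR_scaleR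
      by (intro arg_cong2[where f = "(+)"] sum.cong refl) simp
    also have "(\<Sum>l\<in>UNIV. \<Sum>m\<in>UNIV. (Gam j k l y * Gam i l m y) *\<^sub>R E m y) =
        (\<Sum>m\<in>UNIV. (\<Sum>l\<in>UNIV. Gam j k l y * Gam i l m y) *\<^sub>R E m y)"
      by (subst sum.swap) (simp add: scaleR_sum_left)
    also have "(\<Sum>l\<in>UNIV. (if i = l then Gam j k l y else 0) *\<^sub>R \<xi> y) = Gam j k i y *\<^sub>R \<xi> y"
      by (simp flip: scaleR_sum_left)
    finally show ?thesis by (simp add: sum.distrib scaleR_left_distrib)
  qed
  also have "?\<delta> *\<^sub>R dd i \<xi> y = (\<Sum>l\<in>UNIV. (- (if j = k \<and> i = l then sh i y else 0)) *\<^sub>R E l y)"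
    unfolding dd_xi[OF y] by (simp add: if_distrib[of "\<lambda>r. r *\<^sub>R _"] if_distrib[of uminus] cong: if_cong)
  finally show ?thesis
    by (simp add: scaleR_left_distrib scaleR_left_diff_distrib sum.distrib sum_subtractf sum_negf)
qed

text \<open>Compares the coefficients of \<open>E l\<close> in D_i D_j E_k - D_j D_i E_k = D_[i,j]
  E_k. In the last two indices \<open>om\<close> is antisymmetric and the difference tensor
  symmetric; hence the sum of the equations for (k, l) and (l, k) is the Codazzi equation for the
  difference tensor, and their difference is the Gauss equation for the curvature of the
  metric.\<close>

lemma flatness:
  assumes y: "y \<in> V"
  shows "dd i (Gam j k l) y + (\<Sum>m\<in>UNIV. Gam j k m y * Gam i m l y) - (if j = k \<and> i = l then sh i y else 0)
     - (dd j (Gam i k l) y + (\<Sum>m\<in>UNIV. Gam i k m y * Gam j m l y) - (if i = k \<and> j = l then sh j y else 0))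
     = (\<Sum>m\<in>UNIV. (om i j m y - om j i m y) * Gam m k l y)"
proof -
  let ?P = "\<lambda>i j l. dd i (Gam j k l) y + (\<Sum>m\<in>UNIV. Gam j k m y * Gam i m l y) - (if j = k \<and> i = l then sh i y else 0)"
  let ?Q = "\<lambda>l. \<Sum>m\<in>UNIV. (om i j m y - om j i m y) * Gam m k l y"
  have "(\<Sum>l\<in>UNIV. (?P i j l - ?P j i l) *\<^sub>R E l y) + (Gam j k i y - Gam i k j y) *\<^sub>R \<xi> y
      = dd i (dd j (E k)) y - dd j (dd i (E k)) y"
    unfolding dd_dd_E[OF y] by (simp only: scaleR_left_diff_distrib sum_subtractf) simp
  also have "\<dots> = (\<Sum>m\<in>UNIV. (om i j m y - om j i m y) *\<^sub>R dd m (E k) y)"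
    unfolding dd_commute[OF smooth_E y] bracket[OF y]
    by (simp add: dd_def linear_sum linear_scale smooth_on_linear_deriv[OF smooth_E y])
  also have "\<dots> = (\<Sum>l\<in>UNIV. ?Q l *\<^sub>R E l y)
      + (\<Sum>m\<in>UNIV. (om i j m y - om j i m y) * (if m = k then 1 else 0)) *\<^sub>R \<xi> y"
    unfolding dd_E[OF y]
  proof -
    have "(\<Sum>m\<in>UNIV. c m *\<^sub>R ((\<Sum>l\<in>UNIV. Gam m k l y *\<^sub>R E l y) + d m *\<^sub>R \<xi> y)) =
      (\<Sum>l\<in>UNIV. (\<Sum>m\<in>UNIV. c m * Gam m k l y) *\<^sub>R E l y) + (\<Sum>m\<in>UNIV. c m * d m) *\<^sub>R \<xi> y" for c d
    proof -
      have "(\<Sum>m\<in>UNIV. \<Sum>l\<in>UNIV. (c m * Gam m k l y) *\<^sub>R E l y) =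
          (\<Sum>l\<in>UNIV. (\<Sum>m\<in>UNIV. c m * Gam m k l y) *\<^sub>R E l y)"
        by (subst sum.swap) (simp add: scaleR_sum_left)
      then show ?thesis
        by (simp add: scaleR_right_distrib sum.distrib scaleR_sum_right scaleR_sum_left)
    qed
    then show "(\<Sum>m\<in>UNIV. (om i j m y - om j i m y) *\<^sub>R ((\<Sum>l\<in>UNIV. Gam m k l y *\<^sub>R E l y) +
          (if m = k then 1 else 0) *\<^sub>R \<xi> y)) = (\<Sum>l\<in>UNIV. ?Q l *\<^sub>R E l y)
      + (\<Sum>m\<in>UNIV. (om i j m y - om j i m y) * (if m = k then 1 else 0)) *\<^sub>R \<xi> y" .
  qed
  finally show ?thesis by (rule frame_coefficients_unique(1)[OF y])
qed

lemma codazzi: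
  assumes y: "y \<in> V"
  shows "om 1 1 2 y = 0" "om 1 1 3 y = 0" "om 2 1 3 y = 0" "om 3 1 2 y = 0"
    "dd 2 lam y = 0" "dd 3 lam y = 0" "dd 1 lam y = - 4 * lam y * eta y - (a y - b y) / 2"
proof -
  define w where "w i j k = om i j k y" for i j k
  define dw where "dw m i j k = dd m (om i j k) y" for m i j k
  have w: "w i 1 1 = 0" "w i 2 2 = 0" "w i 3 3 = 0" "w i 2 1 = - w i 1 2" "w i 3 1 = - w i 1 3" "w i 3 2 = - w i 2 3" for i
    unfolding w_def by (rule om_diag[OF y] om_antisym[OF y])+
  have dw: "dw m i 2 1 = - dw m i 1 2" "dw m i 3 1 = - dw m i 1 3" "dw m i 3 2 = - dw m i 2 3" "dw m i k k = 0" for m i k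
  proof -
    have "dw m i j k = - dw m i k j" for j k
      unfolding dw_def using dd_cong[OF smooth_om y, of i j k "\<lambda>z. - om i k j z" m]
        dd_minus[OF smooth_om y, of m i k j] om_antisym[of _ i j k] by metis
    from this[of 2 1] this[of 3 1] this[of 3 2] this[of k k]
    show "dw m i 2 1 = - dw m i 1 2" "dw m i 3 1 = - dw m i 1 3" "dw m i 3 2 = - dw m i 2 3" "dw m i k k = 0" by auto
  qed
  have et: "w 2 1 2 = eta y" "w 3 1 3 = eta y"
    using eta2[OF y] eta3[OF y] by (simp_all add: w_def om_def)
  note fl = flatness[OF y, unfolded dd_Gam[OF y] Gam_def, folded w_def dw_def]
  note S = sum_3 w dw et K_matrix_def sh_def
  define dl where "dl m = dd m lam y" for m
  define dm where "dm m = dd m mu y" for m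
  note fl = fl[folded dl_def dm_def]
  \<comment> \<open>Taking k = l, or adding the equations for (k, l) and (l, k), removes all
    derivatives of \<open>om\<close>. One of k, l is always 1, because the difference tensor then
    contributes only \<open>lam\<close>, so that no derivative of \<open>mu\<close> appears.\<close>
  have c1: "4 * lam y * w 1 1 2 = 2 * dl 2"
    using fl[of 1 2 1 1] by (simp add: S algebra_simps)
  have c2: "mu y * w 1 1 3 = 4 * lam y * w 2 1 3"
    using fl[of 1 2 1 3] fl[of 1 2 3 1] by (simp add: S algebra_simps)
  have c3: "mu y * w 1 1 3 = 4 * lam y * w 3 1 2"
    using fl[of 1 3 1 2] fl[of 1 3 2 1] by (simp add: S algebra_simps)
  have c4: "4 * lam y * w 2 1 3 = 4 * lam y * w 3 1 2"
    using fl[of 2 3 1 1] by (simp add: S algebra_simps)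
  have c5: "w 2 1 3 * mu y = - dl 3 - w 3 1 2 * mu y"
    using fl[of 2 3 1 2] fl[of 2 3 2 1] by (simp add: S algebra_simps)
  have c6: "dl 2 = 0"
    using fl[of 2 3 1 3] fl[of 2 3 3 1] by (simp add: S algebra_simps)
  have c7: "4 * lam y * w 1 1 3 = 2 * dl 3"
    using fl[of 1 3 1 1] by (simp add: S algebra_simps)
  have c8: "- dl 1 - mu y * w 1 1 2 - 4 * lam y * eta y = (a y - b y) / 2"
    using fl[of 1 2 1 2] fl[of 1 2 2 1] by (simp add: S algebra_simps)
  note l = lam_pos[OF y]
  have a2: "w 1 1 2 = 0" using c1 c6 l by simp
  have pr: "w 2 1 3 = w 3 1 2" using c4 l by simp
  \<comment> \<open>By \<open>c2\<close>, \<open>c5\<close> and \<open>pr\<close>, mu^2 w 1 1 3 = 4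
    lam mu w 2 1 3 = - 4 lam^2 w 1 1 3. The two squares end up with the same sign, which forces
    \<open>w 1 1 3\<close> to vanish.\<close>
  have "dl 3 = 2 * lam y * w 1 1 3" using c7 by simp
  then have "(lam y * w 1 1 3) * (4 * (lam y)\<^sup>2 + (mu y)\<^sup>2) = 0"
    using c5 c2 pr by algebra
  moreover have "4 * (lam y)\<^sup>2 + (mu y)\<^sup>2 > 0" using l by (simp add: add_pos_nonneg)
  ultimately have a3: "w 1 1 3 = 0" using l by simp
  have d1: "dl 1 = - 4 * lam y * eta y - (a y - b y) / 2"
    using c8 unfolding a2 by linarith
  show "om 1 1 2 y = 0" "om 1 1 3 y = 0" "om 2 1 3 y = 0" "om 3 1 2 y = 0"
    "dd 2 lam y = 0" "dd 3 lam y = 0" "dd 1 lam y = - 4 * lam y * eta y - (a y - b y) / 2"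
    using a2 a3 c2 c3 c6 c7 d1 l by (simp_all add: w_def dl_def)
qed

text \<open>Here single flatness equations are used, so the curvature enters. The last one is a
  Riccati equation with inhomogeneity \<open>b\<close>; the factorisation b = - (eta - lam)(eta +
  lam) makes it linear and homogeneous in \<open>eta - lam\<close>.\<close>

lemma dd_eta:
  assumes y: "y \<in> V"
  shows "dd 2 eta y = 0" "dd 3 eta y = 0" "dd 1 eta y = dd 1 lam y + 4 * lam y * (eta y - lam y)"
proof -
  define w where "w i j k = om i j k y" for i j k
  define dw where "dw m i j k = dd m (om i j k) y" for m i j k
  have w: "w i 1 1 = 0" "w i 2 2 = 0" "w i 3 3 = 0" "w i 2 1 = - w i 1 2" "w i 3 1 = - w i 1 3" "w i 3 2 = - w i 2 3" for i
    unfolding w_def by (rule om_diag[OF y] om_antisym[OF y])+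
  have w0: "w 1 1 2 = 0" "w 1 1 3 = 0" "w 2 1 3 = 0" "w 3 1 2 = 0"
    using codazzi[OF y] by (simp_all add: w_def)
  have et: "w 2 1 2 = eta y" "w 3 1 3 = eta y"
    using eta2[OF y] eta3[OF y] by (simp_all add: w_def om_def)
  have dw0: "dw m 1 1 2 = 0" "dw m 1 1 3 = 0" "dw m 2 1 3 = 0" "dw m 3 1 2 = 0" for m
    unfolding dw_def by (auto intro!: dd_zero[OF y] codazzi)
  have det: "dw m 2 1 2 = dd m eta y" "dw m 3 1 3 = dd m eta y" for m
    unfolding dw_def using dd_cong[OF smooth_om y, of 2 1 2 eta m] dd_cong[OF smooth_om y, of 3 1 3 eta m] eta2 eta3
    unfolding om_def by simp_all
  note fl = flatness[OF y, unfolded dd_Gam[OF y] Gam_def, folded w_def dw_def]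
  note S = sum_3 w w0 dw0 det et K_matrix_def sh_def codazzi(5,6)[OF y]
  show "dd 2 eta y = 0"
    using fl[of 2 3 1 3] by (simp add: S algebra_simps)
  show "dd 3 eta y = 0"
    using fl[of 2 3 1 2] by (simp add: S algebra_simps)
  show "dd 1 eta y = dd 1 lam y + 4 * lam y * (eta y - lam y)"
    using fl[of 1 2 1 2] by (simp add: S b_eq[OF y] algebra_simps power2_eq_square)
qed

text \<open>Along \<open>e j\<close> with j = 2, 3 the derivative of \<xi> is -b E_j and that of
  \<open>E 1\<close> is del E_j. Since b = - (lam + eta) del, subtracting this multiple of
  \<open>E 1\<close> makes the field constant on the leaves.\<close>

definition W :: "real^3 \<Rightarrow> real^4" where
  "W y = \<xi> y - (lam y + eta y) *\<^sub>R E 1 y"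

text \<open>The function \<delta> of the overview. It is a factor of \<open>b\<close>, so it is
  nonzero wherever \<open>b\<close> is.\<close>

definition del :: "real^3 \<Rightarrow> real" where
  "del y = eta y - lam y"

lemma smooth_W: "smooth_on V W"
  unfolding W_def[abs_def]
  by (intro smooth_on_diff smooth_on_scaleR smooth_on_add open_V smooth_\<xi> smooth_lam smooth_eta smooth_E)

lemma smooth_del: "smooth_on V del"
  unfolding del_def[abs_def] by (intro smooth_on_diff open_V smooth_lam smooth_eta)

lemma dd_del:
  assumes y: "y \<in> V"
  shows "dd 1 del y = 4 * lam y * del y" "dd 2 del y = 0" "dd 3 del y = 0"
  unfolding del_def[abs_def] dd_diff[OF smooth_eta smooth_lam y] dd_eta[OF y] codazzi(5,6)[OF y] by auto

lemma frame_equations: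
  assumes y: "y \<in> V"
  shows "dd 1 (E 1) y = (3 * lam y + eta y) *\<^sub>R E 1 y + W y"
    "dd 2 (E 1) y = del y *\<^sub>R E 2 y"
    "dd 3 (E 1) y = del y *\<^sub>R E 3 y"
    "dd 1 (E 2) y = om 1 2 3 y *\<^sub>R E 3 y - lam y *\<^sub>R E 2 y"
    "dd 2 (E 2) y = W y + mu y *\<^sub>R E 2 y + om 2 2 3 y *\<^sub>R E 3 y"
    "dd 3 (E 2) y = (om 3 2 3 y - mu y) *\<^sub>R E 3 y"
    "dd 1 (E 3) y = - om 1 2 3 y *\<^sub>R E 2 y - lam y *\<^sub>R E 3 y"
    "dd 2 (E 3) y = - om 2 2 3 y *\<^sub>R E 2 y - mu y *\<^sub>R E 3 y"
    "dd 3 (E 3) y = W y - (om 3 2 3 y + mu y) *\<^sub>R E 2 y"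
proof -
  have w: "om i 1 1 y = 0" "om i 2 2 y = 0" "om i 3 3 y = 0" "om i 2 1 y = - om i 1 2 y"
    "om i 3 1 y = - om i 1 3 y" "om i 3 2 y = - om i 2 3 y" for i
    by (rule om_diag[OF y] om_antisym[OF y])+
  have et: "om 2 1 2 y = eta y" "om 3 1 3 y = eta y"
    using eta2[OF y] eta3[OF y] by (simp_all add: om_def)
  note S = dd_E[OF y] sum_3 Gam_def K_matrix_def w et codazzi(1-4)[OF y] W_def del_def
  show "dd 1 (E 1) y = (3 * lam y + eta y) *\<^sub>R E 1 y + W y"
    "dd 2 (E 1) y = del y *\<^sub>R E 2 y"
    "dd 3 (E 1) y = del y *\<^sub>R E 3 y"
    "dd 1 (E 2) y = om 1 2 3 y *\<^sub>R E 3 y - lam y *\<^sub>R E 2 y"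
    "dd 2 (E 2) y = W y + mu y *\<^sub>R E 2 y + om 2 2 3 y *\<^sub>R E 3 y"
    "dd 3 (E 2) y = (om 3 2 3 y - mu y) *\<^sub>R E 3 y"
    "dd 1 (E 3) y = - om 1 2 3 y *\<^sub>R E 2 y - lam y *\<^sub>R E 3 y"
    "dd 2 (E 3) y = - om 2 2 3 y *\<^sub>R E 2 y - mu y *\<^sub>R E 3 y"
    "dd 3 (E 3) y = W y - (om 3 2 3 y + mu y) *\<^sub>R E 2 y"
    by (simp_all add: S vec_eq_iff algebra_simps)
qed

lemma dd_W:
  assumes y: "y \<in> V"
  shows "dd 1 W y = - (lam y + eta y) *\<^sub>R W y" "dd 2 W y = 0" "dd 3 W y = 0"
proof -
  have s: "smooth_on V (\<lambda>y. lam y + eta y)" by (intro smooth_on_add open_V smooth_lam smooth_eta)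
  have d: "dd i W y = - sh i y *\<^sub>R E i y - ((dd i lam y + dd i eta y) *\<^sub>R E 1 y + (lam y + eta y) *\<^sub>R dd i (E 1) y)" for i
    unfolding W_def[abs_def] dd_diff[OF smooth_\<xi> smooth_on_scaleR[OF open_V s smooth_E] y]
      dd_scaleR[OF s smooth_E y] dd_add[OF smooth_lam smooth_eta y] dd_xi[OF y] ..
  have 1: "dd 1 W y = - (lam y + eta y) *\<^sub>R \<xi> y
      - (a y + dd 1 lam y + dd 1 eta y + 2 * lam y * (lam y + eta y)) *\<^sub>R E 1 y"
    unfolding d frame_equations(1)[OF y] sh_def W_def by (simp add: vec_eq_iff algebra_simps)
  \<comment> \<open>\<open>codazzi(7)\<close> enters twice, through \<open>lam\<close> and through
    \<open>eta\<close>. Its terms -(a - b)/2 add up to b - a, which cancels \<open>a\<close> and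
    leaves an expression in \<open>lam\<close> and \<open>eta\<close> alone.\<close>
  have 2: "a y + dd 1 lam y + dd 1 eta y + 2 * lam y * (lam y + eta y) = - (lam y + eta y)\<^sup>2"
    unfolding dd_eta[OF y] codazzi(7)[OF y] b_eq[OF y] by (simp add: field_simps power2_eq_square)
  show "dd 1 W y = - (lam y + eta y) *\<^sub>R W y"
    unfolding 1 2 by (simp add: W_def vec_eq_iff algebra_simps power2_eq_square)
  show "dd 2 W y = 0" "dd 3 W y = 0"
    unfolding d frame_equations[OF y] sh_def dd_eta[OF y] codazzi(5,6)[OF y] del_def
    by (simp_all add: b_eq[OF y] vec_eq_iff algebra_simps power2_eq_square)
qed

end

section \<open>Adapted affine coordinates\<close>

text \<open>The first stage of coordinates, in which \<open>del\<close> may still vanish. The last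
  two assumptions hold at \<open>y0\<close>, where both expressions equal 1, and are met nearby by
  shrinking \<open>V\<close>.\<close>

locale adapted_coordinates = symmetry_frame V e G \<xi> lam mu a b eta
  for V :: "(real^3) set" and e :: "3 \<Rightarrow> real^3 \<Rightarrow> real^3" and G \<xi> :: "real^3 \<Rightarrow> real^4"
    and lam mu a b eta :: "real^3 \<Rightarrow> real" +
  fixes L :: "real^4 \<Rightarrow> real^4" and y0 :: "real^3"
  assumes convex_V: "convex V" and y0: "y0 \<in> V" and linear_L: "linear L"
    and L_E2: "L (E 2 y0) = axis 1 1" and L_E3: "L (E 3 y0) = axis 2 1" and L_W: "L (W y0) = axis 3 1"
    and W_nonzero: "y \<in> V \<Longrightarrow> L (W y) $ 3 \<noteq> 0"
    and minor_nonzero: "y \<in> V \<Longrightarrow> L (E 2 y) $ 1 * L (E 3 y) $ 2 - L (E 2 y) $ 2 * L (E 3 y) $ 1 \<noteq> 0"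
begin

definition X :: "3 \<Rightarrow> 4 \<Rightarrow> real^3 \<Rightarrow> real" where "X j k y = L (E j y) $ k"

definition w :: "4 \<Rightarrow> real^3 \<Rightarrow> real" where "w k y = L (W y) $ k"

definition M :: "4 \<Rightarrow> 4 \<Rightarrow> real^3 \<Rightarrow> real" where
  "M k l y = X 2 k y * X 3 l y - X 2 l y * X 3 k y"

lemma bounded_linear_L_nth: "bounded_linear (\<lambda>v. L v $ k)"
  using linear_L linear_conv_bounded_linear bounded_linear_compose[OF bounded_linear_vec_nth]
  by blast

lemma smooth_X: "smooth_on V (X j k)"
  unfolding X_def[abs_def] by (rule smooth_on_bounded_linear[OF bounded_linear_L_nth open_V smooth_E])

lemma smooth_w: "smooth_on V (w k)"
  unfolding w_def[abs_def] by (rule smooth_on_bounded_linear[OF bounded_linear_L_nth open_V smooth_W])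

lemma smooth_M: "smooth_on V (M k l)"
  unfolding M_def[abs_def] by (intro smooth_on_diff smooth_on_mult open_V smooth_X)

lemma dd_w_1: "y \<in> V \<Longrightarrow> dd 1 (w k) y = - (lam y + eta y) * w k y"
  and dd_w_2: "y \<in> V \<Longrightarrow> dd 2 (w k) y = 0"
  and dd_w_3: "y \<in> V \<Longrightarrow> dd 3 (w k) y = 0"
  unfolding w_def[abs_def]
  by (simp_all add: dd_linear[OF bounded_linear_L_nth smooth_W] dd_W linear_scale[OF linear_L]
      linear_0[OF linear_L] linear_neg[OF linear_L])

lemma dd_X:
  assumes y: "y \<in> V"
  shows "dd 1 (X 1 k) y = (3 * lam y + eta y) * X 1 k y + w k y"
    "dd 2 (X 1 k) y = del y * X 2 k y"
    "dd 3 (X 1 k) y = del y * X 3 k y"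
    "dd 1 (X 2 k) y = om 1 2 3 y * X 3 k y - lam y * X 2 k y"
    "dd 2 (X 2 k) y = w k y + mu y * X 2 k y + om 2 2 3 y * X 3 k y"
    "dd 3 (X 2 k) y = (om 3 2 3 y - mu y) * X 3 k y"
    "dd 1 (X 3 k) y = - om 1 2 3 y * X 2 k y - lam y * X 3 k y"
    "dd 2 (X 3 k) y = - om 2 2 3 y * X 2 k y - mu y * X 3 k y"
    "dd 3 (X 3 k) y = w k y - (om 3 2 3 y + mu y) * X 2 k y"
  unfolding X_def[abs_def] w_def
  by (simp_all add: dd_linear[OF bounded_linear_L_nth smooth_E y] frame_equations[OF y]
      linear_scale[OF linear_L] linear_add[OF linear_L] linear_diff[OF linear_L] linear_neg[OF linear_L])

lemma X_y0: "X 2 1 y0 = 1" "X 2 2 y0 = 0" "X 2 3 y0 = 0" "X 2 4 y0 = 0"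
  "X 3 1 y0 = 0" "X 3 2 y0 = 1" "X 3 3 y0 = 0" "X 3 4 y0 = 0"
  "w 1 y0 = 0" "w 2 y0 = 0" "w 3 y0 = 1" "w 4 y0 = 0"
  by (simp_all add: X_def w_def L_E2 L_E3 L_W axis_def)

lemma w3_nonzero: "y \<in> V \<Longrightarrow> w 3 y \<noteq> 0"
  using W_nonzero by (simp add: w_def)

lemma M_nonzero: "y \<in> V \<Longrightarrow> M 1 2 y \<noteq> 0"
  using minor_nonzero by (simp add: M_def X_def)

lemma w_zero:
  assumes k: "k \<noteq> 3" and y: "y \<in> V"
  shows "w k y = 0"
proof -
  have "w k y * w 3 y0 = w k y0 * w 3 y"
  proof (rule proportional[OF smooth_w smooth_w convex_V w3_nonzero _ _ y y0])
    show d: "dd i (w k) y = (if i = 1 then - (lam y + eta y) else 0) * w k y" if "y \<in> V" for i y k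
      using exhaust_3[of i] that by (auto simp: dd_w_1 dd_w_2 dd_w_3)
    show "dd i (w 3) y = (if i = 1 then - (lam y + eta y) else 0) * w 3 y" if "y \<in> V" for i y
      by (rule d[OF that])
  qed
  then show ?thesis using X_y0 k exhaust_4[of k] by auto
qed

text \<open>The rotation coefficients \<open>om i 2 3\<close> cancel in a minor. What survives is
  the trace of the difference tensor on the span of \<open>e 2\<close> and \<open>e 3\<close>: -2
  lam along \<open>e 1\<close>, mu - mu along \<open>e 2\<close>, and 0 along \<open>e 3\<close>.
  Excluding the third coordinate removes the contribution of \<open>W\<close>.\<close>

lemma dd_M:
  assumes y: "y \<in> V" and k: "k \<noteq> 3" "l \<noteq> 3"
  shows "dd i (M k l) y = (if i = 1 then - 2 * lam y else 0) * M k l y"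
proof -
  have "dd i (M k l) y = dd i (X 2 k) y * X 3 l y + X 2 k y * dd i (X 3 l) y
      - (dd i (X 2 l) y * X 3 k y + X 2 l y * dd i (X 3 k) y)" for i
    unfolding M_def[abs_def]
      dd_diff[OF smooth_on_mult[OF open_V smooth_X smooth_X] smooth_on_mult[OF open_V smooth_X smooth_X] y]
      dd_mult[OF smooth_X smooth_X y] ..
  note d = this[of 1] this[of 2] this[of 3]
  from exhaust_3[of i] show ?thesis
    by (elim disjE; hypsubst; unfold d dd_X[OF y] w_zero[OF k(1) y] w_zero[OF k(2) y] M_def)
       (simp_all add: algebra_simps)
qed

lemma M_zero:
  assumes y: "y \<in> V" and k: "k \<noteq> 3"
  shows "M k 4 y = 0"
proof -
  have "M k 4 y * M 1 2 y0 = M k 4 y0 * M 1 2 y"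
    by (rule proportional[OF smooth_M smooth_M convex_V M_nonzero dd_M dd_M y y0]) (use k in auto)
  then show ?thesis by (simp add: M_def X_y0)
qed

text \<open>By \<open>M_zero\<close> the pair (\<open>X 2 4 y\<close>, \<open>X 3 4 y\<close>) is
  parallel to the corresponding pairs with coordinate index 1 and 2, which are independent. Together
  with \<open>w_zero\<close> this places \<open>E 2\<close>, \<open>E 3\<close> and \<open>W\<close>
  in the fixed hyperplane.\<close>

lemma X_4_zero:
  assumes y: "y \<in> V"
  shows "X 2 4 y = 0" "X 3 4 y = 0"
proof -
  have "X 2 1 y * X 3 4 y = X 2 4 y * X 3 1 y" "X 2 2 y * X 3 4 y = X 2 4 y * X 3 2 y"
    using M_zero[OF y, of 1] M_zero[OF y, of 2] by (simp_all add: M_def)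
  then have "X 2 4 y * M 1 2 y = 0" "X 3 4 y * M 1 2 y = 0"
    unfolding M_def by algebra+
  then show "X 2 4 y = 0" "X 3 4 y = 0" using M_nonzero[OF y] by auto
qed

text \<open>The logarithmic derivative -2 lam of the minor, taken twice, balances the equation e_1
  \<delta> = 4 lam \<delta>. The minor is thus an integrating factor without zeros, and a zero of
  \<open>del\<close> at one point spreads over all of \<open>V\<close>.\<close>

lemma del_M:
  assumes y: "y \<in> V"
  shows "del y * (M 1 2 y)\<^sup>2 = del y0"
proof -
  have "del y * (M 1 2 y * M 1 2 y) = del y0 * (M 1 2 y0 * M 1 2 y0)"
  proof (rule dd_zero_imp_constant[OF _ convex_V _ y y0])
    show "smooth_on V (\<lambda>y. del y * (M 1 2 y * M 1 2 y))"
      by (intro smooth_on_mult open_V smooth_del smooth_M)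
    fix i y assume y: "y \<in> V"
    show "dd i (\<lambda>y. del y * (M 1 2 y * M 1 2 y)) y = 0"
      unfolding dd_mult[OF smooth_del smooth_on_mult[OF open_V smooth_M smooth_M] y]
        dd_mult[OF smooth_M smooth_M y] dd_M[OF y, of 1 2, simplified]
      using exhaust_3[of i] by (auto simp: dd_del[OF y] algebra_simps)
  qed
  then show ?thesis by (simp add: M_def X_y0 power2_eq_square)
qed

end

text \<open>The second stage. \<open>P0\<close> is going to be G y0 - E 1 y0 / del y0; with this
  origin the line traced by F - E_1/\<delta> becomes the third axis, and \<open>y0\<close> gets
  height 1 over the fixed hyperplane.\<close>

locale model_coordinates = adapted_coordinates V e G \<xi> lam mu a b eta L y0
  for V :: "(real^3) set" and e :: "3 \<Rightarrow> real^3 \<Rightarrow> real^3" and G \<xi> :: "real^3 \<Rightarrow> real^4"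
    and lam mu a b eta :: "real^3 \<Rightarrow> real" and L :: "real^4 \<Rightarrow> real^4" and y0 :: "real^3" +
  fixes P0 :: "real^4"
  assumes L_E1: "L (E 1 y0) = del y0 *\<^sub>R axis 4 1"
    and L_G: "L (G y0 - P0) = axis 4 1"
    and del_nonzero: "y \<in> V \<Longrightarrow> del y \<noteq> 0"
    and height_nonzero: "y \<in> V \<Longrightarrow> L (G y - P0) $ 4 > 0"
begin

definition x :: "4 \<Rightarrow> real^3 \<Rightarrow> real" where "x k y = L (G y - P0) $ k"

lemma smooth_x: "smooth_on V (x k)"
  unfolding x_def[abs_def]
  by (rule smooth_on_bounded_linear[OF bounded_linear_L_nth open_V])
    (intro smooth_on_diff open_V smooth_G smooth_on_const)

lemma dd_x: "y \<in> V \<Longrightarrow> dd i (x k) y = X i k y"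
  unfolding x_def[abs_def]
  by (simp add: dd_linear[OF bounded_linear_L_nth smooth_on_diff[OF open_V smooth_G smooth_on_const[OF open_V]]]
      dd_diff[OF smooth_G smooth_on_const[OF open_V]] dd_const X_def E_def)

lemma x_y0: "x 1 y0 = 0" "x 2 y0 = 0" "x 3 y0 = 0" "x 4 y0 = 1"
  "X 1 1 y0 = 0" "X 1 2 y0 = 0" "X 1 3 y0 = 0" "X 1 4 y0 = del y0"
  by (simp_all add: x_def X_def L_G L_E1 axis_def)

lemma x4_pos: "y \<in> V \<Longrightarrow> x 4 y > 0"
  using height_nonzero by (simp add: x_def)

text \<open>The coordinates of the point F - E_1/\<delta>.\<close>

definition Q :: "4 \<Rightarrow> real^3 \<Rightarrow> real" where "Q k y = x k y - X 1 k y / del y"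

lemma smooth_Q: "smooth_on V (Q k)"
  unfolding Q_def[abs_def]
  by (intro smooth_on_diff smooth_on_divide open_V smooth_x smooth_X smooth_del del_nonzero)

text \<open>On a leaf \<open>del\<close> is constant and the derivative of \<open>E 1\<close> is del
  E_j, which cancels that of F. Along \<open>e 1\<close> the identity (3 lam + eta) - 4 lam = del
  cancels \<open>E 1\<close>, so that only \<open>W\<close> remains.\<close>

lemma dd_Q:
  assumes y: "y \<in> V"
  shows "dd 1 (Q k) y = - w k y / del y" "dd 2 (Q k) y = 0" "dd 3 (Q k) y = 0"
proof -
  have d: "dd i (Q k) y = X i k y - (dd i (X 1 k) y * del y - X 1 k y * dd i del y) / (del y)\<^sup>2" for i
  proof -
    have "smooth_on V (\<lambda>y. X 1 k y / del y)"
      by (intro smooth_on_divide open_V smooth_X smooth_del del_nonzero)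
    moreover have "dd i (\<lambda>y. X 1 k y / del y) y = (dd i (X 1 k) y * del y - X 1 k y * dd i del y) / (del y)\<^sup>2"
      by (rule dd_divide[OF smooth_X smooth_del y]) (rule del_nonzero)
    ultimately show ?thesis
      unfolding Q_def[abs_def] using dd_diff[OF smooth_x _ y] dd_x[OF y] by metis
  qed
  have nz: "del y \<noteq> 0" by (rule del_nonzero[OF y])
  show "dd 2 (Q k) y = 0" "dd 3 (Q k) y = 0"
    unfolding d dd_X[OF y] dd_del[OF y] using nz by (simp_all add: power2_eq_square)
  have "(3 * lam y + eta y) * X 1 k y * del y - X 1 k y * (4 * lam y * del y) = X 1 k y * (del y)\<^sup>2"
    by (simp add: del_def algebra_simps power2_eq_square)
  then have "((3 * lam y + eta y) * X 1 k y + w k y) * del y - X 1 k y * (4 * lam y * del y)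
      = X 1 k y * (del y)\<^sup>2 + w k y * del y" by (simp add: algebra_simps)
  then show "dd 1 (Q k) y = - w k y / del y"
    unfolding d dd_X[OF y] dd_del[OF y] using nz by (simp add: field_simps power2_eq_square)
qed

lemma Q_zero:
  assumes k: "k \<noteq> 3" and y: "y \<in> V"
  shows "Q k y = 0"
proof -
  have "Q k y = Q k y0"
  proof (rule dd_zero_imp_constant[OF smooth_Q convex_V _ y y0])
    fix i y assume "y \<in> V"
    then show "dd i (Q k) y = 0"
      using exhaust_3[of i] w_zero[OF k] by (auto simp: dd_Q)
  qed
  then show ?thesis
    using exhaust_4[of k] k del_nonzero[OF y0] by (auto simp: Q_def x_y0)
qed

lemma X_1:
  assumes y: "y \<in> V"
  shows "X 1 1 y = del y * x 1 y" "X 1 2 y = del y * x 2 y" "X 1 4 y = del y * x 4 y"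
  using Q_zero[OF _ y] del_nonzero[OF y] by (simp_all add: Q_def field_simps)

text \<open>The logarithmic derivatives -(lam + eta) of \<open>w 3\<close> and eta - lam of the
  height add up to -2 lam, that of the minor. This link between transversal scale, height and leaf
  volume is what normalises the Hessian determinant at height 1.\<close>

lemma w3_x4:
  assumes y: "y \<in> V"
  shows "w 3 y * x 4 y = M 1 2 y"
proof -
  have "(w 3 y * x 4 y) * M 1 2 y0 = (w 3 y0 * x 4 y0) * M 1 2 y"
  proof (rule proportional[OF smooth_on_mult[OF open_V smooth_w smooth_x] smooth_M convex_V M_nonzero _ dd_M y y0])
    fix i y assume y: "y \<in> V"
    show "dd i (\<lambda>y. w 3 y * x 4 y) y = (if i = 1 then - 2 * lam y else 0) * (w 3 y * x 4 y)"
      unfolding dd_mult[OF smooth_w smooth_x y] dd_x[OF y]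
      using exhaust_3[of i]
      by (auto simp: dd_w_1 dd_w_2 dd_w_3 y X_1 X_4_zero del_def algebra_simps)
  qed auto
  then show ?thesis by (simp add: M_def X_y0 x_y0)
qed

text \<open>For indices 1 and 2 these sums are the entries of the inverse leaf metric in affine
  coordinates. Rotation terms cancel by antisymmetry, so with mu = 0 the inverse metric is a
  multiple of its value at \<open>y0\<close>, the identity matrix.\<close>

lemma circular:
  assumes mu: "\<And>y. y \<in> V \<Longrightarrow> mu y = 0" and y: "y \<in> V" and kl: "k \<noteq> 3" "l \<noteq> 3"
  shows "X 2 k y * X 2 l y + X 3 k y * X 3 l y = (X 2 k y0 * X 2 l y0 + X 3 k y0 * X 3 l y0) * M 1 2 y"
proof -
  define N where "N y = X 2 k y * X 2 l y + X 3 k y * X 3 l y" for y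
  have s: "smooth_on V N"
    unfolding N_def[abs_def] by (intro smooth_on_add smooth_on_mult open_V smooth_X)
  have "N y * M 1 2 y0 = N y0 * M 1 2 y"
  proof (rule proportional[OF s smooth_M convex_V M_nonzero _ dd_M y y0])
    fix i y assume y: "y \<in> V"
    have "dd i N y = dd i (X 2 k) y * X 2 l y + X 2 k y * dd i (X 2 l) y
      + (dd i (X 3 k) y * X 3 l y + X 3 k y * dd i (X 3 l) y)" for i
      unfolding N_def[abs_def]
        dd_add[OF smooth_on_mult[OF open_V smooth_X smooth_X] smooth_on_mult[OF open_V smooth_X smooth_X] y]
        dd_mult[OF smooth_X smooth_X y] ..
    note d = this[of 1] this[of 2] this[of 3]
    from exhaust_3[of i] show "dd i N y = (if i = 1 then - 2 * lam y else 0) * N y"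
      by (elim disjE; hypsubst; unfold d dd_X[OF y] w_zero[OF kl(1) y] w_zero[OF kl(2) y] N_def mu[OF y])
         (simp_all add: algebra_simps)
  qed auto
  then show ?thesis by (simp add: N_def M_def X_y0)
qed

text \<open>Cramer's rule for the slopes of the tangent planes of the slices of constant height.\<close>

definition a1 :: "real^3 \<Rightarrow> real" where "a1 y = M 3 2 y / M 1 2 y"
definition a2 :: "real^3 \<Rightarrow> real" where "a2 y = M 1 3 y / M 1 2 y"

lemma smooth_a: "smooth_on V a1" "smooth_on V a2"
  unfolding a1_def[abs_def] a2_def[abs_def]
  by (intro smooth_on_divide open_V smooth_M M_nonzero; assumption)+

lemma slopes:
  assumes y: "y \<in> V"
  shows "a1 y * X 2 1 y + a2 y * X 2 2 y = X 2 3 y" "a1 y * X 3 1 y + a2 y * X 3 2 y = X 3 3 y"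
proof -
  have "M 3 2 y * X 2 1 y + M 1 3 y * X 2 2 y = X 2 3 y * M 1 2 y"
    "M 3 2 y * X 3 1 y + M 1 3 y * X 3 2 y = X 3 3 y * M 1 2 y"
    by (simp_all add: M_def algebra_simps)
  then show "a1 y * X 2 1 y + a2 y * X 2 2 y = X 2 3 y" "a1 y * X 3 1 y + a2 y * X 3 2 y = X 3 3 y"
    using M_nonzero[OF y] by (simp_all add: a1_def a2_def field_simps)
qed

lemma linear_system_zero:
  assumes y: "y \<in> V" and "p * X 2 1 y + q * X 2 2 y = 0" "p * X 3 1 y + q * X 3 2 y = 0"
  shows "p = 0" "q = 0"
proof -
  have "p * M 1 2 y = 0" "q * M 1 2 y = 0"
    using assms(2,3) unfolding M_def by algebra+
  then show "p = 0" "q = 0" using M_nonzero[OF y] by auto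
qed

text \<open>Differentiate the identities \<open>slopes\<close>. All tangential terms are
  combinations of \<open>E 2\<close> and \<open>E 3\<close> and cancel by \<open>slopes\<close>
  again; what is left is the third coordinate of \<open>W\<close>, when both directions
  agree.\<close>

lemma dd_a:
  assumes y: "y \<in> V"
  shows "dd 1 a1 y = 0" "dd 1 a2 y = 0"
    "dd 2 a1 y * X 2 1 y + dd 2 a2 y * X 2 2 y = w 3 y"
    "dd 2 a1 y * X 3 1 y + dd 2 a2 y * X 3 2 y = 0"
    "dd 3 a1 y * X 2 1 y + dd 3 a2 y * X 2 2 y = 0"
    "dd 3 a1 y * X 3 1 y + dd 3 a2 y * X 3 2 y = w 3 y"
proof -
  have d: "dd i a1 y * X j 1 y + dd i a2 y * X j 2 y = dd i (X j 3) y - a1 y * dd i (X j 1) y - a2 y * dd i (X j 2) y"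
    if j: "j = 2 \<or> j = 3" for i j
  proof -
    have "dd i (\<lambda>y. a1 y * X j 1 y + a2 y * X j 2 y) y = dd i (X j 3) y"
    proof (rule dd_cong)
      show "smooth_on V (\<lambda>y. a1 y * X j 1 y + a2 y * X j 2 y)"
        by (intro smooth_on_add smooth_on_mult open_V smooth_a smooth_X)
    qed (use j slopes y in auto)
    then show ?thesis
      unfolding dd_add[OF smooth_on_mult[OF open_V smooth_a(1) smooth_X] smooth_on_mult[OF open_V smooth_a(2) smooth_X] y]
        dd_mult[OF smooth_a(1) smooth_X y] dd_mult[OF smooth_a(2) smooth_X y]
      by (simp add: algebra_simps)
  qed
  note w0 = w_zero[OF _ y, of 1] w_zero[OF _ y, of 2]
  note S = dd_X[OF y] w0 slopes[OF y, symmetric]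
  have "dd 1 a1 y * X 2 1 y + dd 1 a2 y * X 2 2 y = 0" "dd 1 a1 y * X 3 1 y + dd 1 a2 y * X 3 2 y = 0"
    using d[of 2 1] d[of 3 1] by (simp_all add: S algebra_simps)
  from linear_system_zero[OF y this] show "dd 1 a1 y = 0" "dd 1 a2 y = 0" by auto
  show "dd 2 a1 y * X 2 1 y + dd 2 a2 y * X 2 2 y = w 3 y"
    "dd 2 a1 y * X 3 1 y + dd 2 a2 y * X 3 2 y = 0"
    "dd 3 a1 y * X 2 1 y + dd 3 a2 y * X 2 2 y = 0"
    "dd 3 a1 y * X 3 1 y + dd 3 a2 y * X 3 2 y = w 3 y"
    using d[of 2 2] d[of 3 2] d[of 2 3] d[of 3 3] by (simp_all add: S algebra_simps)
qed

definition u :: "4 \<Rightarrow> real^3 \<Rightarrow> real" where "u k y = x k y / x 4 y"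

lemma smooth_u: "smooth_on V (u k)"
  unfolding u_def[abs_def] using x4_pos
  by (intro smooth_on_divide open_V smooth_x) (metis less_irrefl)

lemma dd_x4:
  assumes y: "y \<in> V"
  shows "dd 1 (x 4) y = del y * x 4 y" "dd 2 (x 4) y = 0" "dd 3 (x 4) y = 0"
  by (simp_all add: dd_x y X_1 X_4_zero)

text \<open>The height is constant on the leaves, so there only the numerator is differentiated.
  Along \<open>e 1\<close> one has X 1 k = del (x k - Q k), and the part del (x k) is cancelled by
  the change of height.\<close>

lemma dd_u:
  assumes y: "y \<in> V"
  shows "dd 1 (u k) y = - del y * Q k y / x 4 y" "dd 2 (u k) y = X 2 k y / x 4 y" "dd 3 (u k) y = X 3 k y / x 4 y"
proof -
  have nz: "\<And>y. y \<in> V \<Longrightarrow> x 4 y \<noteq> 0" using x4_pos by (metis less_irrefl)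
  have d: "dd i (u k) y = (X i k y * x 4 y - x k y * dd i (x 4) y) / (x 4 y)\<^sup>2" for i
    unfolding u_def[abs_def] dd_x[OF y, of i k, symmetric]
    by (rule dd_divide[OF smooth_x smooth_x y]) (rule nz)
  show "dd 1 (u k) y = - del y * Q k y / x 4 y" "dd 2 (u k) y = X 2 k y / x 4 y" "dd 3 (u k) y = X 3 k y / x 4 y"
    unfolding d dd_x4[OF y] Q_def using nz[OF y] del_nonzero[OF y]
    by (simp_all add: field_simps power2_eq_square)
qed

end

section \<open>Graphs of functions with unimodular Hessian\<close>

text \<open>As a sum of scaled axis vectors the map is accessible to the derivative rules for sums
  and scalings; \<open>slice\<close> is written in this form for the same reason.\<close>

lemma graph_surface_axis:
  "graph_surface f w = (w $ 1) *\<^sub>R axis 1 1 + (w $ 2) *\<^sub>R axis 2 1 + f w *\<^sub>R axis 3 1"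
  by (simp add: graph_surface_def vec_eq_iff forall_3 axis_def)

lemma vector_3_axis: "(vector [p, q, r] :: real^3) = p *\<^sub>R axis 1 1 + q *\<^sub>R axis 2 1 + r *\<^sub>R axis 3 1"
  by (simp add: vec_eq_iff forall_3 axis_def)

lemma smooth_graph_surface:
  assumes "open N" "smooth_on N f"
  shows "smooth_on N (graph_surface f)"
  unfolding graph_surface_axis[abs_def]
  by (intro smooth_on_add smooth_on_scaleR smooth_on_const smooth_on_component smooth_on_id assms)

lemma frechet_derivative_graph_surface:
  assumes "(f has_derivative f') (at w)"
  shows "frechet_derivative (graph_surface f) (at w) Y = vector [Y $ 1, Y $ 2, f' Y]"
proof -
  have "(graph_surface f has_derivative (\<lambda>Y. (Y $ 1) *\<^sub>R axis 1 1 + (Y $ 2) *\<^sub>R axis 2 1 + f' Y *\<^sub>R axis 3 1)) (at w)"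
    unfolding graph_surface_axis[abs_def]
    by (intro has_derivative_add has_derivative_scaleR_left assms
        bounded_linear.has_derivative[OF bounded_linear_vec_nth] has_derivative_ident)
  from fun_cong[OF frechet_derivative_at[OF this], of Y, symmetric] show ?thesis
    by (simp add: vector_3_axis)
qed

text \<open>Second derivatives of a graph are vertical, so with the vertical transversal the affine
  metric is the Hessian. The determinant in the volume condition is the planar determinant of X and
  Y, and its square times the Hessian determinant is the Gram determinant of X and Y.\<close>

lemma unimodular_graph_improper_affine_sphere:
  fixes f :: "real^2 \<Rightarrow> real"
  assumes N: "open N" and f: "smooth_on N f"
    and df: "\<And>w. w \<in> N \<Longrightarrow> (f has_derivative (\<lambda>Y. Y $ 1 * p w + Y $ 2 * q w)) (at w)"
    and dp: "\<And>w. w \<in> N \<Longrightarrow> (p has_derivative (\<lambda>X. X $ 1 * p1 w + X $ 2 * p2 w)) (at w)"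
    and dq: "\<And>w. w \<in> N \<Longrightarrow> (q has_derivative (\<lambda>X. X $ 1 * q1 w + X $ 2 * q2 w)) (at w)"
    and hess: "\<And>w. w \<in> N \<Longrightarrow> p1 w * q2 w - p2 w * q1 w = 1"
  shows "improper_affine_sphere_on N (graph_surface f) (vector [0, 0, 1])"
proof -
  let ?G = "graph_surface f" and ?\<zeta> = "vector [0, 0, 1] :: real^3"
  define H where "H w X Y = Y $ 1 * (X $ 1 * p1 w + X $ 2 * p2 w) + Y $ 2 * (X $ 1 * q1 w + X $ 2 * q2 w)"
    for w and X Y :: "real^2"
  have dG: "frechet_derivative ?G (at w) Y = vector [Y $ 1, Y $ 2, Y $ 1 * p w + Y $ 2 * q w]" if "w \<in> N" for w Y
    by (rule frechet_derivative_graph_surface[OF df[OF that]])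
  have d2G: "frechet_derivative (\<lambda>z. frechet_derivative ?G (at z) Y) (at w) X = vector [0, 0, H w X Y]"
    if w: "w \<in> N" for w X Y
  proof -
    have "((\<lambda>z. (Y $ 1) *\<^sub>R axis 1 1 + (Y $ 2) *\<^sub>R axis 2 1 + (Y $ 1 * p z + Y $ 2 * q z) *\<^sub>R axis 3 1 :: real^3)
      has_derivative (\<lambda>X. H w X Y *\<^sub>R axis 3 1)) (at w)"
      unfolding H_def by (auto intro!: derivative_eq_intros dp[OF w] dq[OF w])
    then have "((\<lambda>z. frechet_derivative ?G (at z) Y) has_derivative (\<lambda>X. H w X Y *\<^sub>R axis 3 1)) (at w)"
      by (rule has_derivative_transform_within_open[OF _ N w]) (simp add: dG vector_3_axis)
    from fun_cong[OF frechet_derivative_at[OF this], of X, symmetric] show ?thesis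
      by (simp add: vector_3_axis)
  qed
  have metric: "affine_metric ?G (\<lambda>_. ?\<zeta>) w X Y = H w X Y" if w: "w \<in> N" for w X Y
    unfolding affine_metric_def d2G[OF w] dG[OF w]
  proof (rule the_equality)
    show "\<exists>Z. vector [0, 0, H w X Y] = vector [Z $ 1, Z $ 2, Z $ 1 * p w + Z $ 2 * q w] + H w X Y *\<^sub>R ?\<zeta>"
      by (rule exI[of _ 0]) (simp add: vec_eq_iff forall_3)
    show "r = H w X Y" if "\<exists>Z. vector [0, 0, H w X Y] = vector [Z $ 1, Z $ 2, Z $ 1 * p w + Z $ 2 * q w] + r *\<^sub>R ?\<zeta>" for r
      using that by (auto simp: vec_eq_iff forall_3)
  qed
  have "immersion_on N ?G"
    unfolding immersion_on_def
  proof (intro conjI ballI smooth_graph_surface N f injI)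
    fix w X Y assume "w \<in> N" "frechet_derivative ?G (at w) X = frechet_derivative ?G (at w) Y"
    then show "X = Y" by (simp add: dG vec_eq_iff forall_3 forall_2)
  qed
  moreover have "affine_normal_on N ?G (\<lambda>_. ?\<zeta>)"
    unfolding affine_normal_on_def
  proof (intro conjI ballI allI impI)
    show "smooth_on N (\<lambda>_. ?\<zeta>)" by (rule smooth_on_const[OF N])
    fix w assume w: "w \<in> N"
    show "?\<zeta> \<notin> range (frechet_derivative ?G (at w))"
      by (auto simp: dG[OF w] vec_eq_iff forall_3)
    have "frechet_derivative ?G (at w) 0 = 0"
      by (simp add: dG[OF w] vec_eq_iff forall_3)
    then show "range (frechet_derivative (\<lambda>_. ?\<zeta>) (at w)) \<subseteq> range (frechet_derivative ?G (at w))"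
      using range_eqI[of 0 "frechet_derivative ?G (at w)", OF \<open>frechet_derivative ?G (at w) 0 = 0\<close>[symmetric]] by auto
    show "\<exists>Y. affine_metric ?G (\<lambda>_. ?\<zeta>) w X Y \<noteq> 0" if "X \<noteq> 0" for X
    proof (rule ccontr)
      assume "\<not> ?thesis"
      then have z: "H w X Y = 0" for Y using metric[OF w] by auto
      have 1: "X $ 1 * p1 w + X $ 2 * p2 w = 0" using z[of "axis 1 1"] by (simp add: H_def axis_def)
      have 2: "X $ 1 * q1 w + X $ 2 * q2 w = 0" using z[of "axis 2 1"] by (simp add: H_def axis_def)
      have "X $ 1 * (p1 w * q2 w - p2 w * q1 w) = 0" "X $ 2 * (p1 w * q2 w - p2 w * q1 w) = 0"
        using 1 2 by algebra+
      then show False using hess[OF w] that by (simp add: vec_eq_iff forall_2)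
    qed
    fix Xs :: "(real^2) list"
    assume Xs: "length Xs = CARD(2) \<and> orthonormal_list (affine_metric ?G (\<lambda>_. ?\<zeta>) w) Xs"
    then obtain X Y where XY: "Xs = [X, Y]" by (auto simp: length_Suc_conv numeral_2_eq_2)
    have on: "\<bar>H w ([X, Y] ! i) ([X, Y] ! j)\<bar> = (if i = j then 1 else 0)" if "i < 2" "j < 2" for i j
      using Xs that unfolding orthonormal_list_def XY metric[OF w] by simp
    have o: "\<bar>H w X X\<bar> = 1" "\<bar>H w Y Y\<bar> = 1" "H w X Y = 0"
      using on[of 0 0] on[of 1 1] on[of 0 1] by simp_all
    let ?d = "X $ 1 * Y $ 2 - X $ 2 * Y $ 1"
    have "H w X X * H w Y Y - H w X Y * H w Y X = (p1 w * q2 w - p2 w * q1 w) * ?d\<^sup>2"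
      unfolding H_def by algebra
    then have "H w X X * H w Y Y = ?d\<^sup>2" using o hess[OF w] by simp
    then have "\<bar>H w X X\<bar> * \<bar>H w Y Y\<bar> = ?d\<^sup>2" by (metis abs_mult abs_power2)
    then have "?d\<^sup>2 = 1" using o by simp
    then have "\<bar>?d\<bar> = 1" by (metis abs_square_eq_1)
    then show "\<bar>det (vector (map (frechet_derivative ?G (at w)) Xs @ [?\<zeta>]) :: real^3^3)\<bar> = 1"
      unfolding XY by (simp add: dG[OF w] det_3)
  qed
  ultimately show ?thesis unfolding improper_affine_sphere_on_def by blast
qed

lemma paraboloid_patch:
  fixes f :: "real^2 \<Rightarrow> real"
  assumes N: "open N" and f: "\<And>w. w \<in> N \<Longrightarrow> f w = ((w $ 1)\<^sup>2 + (w $ 2)\<^sup>2) / 2"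
  shows "\<exists>Q. elliptic_paraboloid Q \<and> graph_surface f ` N \<subseteq> Q \<and> openin (top_of_set Q) (graph_surface f ` N)"
proof -
  define T :: "real^3 \<Rightarrow> real^3" where "T x = vector [x $ 1, x $ 2, x $ 3 / 2]" for x
  define T' :: "real^3 \<Rightarrow> real^3" where "T' x = vector [x $ 1, x $ 2, 2 * x $ 3]" for x
  define Q :: "(real^3) set" where "Q = {x. x $ 3 = ((x $ 1)\<^sup>2 + (x $ 2)\<^sup>2) / 2}"
  have TT: "T (T' x) = x" "T' (T x) = x" for x by (simp_all add: T_def T'_def vec_eq_iff forall_3)
  have lin: "linear T"
    by (rule linearI) (simp_all add: T_def vec_eq_iff forall_3 add_divide_distrib)
  have bij: "bij T" by (rule o_bij[of T']) (auto simp: TT)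
  have "affine_iso T"
    unfolding affine_iso_def using lin bij by (intro exI[of _ T] exI[of _ 0]) auto
  moreover have "Q = T ` {x. x $ 3 = (x $ 1)\<^sup>2 + (x $ 2)\<^sup>2}"
  proof (intro equalityI subsetI)
    fix x assume "x \<in> Q"
    then have "T' x \<in> {x. x $ 3 = (x $ 1)\<^sup>2 + (x $ 2)\<^sup>2}" by (simp add: Q_def T'_def)
    then show "x \<in> T ` {x. x $ 3 = (x $ 1)\<^sup>2 + (x $ 2)\<^sup>2}"
      by (rule image_eqI[of _ T, OF TT(1)[symmetric]])
  qed (auto simp: Q_def T_def)
  ultimately have "elliptic_paraboloid Q" unfolding elliptic_paraboloid_def by blast
  moreover have sub: "graph_surface f ` N \<subseteq> Q"
    by (auto simp: Q_def graph_surface_def f)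
  moreover have "openin (top_of_set Q) (graph_surface f ` N)"
  proof -
    \<comment> \<open>The graph is the part of \<open>Q\<close> that lies over \<open>N\<close>,
      hence relatively open.\<close>
    define proj :: "real^3 \<Rightarrow> real^2" where "proj x = (x $ 1) *\<^sub>R axis 1 1 + (x $ 2) *\<^sub>R axis 2 1" for x
    have "continuous_on UNIV proj" unfolding proj_def[abs_def] by (intro continuous_intros)
    then have "open (proj -` N)" using N open_vimage by blast
    moreover have "graph_surface f ` N = Q \<inter> proj -` N"
    proof (intro equalityI subsetI)
      fix x assume x: "x \<in> Q \<inter> proj -` N"
      then have "graph_surface f (proj x) = x"
        by (simp add: Q_def graph_surface_def f) (simp add: proj_def axis_def vec_eq_iff forall_3)
      from image_eqI[of x "graph_surface f", OF this[symmetric]] show "x \<in> graph_surface f ` N" using x by blast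
    next
      fix x assume x: "x \<in> graph_surface f ` N"
      then obtain w where w: "w \<in> N" "x = graph_surface f w" by blast
      then have "proj x = w" by (simp add: proj_def graph_surface_def axis_def vec_eq_iff forall_2)
      then show "x \<in> Q \<inter> proj -` N" using w x sub by auto
    qed
    ultimately show ?thesis by (metis openin_open)
  qed
  ultimately show ?thesis by blast
qed

section \<open>Slices and boxes in the parameter domain\<close>

definition slice :: "real \<Rightarrow> real^2 \<Rightarrow> real^3" where
  "slice t w = t *\<^sub>R axis 1 1 + (w $ 1) *\<^sub>R axis 2 1 + (w $ 2) *\<^sub>R axis 3 1"

lemma slice_nth [simp]: "slice t w $ 1 = t" "slice t w $ 2 = w $ 1" "slice t w $ 3 = w $ 2"
  by (simp_all add: slice_def axis_def)

lemma slice_in_prod_domain [simp]: "slice t w \<in> prod_domain I N \<longleftrightarrow> t \<in> I \<and> w \<in> N"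
proof -
  have "vector [w $ 1, w $ 2] = w" by (simp add: vec_eq_iff forall_2)
  then show ?thesis by (simp add: prod_domain_def)
qed

lemma
  shows slice_derivative_fst: "((\<lambda>t. slice t w) has_derivative (\<lambda>h. slice h 0)) (at t)"
    and slice_derivative_snd: "((\<lambda>w. slice t w) has_derivative (\<lambda>h. slice 0 h)) (at w)"
  unfolding slice_def
  by (auto intro!: derivative_eq_intros bounded_linear.has_derivative[OF bounded_linear_vec_nth])

lemma smooth_slice:
  shows "open I \<Longrightarrow> smooth_on I (\<lambda>t. slice t w)" "open N \<Longrightarrow> smooth_on N (\<lambda>w. slice t w)"
  unfolding slice_def
  by (intro smooth_on_add smooth_on_scaleR smooth_on_const smooth_on_component smooth_on_id; assumption)+

lemma open_prod_domain:
  assumes "open I" "open N"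
  shows "open (prod_domain I N)"
proof -
  define proj :: "real^3 \<Rightarrow> real^2" where "proj x = (x $ 2) *\<^sub>R axis 1 1 + (x $ 3) *\<^sub>R axis 2 1" for x
  have "continuous_on UNIV proj" unfolding proj_def[abs_def] by (intro continuous_intros)
  then have "open (proj -` N)" using assms open_vimage by blast
  moreover have "open ((\<lambda>x. x $ 1) -` I :: (real^3) set)"
    using assms by (intro open_vimage continuous_intros)
  moreover have "prod_domain I N = (\<lambda>x. x $ 1) -` I \<inter> proj -` N"
  proof -
    have "proj x = vector [x $ 2, x $ 3]" for x by (simp add: proj_def axis_def vec_eq_iff forall_2)
    then show ?thesis by (auto simp: prod_domain_def)
  qed
  ultimately show ?thesis by auto
qed

lemma prod_domain_neighbourhood:
  assumes T: "open T" "slice t 0 \<in> T"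
  obtains \<epsilon> where "\<epsilon> > 0" "prod_domain {t - \<epsilon><..<t + \<epsilon>} (ball 0 \<epsilon>) \<subseteq> T"
proof -
  obtain r where r: "r > 0" "ball (slice t 0) r \<subseteq> T" using T openE by blast
  \<comment> \<open>The Euclidean norm is at most the sum of the three coordinate moduli, each below
    r/3.\<close>
  have "prod_domain {t - r / 3<..<t + r / 3} (ball 0 (r / 3)) \<subseteq> ball (slice t 0) r"
  proof
    fix z assume "z \<in> prod_domain {t - r / 3<..<t + r / 3} (ball 0 (r / 3))"
    then have z: "\<bar>z $ 1 - t\<bar> < r / 3" "norm (vector [z $ 2, z $ 3] :: real^2) < r / 3"
      unfolding prod_domain_def abs_less_iff by auto
    have "\<bar>z $ 2\<bar> < r / 3" "\<bar>z $ 3\<bar> < r / 3"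
      using z(2) component_le_norm_cart[of "vector [z $ 2, z $ 3] :: real^2" 1]
        component_le_norm_cart[of "vector [z $ 2, z $ 3] :: real^2" 2] by simp_all
    then have "(\<Sum>i\<in>UNIV. \<bar>(z - slice t 0) $ i\<bar>) < r"
      using z(1) by (simp add: sum_3)
    then have "norm (z - slice t 0) < r" using norm_le_l1_cart le_less_trans by blast
    then show "z \<in> ball (slice t 0) r" by (simp add: dist_norm norm_minus_commute)
  qed
  then show ?thesis using that[of "r / 3"] r by auto
qed

section \<open>The model chart\<close>

lemma vector_4_nth:
  "(vector [p, q, r, s] :: real^4) $ 1 = p" "(vector [p, q, r, s] :: real^4) $ 2 = q"
  "(vector [p, q, r, s] :: real^4) $ 3 = r" "(vector [p, q, r, s] :: real^4) $ 4 = s"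
  unfolding vector_def by simp_all

context model_coordinates
begin

definition phi :: "real^3 \<Rightarrow> real^3" where
  "phi y = slice (x 4 y) (vector [u 1 y, u 2 y])"

lemma phi_nth: "phi y $ 1 = x 4 y" "phi y $ 2 = u 1 y" "phi y $ 3 = u 2 y"
  by (simp_all add: phi_def)

lemma smooth_phi: "smooth_on V phi"
proof (rule smooth_on_vec[OF open_V])
  fix i :: 3
  show "smooth_on V (\<lambda>y. phi y $ i)"
    using exhaust_3[of i] smooth_x smooth_u by (auto simp: phi_nth)
qed

lemma phi_y0: "phi y0 = slice 1 0"
  by (simp add: vec_eq_iff forall_3 phi_nth x_y0 u_def)

lemma dd_phi:
  assumes y: "y \<in> V"
  shows "dd i phi y $ 1 = dd i (x 4) y" "dd i phi y $ 2 = dd i (u 1) y" "dd i phi y $ 3 = dd i (u 2) y"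
  using dd_component[OF smooth_phi y, of i 1] dd_component[OF smooth_phi y, of i 2] dd_component[OF smooth_phi y, of i 3]
  by (simp_all add: phi_nth)

text \<open>The preimage of \<open>v\<close> under the differential of \<open>phi\<close>, solved by
  Cramer's rule: \<open>e 1\<close> is sent to (del x_4, 0, 0) and \<open>e j\<close> to (0, X j 1 /
  x_4, X j 2 / x_4). As an explicit smooth field on \<open>V\<close> it feeds
  \<open>smooth_on_bootstrap\<close>.\<close>

definition lift :: "real^3 \<Rightarrow> real^3 \<Rightarrow> real^3" where
  "lift v y = (v $ 1 / (del y * x 4 y)) *\<^sub>R e 1 y
     + ((v $ 2 * X 3 2 y - v $ 3 * X 3 1 y) * x 4 y / M 1 2 y) *\<^sub>R e 2 y
     + ((v $ 3 * X 2 1 y - v $ 2 * X 2 2 y) * x 4 y / M 1 2 y) *\<^sub>R e 3 y"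

lemma smooth_lift: "smooth_on V (lift v)"
  unfolding lift_def[abs_def]
  by (intro smooth_on_add smooth_on_scaleR smooth_on_divide smooth_on_mult smooth_on_diff smooth_on_const
      open_V smooth_e smooth_del smooth_x smooth_X smooth_M)
    (use del_nonzero x4_pos M_nonzero in \<open>auto simp: less_imp_neq[symmetric]\<close>)

lemma deriv_lift:
  assumes q: "smooth_on V q" and y: "y \<in> V"
  shows "frechet_derivative q (at y) (lift v y) = (v $ 1 / (del y * x 4 y)) *\<^sub>R dd 1 q y
     + ((v $ 2 * X 3 2 y - v $ 3 * X 3 1 y) * x 4 y / M 1 2 y) *\<^sub>R dd 2 q y
     + ((v $ 3 * X 2 1 y - v $ 2 * X 2 2 y) * x 4 y / M 1 2 y) *\<^sub>R dd 3 q y"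
  unfolding lift_def dd_def
    linear_add[OF smooth_on_linear_deriv[OF q y]] linear_scale[OF smooth_on_linear_deriv[OF q y]] ..

lemma deriv_phi_lift:
  assumes y: "y \<in> V"
  shows "frechet_derivative phi (at y) (lift v y) = v"
proof -
  have nz: "del y \<noteq> 0" "x 4 y \<noteq> 0" using del_nonzero[OF y] x4_pos[OF y] by auto
  have q0: "Q 1 y = 0" "Q 2 y = 0" using Q_zero[OF _ y] by auto
  define m where "m = M 1 2 y"
  have m: "m \<noteq> 0" "m = X 2 1 y * X 3 2 y - X 2 2 y * X 3 1 y" using M_nonzero[OF y] by (auto simp: m_def M_def)
  have "(v $ 2 * X 3 2 y - v $ 3 * X 3 1 y) * X 2 1 y + (v $ 3 * X 2 1 y - v $ 2 * X 2 2 y) * X 3 1 y = v $ 2 * m"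
    "(v $ 2 * X 3 2 y - v $ 3 * X 3 1 y) * X 2 2 y + (v $ 3 * X 2 1 y - v $ 2 * X 2 2 y) * X 3 2 y = v $ 3 * m"
    unfolding m(2) by algebra+
  then have "((v $ 2 * X 3 2 y - v $ 3 * X 3 1 y) * X 2 1 y + (v $ 3 * X 2 1 y - v $ 2 * X 2 2 y) * X 3 1 y) / m = v $ 2"
    "((v $ 2 * X 3 2 y - v $ 3 * X 3 1 y) * X 2 2 y + (v $ 3 * X 2 1 y - v $ 2 * X 2 2 y) * X 3 2 y) / m = v $ 3"
    using m by simp_all
  then show ?thesis
    unfolding deriv_lift[OF smooth_phi y] m_def[symmetric] using nz
    by (simp add: vec_eq_iff forall_3 dd_phi[OF y] dd_x4[OF y] dd_u[OF y] q0 add_divide_distrib[symmetric])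
qed

text \<open>At height 1 the right sides in \<open>dd_a\<close> equal the determinant
  \<open>M 1 2 y\<close> of the linear system, so the quotients of Cramer's rule collapse to single
  entries.\<close>

lemma dd_a_height_1:
  assumes y: "y \<in> V" and h: "x 4 y = 1"
  shows "dd 2 a1 y = X 3 2 y" "dd 2 a2 y = - X 3 1 y" "dd 3 a1 y = - X 2 2 y" "dd 3 a2 y = X 2 1 y"
proof -
  have m: "w 3 y = M 1 2 y" using w3_x4[OF y] h by simp
  have "dd 2 a1 y * M 1 2 y = X 3 2 y * M 1 2 y" "dd 2 a2 y * M 1 2 y = - X 3 1 y * M 1 2 y"
    "dd 3 a1 y * M 1 2 y = - X 2 2 y * M 1 2 y" "dd 3 a2 y * M 1 2 y = X 2 1 y * M 1 2 y"
    using dd_a(3-6)[OF y] unfolding m unfolding M_def by algebra+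
  then show "dd 2 a1 y = X 3 2 y" "dd 2 a2 y = - X 3 1 y" "dd 3 a1 y = - X 2 2 y" "dd 3 a2 y = X 2 1 y"
    using M_nonzero[OF y] mult_right_cancel by blast+
qed

text \<open>In equal dimensions the right inverse \<open>lift\<close> of the differential is its
  inverse, which gives the derivative of \<psi> in the explicit form needed to prove \<psi>
  smooth.\<close>

lemma inverse_chart:
  obtains U' T \<psi> where "open U'" "U' \<subseteq> V" "y0 \<in> U'" "open T" "slice 1 0 \<in> T" "homeomorphism U' T phi \<psi>"
    "\<And>z. z \<in> T \<Longrightarrow> (\<psi> has_derivative (\<lambda>v. lift v (\<psi> z))) (at z)"
proof -
  define f' where "f' y = Blinfun (frechet_derivative phi (at y))" for y
  have f': "blinfun_apply (f' y) = frechet_derivative phi (at y)" if "y \<in> V" for y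
    unfolding f'_def using bounded_linear_Blinfun_apply[of "frechet_derivative phi (at y)"]
      has_derivative_bounded_linear[OF smooth_on_has_derivative[OF smooth_phi that]] by blast
  have inj: "inj (frechet_derivative phi (at y))" if "y \<in> V" for y
  proof -
    have "surj (frechet_derivative phi (at y))"
      by (rule surjI[of _ "\<lambda>v. lift v y"]) (rule deriv_phi_lift[OF that])
    then show ?thesis
      using linear_surjective_imp_injective[OF smooth_on_linear_deriv[OF smooth_phi that]] by simp
  qed
  \<comment> \<open>The inverse function theorem takes a left inverse of the derivative at the base
    point, as a bounded linear operator.\<close>
  obtain g where g: "linear g" "g \<circ> frechet_derivative phi (at y0) = id"
    using linear_injective_left_inverse[OF smooth_on_linear_deriv[OF smooth_phi y0] inj[OF y0]] by blast
  have gb: "blinfun_apply (Blinfun g) = g"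
    using bounded_linear_Blinfun_apply[of g] g(1) linear_conv_bounded_linear by blast
  have 1: "(phi has_derivative blinfun_apply (f' y)) (at y)" if "y \<in> V" for y
    using smooth_on_has_derivative[OF smooth_phi that] f'[OF that] by simp
  have 2: "continuous_on V f'"
  proof (rule continuous_on_blinfun_componentwise)
    fix i :: "real^3"
    have "continuous_on V (\<lambda>y. frechet_derivative phi (at y) i)"
      by (rule smooth_on_continuous_on[OF smooth_on_deriv[OF smooth_phi]])
    then show "continuous_on V (\<lambda>y. blinfun_apply (f' y) i)"
      by (rule continuous_on_eq) (simp add: f')
  qed
  have 3: "Blinfun g o\<^sub>L f' y0 = id_blinfun"
  proof (rule blinfun_eqI)
    fix v
    show "blinfun_apply (Blinfun g o\<^sub>L f' y0) v = blinfun_apply id_blinfun v"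
      using fun_cong[OF g(2), of v] by (simp add: gb f'[OF y0])
  qed
  obtain U' T \<psi> \<psi>' where *: "open U'" "U' \<subseteq> V" "y0 \<in> U'" "open T" "phi y0 \<in> T" "homeomorphism U' T phi \<psi>"
    "\<And>z. z \<in> T \<Longrightarrow> (\<psi> has_derivative (\<psi>' z)) (at z)"
    "\<And>z. z \<in> T \<Longrightarrow> \<psi>' z = inv (blinfun_apply (f' (\<psi> z)))"
    "\<And>z. z \<in> T \<Longrightarrow> bij (blinfun_apply (f' (\<psi> z)))"
    by (rule inverse_function_theorem[OF open_V _ 2 y0 3], erule 1) (rule that)
  have "(\<psi> has_derivative (\<lambda>v. lift v (\<psi> z))) (at z)" if z: "z \<in> T" for z
  proof -
    have "\<psi> z \<in> V" using *(2,6) z unfolding homeomorphism_def by blast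
    then have "\<psi>' z = (\<lambda>v. lift v (\<psi> z))"
      unfolding *(8)[OF z] f'[OF \<open>\<psi> z \<in> V\<close>] using inv_f_eq[OF inj deriv_phi_lift] by blast
    then show ?thesis using *(7)[OF z] by simp
  qed
  from that[OF *(1-4) _ *(6) this] *(5) show ?thesis unfolding phi_y0 by blast
qed

text \<open>In the coordinates \<open>(t,u,v)\<close> the third coordinate of the hypersurface is
  \<open>t f(u,v) + g(t)\<close>: the \<open>t\<close>-derivative of its quotient by \<open>t\<close> is \<open>-Q\<^sub>3/t\<^sup>2\<close>, and \<open>Q\<^sub>3\<close>
  depends on \<open>t\<close> only.\<close>

lemma local_model:
  shows "\<exists>V' \<psi> I N f \<gamma>. open V' \<and> V' \<subseteq> V \<and> y0 \<in> V' \<and> open I \<and> is_interval I \<and> open N \<and>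
    homeomorphism V' (prod_domain I N) phi \<psi> \<and> smooth_on (prod_domain I N) \<psi> \<and> smooth_on I \<gamma> \<and>
    improper_affine_sphere_on N (graph_surface f) (vector [0, 0, 1]) \<and>
    (\<forall>y\<in>V'. L (G y - P0) = model_hypersurface \<gamma> f (phi y)) \<and>
    ((\<forall>y\<in>V. mu y = 0) \<longrightarrow> (\<exists>Q. elliptic_paraboloid Q \<and> graph_surface f ` N \<subseteq> Q \<and>
       openin (top_of_set Q) (graph_surface f ` N)))"
proof -
  obtain U' T \<psi> where U': "open U'" "U' \<subseteq> V" "y0 \<in> U'" and T: "open T" "slice 1 0 \<in> T"
    and hom: "homeomorphism U' T phi \<psi>"
    and d\<psi>: "\<And>z. z \<in> T \<Longrightarrow> (\<psi> has_derivative (\<lambda>v. lift v (\<psi> z))) (at z)"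
    using inverse_chart by metis
  obtain \<epsilon> where \<epsilon>: "\<epsilon> > 0" "prod_domain {1 - \<epsilon><..<1 + \<epsilon>} (ball 0 \<epsilon>) \<subseteq> T"
    using prod_domain_neighbourhood[OF T] .
  define I where "I = {1 - \<epsilon><..<1 + \<epsilon>}"
  define N where "N = ball (0 :: real^2) \<epsilon>"
  let ?B = "prod_domain I N"
  \<comment> \<open>Restricting to the preimage of a box makes vanishing derivatives imply constancy
    along each of the convex factors \<open>I\<close> and \<open>N\<close>.\<close>
  define V' where "V' = U' \<inter> phi -` ?B"
  have BT: "?B \<subseteq> T" using \<epsilon> by (simp add: I_def N_def)
  have oI: "open I" "1 \<in> I" "convex I" "is_interval I"
    and oN: "open N" "0 \<in> N" "convex N" using \<epsilon> by (auto simp: I_def N_def is_interval_convex_1)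
  have oB: "open ?B" by (rule open_prod_domain[OF oI(1) oN(1)])
  have "continuous_on U' phi" using hom by (simp add: homeomorphism_def)
  then have oV': "open V'" unfolding V'_def using U'(1) oB continuous_open_preimage by blast
  have \<psi>1: "\<psi> z \<in> V'" "phi (\<psi> z) = z" if "z \<in> ?B" for z
    using hom that BT unfolding homeomorphism_def V'_def by auto
  have \<psi>2: "\<psi> (phi y) = y" if "y \<in> V'" for y
    using hom that unfolding homeomorphism_def V'_def by auto
  have V'V: "V' \<subseteq> V" using U'(2) by (auto simp: V'_def)
  have \<psi>V: "\<psi> z \<in> V" if "z \<in> ?B" for z using \<psi>1[OF that] V'V by blast
  have \<psi>y0: "\<psi> (slice 1 0) = y0" and y0V': "y0 \<in> V'"
  proof -
    show "y0 \<in> V'" using U'(3) oI oN by (simp add: V'_def phi_y0)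
    then show "\<psi> (slice 1 0) = y0" using \<psi>2 phi_y0 by metis
  qed
  have hom': "homeomorphism V' ?B phi \<psi>"
    unfolding homeomorphism_def
  proof (intro conjI ballI)
    show "continuous_on V' phi" using smooth_on_continuous_on[OF smooth_phi] V'V continuous_on_subset by blast
    have "continuous_on T \<psi>" using hom by (simp add: homeomorphism_def)
    then show "continuous_on ?B \<psi>" using BT by (rule continuous_on_subset)
    have phiV': "phi y \<in> ?B" if "y \<in> V'" for y using that by (simp add: V'_def)
    show "phi ` V' = ?B"
    proof (intro equalityI subsetI)
      fix z assume "z \<in> ?B"
      then show "z \<in> phi ` V'" using \<psi>1[of z] imageI[of "\<psi> z" V' phi] by simp
    qed (use phiV' in auto)
    show "\<psi> ` ?B = V'"
    proof (intro equalityI subsetI)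
      fix y assume "y \<in> V'"
      then show "y \<in> \<psi> ` ?B" using \<psi>2[of y] imageI[OF phiV'[of y], of \<psi>] by simp
    qed (use \<psi>1 in auto)
  qed (use \<psi>1 \<psi>2 in auto)
  \<comment> \<open>The inverse function theorem supplies one derivative; since that derivative is
    \<open>lift\<close> evaluated along \<psi>, all higher ones follow.\<close>
  have s\<psi>: "smooth_on ?B \<psi>"
    by (rule smooth_on_bootstrap[OF oB _ d\<psi> smooth_lift]) (use BT \<psi>V in auto)
  have smooth_pull: "smooth_on ?B (\<lambda>z. q (\<psi> z))" if "smooth_on V q" for q :: "real^3 \<Rightarrow> real"
    by (rule smooth_on_compose[OF oB that s\<psi>]) (use \<psi>V in auto)
  have dpull: "((\<lambda>z. q (\<psi> z)) has_derivative (\<lambda>v. v $ 1 / (del (\<psi> z) * x 4 (\<psi> z)) * dd 1 q (\<psi> z)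
     + (v $ 2 * X 3 2 (\<psi> z) - v $ 3 * X 3 1 (\<psi> z)) * x 4 (\<psi> z) / M 1 2 (\<psi> z) * dd 2 q (\<psi> z)
     + (v $ 3 * X 2 1 (\<psi> z) - v $ 2 * X 2 2 (\<psi> z)) * x 4 (\<psi> z) / M 1 2 (\<psi> z) * dd 3 q (\<psi> z))) (at z)"
    if q: "smooth_on V q" and z: "z \<in> ?B" for q :: "real^3 \<Rightarrow> real" and z
  proof -
    have "((\<lambda>z. q (\<psi> z)) has_derivative (\<lambda>v. frechet_derivative q (at (\<psi> z)) (lift v (\<psi> z)))) (at z)"
      using diff_chain_at[OF d\<psi> smooth_on_has_derivative[OF q \<psi>V[OF z]]] z BT by (auto simp: o_def)
    then show ?thesis unfolding deriv_lift[OF q \<psi>V[OF z]] by simp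
  qed
  have x4: "x 4 (\<psi> z) = z $ 1" if "z \<in> ?B" for z
    using \<psi>1(2)[OF that] phi_nth(1)[of "\<psi> z"] by simp
  have Qt: "Q 3 (\<psi> (slice t w)) = Q 3 (\<psi> (slice t 0))" if t: "t \<in> I" and w: "w \<in> N" for t w
  proof (rule has_derivative_zero_unique[OF oN(3) _ w oN(2), of "\<lambda>w. Q 3 (\<psi> (slice t w))"])
    fix w assume "w \<in> N"
    then have z: "slice t w \<in> ?B" using t by simp
    show "((\<lambda>w. Q 3 (\<psi> (slice t w))) has_derivative (\<lambda>h. 0)) (at w within N)"
      using has_derivative_at_withinI[OF diff_chain_at[OF slice_derivative_snd dpull[OF smooth_Q z]]]
      by (simp add: o_def dd_Q[OF \<psi>V[OF z]])
  qed
  \<comment> \<open>For every \<open>w\<close> the t-derivative is the same function of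
    \<open>t\<close>, so the difference of two such quotients keeps its value at t = 1. This
    separates the variables.\<close>
  have Yt: "u 3 (\<psi> (slice t w)) - u 3 (\<psi> (slice t 0)) = u 3 (\<psi> (slice 1 w)) - u 3 (\<psi> (slice 1 0))"
    if t: "t \<in> I" and w: "w \<in> N" for t w
  proof (rule has_derivative_zero_unique[OF oI(3) _ t oI(2), of "\<lambda>t. u 3 (\<psi> (slice t w)) - u 3 (\<psi> (slice t 0))"])
    fix t assume t: "t \<in> I"
    have d: "((\<lambda>t. u 3 (\<psi> (slice t w))) has_derivative (\<lambda>h. - h / t\<^sup>2 * Q 3 (\<psi> (slice t 0)))) (at t)"
      if w: "w \<in> N" for w
    proof -
      have z: "slice t w \<in> ?B" using t w by simp
      have "((\<lambda>t. u 3 (\<psi> (slice t w))) has_derivative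
         (\<lambda>h. h / (del (\<psi> (slice t w)) * x 4 (\<psi> (slice t w))) * dd 1 (u 3) (\<psi> (slice t w)))) (at t)"
        using diff_chain_at[OF slice_derivative_fst dpull[OF smooth_u z]] by (simp add: o_def)
      then show ?thesis
        unfolding dd_u[OF \<psi>V[OF z]] Qt[OF t w] x4[OF z]
        using del_nonzero[OF \<psi>V[OF z]] by (simp add: power2_eq_square)
    qed
    show "((\<lambda>t. u 3 (\<psi> (slice t w)) - u 3 (\<psi> (slice t 0))) has_derivative (\<lambda>h. 0)) (at t within I)"
      using has_derivative_at_withinI[OF has_derivative_diff[OF d[OF w] d[OF oN(2)]]] by simp
  qed
  \<comment> \<open>\<open>f\<close> is read off the slice of height 1. The second component of
    \<gamma> carries the factor t because the quotient by the height is multiplied back; it vanishes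
    at t = 1.\<close>
  define f where "f w = x 3 (\<psi> (slice 1 w))" for w
  define \<gamma> :: "real \<Rightarrow> real^2" where
    "\<gamma> t = t *\<^sub>R axis 1 1 + (t * (u 3 (\<psi> (slice t 0)) - u 3 (\<psi> (slice 1 0)))) *\<^sub>R axis 2 1" for t
  have inB: "slice 1 w \<in> ?B" if "w \<in> N" for w using that oI by simp
  have u3f: "u 3 (\<psi> (slice 1 w)) = f w" if "w \<in> N" for w
    using x4[OF inB[OF that]] by (simp add: f_def u_def)
  have sf: "smooth_on N f"
    unfolding f_def[abs_def]
    by (rule smooth_on_compose[OF oN(1) smooth_pull[OF smooth_x] smooth_slice(2)[OF oN(1)]]) (use inB in auto)
  have s\<gamma>: "smooth_on I \<gamma>"
    unfolding \<gamma>_def[abs_def]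
    by (intro smooth_on_add smooth_on_scaleR smooth_on_mult smooth_on_diff smooth_on_const smooth_on_id oI
        smooth_on_compose[OF oI(1) smooth_pull[OF smooth_u] smooth_slice(1)[OF oI(1)]]) (use oN in auto)
  have model: "L (G y - P0) = model_hypersurface \<gamma> f (phi y)" if y: "y \<in> V'" for y
  proof -
    define t where "t = x 4 y"
    define w :: "real^2" where "w = vector [u 1 y, u 2 y]"
    have ph: "phi y = slice t w" by (simp add: phi_def t_def w_def)
    have tw: "t \<in> I" "w \<in> N" using y ph by (auto simp: V'_def)
    have t: "t \<noteq> 0" using x4_pos y V'V unfolding t_def by (metis less_irrefl subsetD)
    have py: "\<psi> (slice t w) = y" using \<psi>2[OF y] ph by simp
    have u3: "u 3 y = f w + (u 3 (\<psi> (slice t 0)) - u 3 (\<psi> (slice 1 0)))"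
      using Yt[OF tw] u3f[OF tw(2)] py by simp
    have tu: "x k y = t * u k y" for k using t by (simp add: u_def t_def)
    have "x 3 y = t * f w + t * (u 3 (\<psi> (slice t 0)) - u 3 (\<psi> (slice 1 0)))"
      "x 1 y = t * w $ 1" "x 2 y = t * w $ 2"
      unfolding tu u3 by (simp_all add: w_def algebra_simps)
    moreover have "vector [w $ 1, w $ 2] = w" by (simp add: w_def)
    moreover have "L (G y - P0) = vector [x 1 y, x 2 y, x 3 y, x 4 y]"
      by (simp add: vec_eq_iff forall_4 x_def vector_4_nth)
    moreover have "\<gamma> t $ 1 = t" "\<gamma> t $ 2 = t * (u 3 (\<psi> (slice t 0)) - u 3 (\<psi> (slice 1 0)))"
      by (simp_all add: \<gamma>_def axis_def)
    ultimately show ?thesis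
      unfolding model_hypersurface_def ph Let_def by (simp add: t_def[symmetric])
  qed
  \<comment> \<open>The derivatives of \<open>f\<close> are computed on the slice of height 1, where
    the factors \<open>x 4\<close> in \<open>lift\<close> disappear.\<close>
  define c where "c r = \<psi> (slice 1 r)" for r
  have cV: "c r \<in> V" and x4c: "x 4 (c r) = 1" if "r \<in> N" for r
    using \<psi>V[OF inB[OF that]] x4[OF inB[OF that]] by (simp_all add: c_def)
  have c0: "c 0 = y0" by (simp add: c_def \<psi>y0)
  have dN: "((\<lambda>r. q (c r)) has_derivative (\<lambda>v.
      v $ 1 * ((X 3 2 (c r) * dd 2 q (c r) - X 2 2 (c r) * dd 3 q (c r)) / M 1 2 (c r))
    + v $ 2 * ((X 2 1 (c r) * dd 3 q (c r) - X 3 1 (c r) * dd 2 q (c r)) / M 1 2 (c r)))) (at r)"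
    if q: "smooth_on V q" and r: "r \<in> N" for q :: "real^3 \<Rightarrow> real" and r
  proof -
    note d = diff_chain_at[OF slice_derivative_snd dpull[OF q inB[OF r]], unfolded o_def, folded c_def, unfolded x4c[OF r]]
    show ?thesis
      by (rule has_derivative_eq_rhs[OF d])
        (simp add: fun_eq_iff diff_divide_distrib left_diff_distrib right_diff_distrib mult_ac)
  qed
  let ?m = "\<lambda>r. M 1 2 (c r)"
  have m0: "?m r \<noteq> 0" if "r \<in> N" for r by (rule M_nonzero[OF cV[OF that]])
  have df: "(f has_derivative (\<lambda>v. v $ 1 * a1 (c r) + v $ 2 * a2 (c r))) (at r)" if r: "r \<in> N" for r
  proof -
    have "(X 3 2 (c r) * X 2 3 (c r) - X 2 2 (c r) * X 3 3 (c r)) / ?m r = a1 (c r)"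
      "(X 2 1 (c r) * X 3 3 (c r) - X 3 1 (c r) * X 2 3 (c r)) / ?m r = a2 (c r)"
      by (simp_all add: a1_def a2_def M_def mult.commute)
    then show ?thesis
      using dN[OF smooth_x[of 3] r] unfolding dd_x[OF cV[OF r]] by (simp add: f_def[abs_def] c_def[symmetric])
  qed
  \<comment> \<open>The entries of the Hessian of \<open>f\<close>: the adjugate of the inverse leaf
    metric, divided by the minor. From here on \<open>?B\<close> is the mixed entry and no longer
    the box.\<close>
  let ?A = "\<lambda>r. (X 3 2 (c r) * X 3 2 (c r) + X 2 2 (c r) * X 2 2 (c r)) / ?m r"
  let ?B = "\<lambda>r. - (X 2 1 (c r) * X 2 2 (c r) + X 3 1 (c r) * X 3 2 (c r)) / ?m r"
  let ?C = "\<lambda>r. (X 2 1 (c r) * X 2 1 (c r) + X 3 1 (c r) * X 3 1 (c r)) / ?m r"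
  have da: "((\<lambda>r. a1 (c r)) has_derivative (\<lambda>v. v $ 1 * ?A r + v $ 2 * ?B r)) (at r)"
    "((\<lambda>r. a2 (c r)) has_derivative (\<lambda>v. v $ 1 * ?B r + v $ 2 * ?C r)) (at r)" if r: "r \<in> N" for r
    by (rule has_derivative_eq_rhs[OF dN[OF smooth_a(1) r]], simp add: dd_a_height_1[OF cV[OF r] x4c[OF r]] fun_eq_iff mult_ac)
       (rule has_derivative_eq_rhs[OF dN[OF smooth_a(2) r]], simp add: dd_a_height_1[OF cV[OF r] x4c[OF r]] fun_eq_iff mult_ac)
  \<comment> \<open>Lagrange's identity: the Gram determinant of two planar vectors is the square of
    their minor.\<close>
  have hess: "?A r * ?C r - ?B r * ?B r = 1" if r: "r \<in> N" for r
  proof -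
    let ?p = "X 2 1 (c r)" and ?q = "X 2 2 (c r)" and ?s = "X 3 1 (c r)" and ?t = "X 3 2 (c r)"
    have "(?t * ?t + ?q * ?q) * (?p * ?p + ?s * ?s) - (?p * ?q + ?s * ?t) * (?p * ?q + ?s * ?t) = ?m r * ?m r"
      unfolding M_def by algebra
    then have "((?t * ?t + ?q * ?q) * (?p * ?p + ?s * ?s) - (?p * ?q + ?s * ?t) * (?p * ?q + ?s * ?t)) / (?m r * ?m r) = 1"
      using m0[OF r] by simp
    then show ?thesis by (simp only: diff_divide_distrib times_divide_times_eq minus_mult_minus)
  qed
  have sphere: "improper_affine_sphere_on N (graph_surface f) (vector [0, 0, 1])"
    by (rule unimodular_graph_improper_affine_sphere[OF oN(1) sf df da hess])
  have paraboloid: "\<exists>Q. elliptic_paraboloid Q \<and> graph_surface f ` N \<subseteq> Q \<and>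
       openin (top_of_set Q) (graph_surface f ` N)" if mu: "\<forall>y\<in>V. mu y = 0"
  proof (rule paraboloid_patch[OF oN(1)])
    \<comment> \<open>At \<open>y0\<close> the inverse leaf metric is the identity, so
      \<open>circular\<close> makes the three sums equal to the minor, 0 and the minor.\<close>
    have ABC: "?A r = 1" "?B r = 0" "?C r = 1" if r: "r \<in> N" for r
      using circular[OF _ cV[OF r], of 1 1] circular[OF _ cV[OF r], of 1 2] circular[OF _ cV[OF r], of 2 2] m0[OF r] mu
      by (simp_all add: X_y0 add.commute)
    have a0: "a1 (c 0) = 0" "a2 (c 0) = 0" "f 0 = 0"
      by (simp_all add: c0 a1_def a2_def M_def X_y0 f_def \<psi>y0 x_y0)
    have p: "a1 (c r) = r $ 1" "a2 (c r) = r $ 2" if r: "r \<in> N" for r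
    proof -
      have "a1 (c r) - r $ 1 = a1 (c 0) - (0::real^2) $ 1"
      proof (rule has_derivative_zero_unique[OF oN(3) _ r oN(2), of "\<lambda>r. a1 (c r) - r $ 1"])
        fix r assume r: "r \<in> N"
        have "((\<lambda>r. a1 (c r) - r $ 1) has_derivative (\<lambda>v. (v $ 1 * ?A r + v $ 2 * ?B r) - v $ 1)) (at r)"
          by (intro has_derivative_diff da r bounded_linear.has_derivative[OF bounded_linear_vec_nth] has_derivative_ident)
        then show "((\<lambda>r. a1 (c r) - r $ 1) has_derivative (\<lambda>h. 0)) (at r within N)"
          unfolding ABC[OF r] using has_derivative_at_withinI by fastforce
      qed
      then show "a1 (c r) = r $ 1" by (simp add: a0)
      have "a2 (c r) - r $ 2 = a2 (c 0) - (0::real^2) $ 2"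
      proof (rule has_derivative_zero_unique[OF oN(3) _ r oN(2), of "\<lambda>r. a2 (c r) - r $ 2"])
        fix r assume r: "r \<in> N"
        have "((\<lambda>r. a2 (c r) - r $ 2) has_derivative (\<lambda>v. (v $ 1 * ?B r + v $ 2 * ?C r) - v $ 2)) (at r)"
          by (intro has_derivative_diff da r bounded_linear.has_derivative[OF bounded_linear_vec_nth] has_derivative_ident)
        then show "((\<lambda>r. a2 (c r) - r $ 2) has_derivative (\<lambda>h. 0)) (at r within N)"
          unfolding ABC[OF r] using has_derivative_at_withinI by fastforce
      qed
      then show "a2 (c r) = r $ 2" by (simp add: a0)
    qed
    fix r assume r: "r \<in> N"
    have "f r - ((r $ 1)\<^sup>2 + (r $ 2)\<^sup>2) / 2 = f 0 - (((0::real^2) $ 1)\<^sup>2 + ((0::real^2) $ 2)\<^sup>2) / 2"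
    proof (rule has_derivative_zero_unique[OF oN(3) _ r oN(2), of "\<lambda>r. f r - ((r $ 1)\<^sup>2 + (r $ 2)\<^sup>2) / 2"])
      fix r assume r: "r \<in> N"
      have "((\<lambda>r. f r - ((r $ 1)\<^sup>2 + (r $ 2)\<^sup>2) / 2) has_derivative
          (\<lambda>v. (v $ 1 * a1 (c r) + v $ 2 * a2 (c r)) - (2 * (r $ 1) * (v $ 1) + 2 * (r $ 2) * (v $ 2)) / 2)) (at r)"
        by (auto intro!: derivative_eq_intros df[OF r] bounded_linear.has_derivative[OF bounded_linear_vec_nth] simp: fun_eq_iff)
      then have "((\<lambda>r. f r - ((r $ 1)\<^sup>2 + (r $ 2)\<^sup>2) / 2) has_derivative (\<lambda>h. 0)) (at r)"
        by (rule has_derivative_eq_rhs) (simp add: p[OF r] fun_eq_iff)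
      then show "((\<lambda>r. f r - ((r $ 1)\<^sup>2 + (r $ 2)\<^sup>2) / 2) has_derivative (\<lambda>h. 0)) (at r within N)"
        by (rule has_derivative_at_withinI)
    qed
    then show "f r = ((r $ 1)\<^sup>2 + (r $ 2)\<^sup>2) / 2" by (simp add: a0)
  qed
  show ?thesis
    by (rule exI[of _ V'], rule exI[of _ \<psi>], rule exI[of _ I], rule exI[of _ N], rule exI[of _ f],
        rule exI[of _ \<gamma>], intro conjI ballI impI)
      (rule oV' V'V y0V' oI(1) oI(4) oN(1) hom' s\<psi> s\<gamma> sphere | erule model paraboloid)+
qed

end

section \<open>From charts to the manifold\<close>

lemma frame_on_subset: "frame_on V e \<Longrightarrow> open V' \<Longrightarrow> V' \<subseteq> V \<Longrightarrow> frame_on V' e"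
  unfolding frame_on_def using smooth_on_subset by (metis subsetD)

lemma symmetry_frame_subset:
  assumes "symmetry_frame V e G \<xi> lam mu a b eta" and V': "open V'" "V' \<subseteq> V"
  shows "symmetry_frame V' e G \<xi> lam mu a b eta"
proof -
  interpret symmetry_frame V e G \<xi> lam mu a b eta by fact
  interpret V': frame_on V' e by (rule frame_on_subset[OF frame_on_axioms V'])
  show ?thesis
  proof unfold_locales
    show "smooth_on V' G" "smooth_on V' \<xi>" using smooth_G smooth_\<xi> smooth_on_subset[OF _ V'(2)] by auto
    fix y assume "y \<in> V'"
    then have y: "y \<in> V" using V' by blast
    show "inj (dG y)" "\<xi> y \<notin> range (dG y)" "range (frechet_derivative \<xi> (at y)) \<subseteq> range (dG y)"
      using inj_dG[OF y] transversal[OF y] equiaffine[OF y] .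
    show "h y (e i y) (e j y) = (if i = j then 1 else 0)" for i j by (rule orthonormal[OF y])
    show "normal_form (h y) (difference_tensor G \<xi> y) (shape_operator G \<xi> y) (\<lambda>i. e i y) (lam y) (mu y) (a y) (b y)"
      by (rule normal[OF y])
    show "eta y = h y (levi_civita h (e 2) (e 1) y) (e 2 y)" "eta y = h y (levi_civita h (e 3) (e 1) y) (e 3 y)"
      using eta2[OF y] eta3[OF y] .
    show "lam y > 0" "b y = - (eta y)\<^sup>2 + (lam y)\<^sup>2" using lam_pos[OF y] b_eq[OF y] .
  qed
qed

lemma nonvanishing_ball:
  fixes f g :: "'a::metric_space \<Rightarrow> real"
  assumes V: "open V" and f: "continuous_on V f" and g: "continuous_on V g"
    and y: "y \<in> V" "f y \<noteq> 0" "g y > 0"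
  obtains r where "r > 0" "ball y r \<subseteq> V" "\<And>z. z \<in> ball y r \<Longrightarrow> f z \<noteq> 0" "\<And>z. z \<in> ball y r \<Longrightarrow> g z > 0"
proof -
  have "open (V \<inter> f -` (- {0}))" "open (V \<inter> g -` {0<..})"
    using continuous_open_preimage[OF f V] continuous_open_preimage[OF g V] by auto
  then have "open ((V \<inter> f -` (- {0})) \<inter> (V \<inter> g -` {0<..}))" by blast
  moreover have "y \<in> (V \<inter> f -` (- {0})) \<inter> (V \<inter> g -` {0<..})" using y by auto
  ultimately obtain r where "r > 0" "ball y r \<subseteq> (V \<inter> f -` (- {0})) \<inter> (V \<inter> g -` {0<..})"
    using openE by blast
  then show ?thesis by (intro that[of r]) auto
qed

section \<open>Normalisation at a base point\<close>

context symmetry_frame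
begin

text \<open>\<open>L\<close> inverts the map \<open>B\<close> built from \<open>E 2\<close>,
  \<open>E 3\<close>, \<open>W\<close> and E_1/s. The scale s = del y0 turns E_1/\<delta> into the
  fourth axis vector for the model; s = 1 serves as long as \<open>del\<close> may vanish.\<close>

lemma adapted_basis:
  assumes y0: "y0 \<in> V" and s: "s \<noteq> 0"
  obtains L B :: "real^4 \<Rightarrow> real^4" where "linear L" "linear B" "\<And>v. L (B v) = v" "\<And>v. B (L v) = v"
    "L (E 2 y0) = axis 1 1" "L (E 3 y0) = axis 2 1" "L (W y0) = axis 3 1" "L (E 1 y0) = s *\<^sub>R axis 4 1"
proof -
  define B :: "real^4 \<Rightarrow> real^4" where
    "B v = v $ 1 *\<^sub>R E 2 y0 + v $ 2 *\<^sub>R E 3 y0 + v $ 3 *\<^sub>R W y0 + (v $ 4 / s) *\<^sub>R E 1 y0" for v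
  have lin: "linear B"
    by (rule linearI) (simp_all add: B_def algebra_simps add_divide_distrib)
  have "inj B"
  proof (rule linear_injective_0[OF lin, THEN iffD2, rule_format])
    fix v assume "B v = 0"
    define c :: "3 \<Rightarrow> real" where
      "c i = (if i = 1 then v $ 4 / s - (lam y0 + eta y0) * v $ 3 else if i = 2 then v $ 1 else v $ 2)" for i
    have "(\<Sum>i\<in>UNIV. c i *\<^sub>R E i y0) + v $ 3 *\<^sub>R \<xi> y0 = B v"
      by (simp add: sum_3 c_def B_def W_def algebra_simps)
    also have "\<dots> = (\<Sum>i\<in>UNIV. 0 *\<^sub>R E i y0) + 0 *\<^sub>R \<xi> y0" using \<open>B v = 0\<close> by simp
    finally have eq: "(\<Sum>i\<in>UNIV. c i *\<^sub>R E i y0) + v $ 3 *\<^sub>R \<xi> y0 = (\<Sum>i\<in>UNIV. 0 *\<^sub>R E i y0) + 0 *\<^sub>R \<xi> y0" .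
    have "v $ 3 = 0" "c 1 = 0" "c 2 = 0" "c 3 = 0"
      using frame_coefficients_unique[OF y0 eq] by auto
    then show "v = 0" using s by (simp add: c_def vec_eq_iff forall_4)
  qed
  then obtain L where L: "linear L" "\<And>v. L (B v) = v" "\<And>v. B (L v) = v"
    using linear_injective_isomorphism[OF lin] by auto
  have "B (axis 1 1) = E 2 y0" "B (axis 2 1) = E 3 y0" "B (axis 3 1) = W y0" "B (s *\<^sub>R axis 4 1) = E 1 y0"
    using s by (simp_all add: B_def axis_def)
  then have "L (E 2 y0) = axis 1 1" "L (E 3 y0) = axis 2 1" "L (W y0) = axis 3 1" "L (E 1 y0) = s *\<^sub>R axis 4 1"
    using L(2) by metis+
  then show ?thesis by (rule that[OF L(1) lin L(2,3)])
qed

text \<open>The functions \<open>f\<close> and \<open>g\<close> carry further open conditions to be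
  met on the same ball, such as positivity of the height.\<close>

lemma adapted_coordinates_exist:
  assumes y0: "y0 \<in> V" and L: "linear L" "L (E 2 y0) = axis 1 1" "L (E 3 y0) = axis 2 1" "L (W y0) = axis 3 1"
    and f: "continuous_on V f" "f y0 \<noteq> (0::real)" and g: "continuous_on V g" "g y0 > (0::real)"
  obtains r where "r > 0" "ball y0 r \<subseteq> V" "adapted_coordinates (ball y0 r) e G \<xi> lam mu a b eta L y0"
    "\<And>z. z \<in> ball y0 r \<Longrightarrow> f z \<noteq> 0" "\<And>z. z \<in> ball y0 r \<Longrightarrow> g z > 0"
proof -
  let ?w = "\<lambda>y. L (W y) $ 3" and ?M = "\<lambda>y. L (E 2 y) $ 1 * L (E 3 y) $ 2 - L (E 2 y) $ 2 * L (E 3 y) $ 1"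
  have cont: "continuous_on V (\<lambda>y. L (\<Phi> y) $ k)" if "smooth_on V \<Phi>" for \<Phi> :: "real^3 \<Rightarrow> real^4" and k
    using smooth_on_continuous_on[OF smooth_on_component[OF open_V smooth_on_linear[OF L(1) open_V that]]] .
  have "continuous_on V (\<lambda>y. ?w y * ?M y * f y)"
    by (intro continuous_intros cont smooth_W smooth_E f)
  moreover have "?w y0 * ?M y0 * f y0 \<noteq> 0" using f by (simp add: L axis_def)
  ultimately obtain r where r: "r > 0" "ball y0 r \<subseteq> V" "\<And>z. z \<in> ball y0 r \<Longrightarrow> ?w z * ?M z * f z \<noteq> 0"
      "\<And>z. z \<in> ball y0 r \<Longrightarrow> g z > 0"
    using nonvanishing_ball[OF open_V _ g(1) y0 _ g(2), of "\<lambda>y. ?w y * ?M y * f y"] by blast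
  have "adapted_coordinates (ball y0 r) e G \<xi> lam mu a b eta L y0"
    unfolding adapted_coordinates_def adapted_coordinates_axioms_def
    using symmetry_frame_subset[OF symmetry_frame_axioms open_ball r(2)] r L by auto
  then show ?thesis using that r by auto
qed

text \<open>\<open>del_M\<close> on a small ball around \<open>y0\<close>: the minor has no zeros
  there. This is the local input of the connectedness argument.\<close>

lemma del_dichotomy:
  assumes y0: "y0 \<in> V"
  obtains V' where "open V'" "y0 \<in> V'" "V' \<subseteq> V" "\<And>y. y \<in> V' \<Longrightarrow> del y = 0 \<longleftrightarrow> del y0 = 0"
proof -
  obtain L B :: "real^4 \<Rightarrow> real^4" where L: "linear L" "linear B" "\<And>v. L (B v) = v" "\<And>v. B (L v) = v"
    "L (E 2 y0) = axis 1 1" "L (E 3 y0) = axis 2 1" "L (W y0) = axis 3 1" "L (E 1 y0) = 1 *\<^sub>R axis 4 1"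
    using adapted_basis[OF y0, of 1] by auto
  obtain r where r: "r > 0" "ball y0 r \<subseteq> V" "adapted_coordinates (ball y0 r) e G \<xi> lam mu a b eta L y0"
    by (rule adapted_coordinates_exist[OF y0 L(1,5,6,7) continuous_on_const _ continuous_on_const, of 1 1])
      (simp_all add: that)
  interpret A: adapted_coordinates "ball y0 r" e G \<xi> lam mu a b eta L y0 by fact
  have "del y = 0 \<longleftrightarrow> del y0 = 0" if "y \<in> ball y0 r" for y
    unfolding A.del_M[OF that, symmetric] using A.M_nonzero[OF that] by simp
  note iff = this
  show ?thesis by (rule that[OF open_ball _ r(2) iff]) (use r(1) in auto)
qed

lemma local_model_exists:
  assumes y0: "y0 \<in> V" and del: "\<And>y. y \<in> V \<Longrightarrow> del y \<noteq> 0"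
  shows "\<exists>V' \<phi> \<psi> I N f \<gamma> T. open V' \<and> V' \<subseteq> V \<and> y0 \<in> V' \<and> open I \<and> is_interval I \<and> open N \<and>
    homeomorphism V' (prod_domain I N) \<phi> \<psi> \<and> smooth_on V' \<phi> \<and> smooth_on (prod_domain I N) \<psi> \<and> smooth_on I \<gamma> \<and>
    improper_affine_sphere_on N (graph_surface f) (vector [0, 0, 1]) \<and> affine_iso T \<and>
    (\<forall>y\<in>V'. G y = T (model_hypersurface \<gamma> f (\<phi> y))) \<and>
    ((\<forall>y\<in>V. mu y = 0) \<longrightarrow> (\<exists>Q. elliptic_paraboloid Q \<and> graph_surface f ` N \<subseteq> Q \<and>
       openin (top_of_set Q) (graph_surface f ` N)))"
proof -
  have d0: "del y0 \<noteq> 0" by (rule del[OF y0])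
  obtain L B :: "real^4 \<Rightarrow> real^4" where L: "linear L" "linear B" "\<And>v. L (B v) = v" "\<And>v. B (L v) = v"
    "L (E 2 y0) = axis 1 1" "L (E 3 y0) = axis 2 1" "L (W y0) = axis 3 1" "L (E 1 y0) = del y0 *\<^sub>R axis 4 1"
    by (rule adapted_basis[OF y0 d0]) (rule that)
  define P0 where "P0 = G y0 - (1 / del y0) *\<^sub>R E 1 y0"
  have LG: "L (G y0 - P0) = axis 4 1"
    using d0 by (simp add: P0_def linear_scale[OF L(1)] L(8))
  have "continuous_on V (\<lambda>y. L (G y - P0) $ 4)"
    by (intro smooth_on_continuous_on smooth_on_component smooth_on_linear[OF L(1)] smooth_on_diff
        smooth_on_const open_V smooth_G)
  note c4 = this
  have "L (G y0 - P0) $ 4 > 0" by (simp add: LG)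
  note c4 = c4 this
  obtain r where r: "r > 0" "ball y0 r \<subseteq> V" "adapted_coordinates (ball y0 r) e G \<xi> lam mu a b eta L y0"
    "\<And>z. z \<in> ball y0 r \<Longrightarrow> L (G z - P0) $ 4 > 0"
    by (rule adapted_coordinates_exist[OF y0 L(1,5,6,7) continuous_on_const _ c4, of 1]) (simp_all add: that)
  interpret M: model_coordinates "ball y0 r" e G \<xi> lam mu a b eta L y0 P0
    unfolding model_coordinates_def model_coordinates_axioms_def
    using r del L(8) LG by auto
  obtain V' \<psi> I N f \<gamma> where *: "open V'" "V' \<subseteq> ball y0 r" "y0 \<in> V'" "open I" "is_interval I" "open N"
    "homeomorphism V' (prod_domain I N) M.phi \<psi>" "smooth_on (prod_domain I N) \<psi>" "smooth_on I \<gamma>"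
    "improper_affine_sphere_on N (graph_surface f) (vector [0, 0, 1])"
    "\<forall>y\<in>V'. L (G y - P0) = model_hypersurface \<gamma> f (M.phi y)"
    "(\<forall>y\<in>ball y0 r. mu y = 0) \<longrightarrow> (\<exists>Q. elliptic_paraboloid Q \<and> graph_surface f ` N \<subseteq> Q \<and>
       openin (top_of_set Q) (graph_surface f ` N))"
    using M.local_model by (elim exE conjE) (rule that)
  define T where "T x = B x + P0" for x
  have "bij B" by (rule o_bij[of L]) (auto simp: L)
  then have T: "affine_iso T" unfolding affine_iso_def T_def using L(2) by blast
  have GT: "G y = T (model_hypersurface \<gamma> f (M.phi y))" if "y \<in> V'" for y
    unfolding *(11)[rule_format, OF that, symmetric] T_def L(4) by simp
  have s: "smooth_on V' M.phi" using smooth_on_subset[OF M.smooth_phi *(2)] .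
  show ?thesis
    by (rule exI[of _ V'], rule exI[of _ M.phi], rule exI[of _ \<psi>], rule exI[of _ I], rule exI[of _ N],
        rule exI[of _ f], rule exI[of _ \<gamma>], rule exI[of _ T], intro conjI ballI impI)
      (rule *(1) subset_trans[OF *(2) r(2)] *(3) *(4) *(5) *(6) *(7) s *(8) *(9) *(10) T | erule GT | use *(12) r(2) in blast)+
qed

end

text \<open>The coordinate frame gives access to the bilinearity of the metric before a frame given
  only as orthonormal is known to be independent.\<close>

lemma frame_on_axes: "open V \<Longrightarrow> frame_on V (\<lambda>i _. axis i 1)"
proof (unfold_locales, assumption)
  show "smooth_on V (\<lambda>_. axis i 1)" if "open V" for i by (rule smooth_on_const[OF that])
  fix d :: "3 \<Rightarrow> real" and j assume "(\<Sum>i\<in>UNIV. d i *\<^sub>R (axis i 1 :: real^3)) = 0"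
  then have "(\<Sum>i\<in>UNIV. d i *\<^sub>R (axis i 1 :: real^3)) $ j = 0" by simp
  then show "d j = 0" by (simp add: axis_def if_distrib cong: if_cong)
qed

section \<open>Local frames in the charts of the hypersurface\<close>

lemma hypersurface_patch:
  assumes A: "affine_hypersurface A F \<xi>" and c: "c \<in> A" and V: "open V" "V \<subseteq> chart_image c"
    and e: "frame_on V e"
  shows "patch V e (F \<circ> param c) (\<xi> \<circ> param c)"
proof -
  have *: "immersion_on (chart_image c) (F \<circ> param c)" "affine_normal_on (chart_image c) (F \<circ> param c) (\<xi> \<circ> param c)"
    using A c by (auto simp: affine_hypersurface_def)
  interpret frame_on V e by fact
  show ?thesis
  proof unfold_locales
    show "smooth_on V (F \<circ> param c)" "smooth_on V (\<xi> \<circ> param c)"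
      using * smooth_on_subset[OF _ V(2)] by (auto simp: immersion_on_def affine_normal_on_def)
    fix y assume "y \<in> V"
    then have "y \<in> chart_image c" using V(2) by blast
    then show "inj (frechet_derivative (F \<circ> param c) (at y))"
      "(\<xi> \<circ> param c) y \<notin> range (frechet_derivative (F \<circ> param c) (at y))"
      "range (frechet_derivative (\<xi> \<circ> param c) (at y)) \<subseteq> range (frechet_derivative (F \<circ> param c) (at y))"
      using * unfolding immersion_on_def affine_normal_on_def by blast+
  qed
qed

lemma hypersurface_chart:
  assumes "affine_hypersurface A F \<xi>" "c \<in> A"
  shows "open (fst c)" "open (chart_image c)" "homeomorphism (fst c) (chart_image c) (snd c) (param c)"
  using assms by (auto simp: affine_hypersurface_def smooth_atlas_def is_chart_def)

lemma hypersurface_symmetry_frame: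
  assumes A: "affine_hypersurface A F \<xi>" and sf: "symmetry_functions A F \<xi> lam mu a b eta"
    and b: "\<forall>p\<in>carrier A. b p = - (eta p)\<^sup>2 + (lam p)\<^sup>2" and p: "p \<in> carrier A"
  obtains c V e where "c \<in> A" "p \<in> fst c" "open V" "V \<subseteq> chart_image c" "snd c p \<in> V"
    "symmetry_frame V e (F \<circ> param c) (\<xi> \<circ> param c) (lam \<circ> param c) (mu \<circ> param c) (a \<circ> param c)
       (b \<circ> param c) (eta \<circ> param c)"
proof -
  obtain c V e where c: "c \<in> A" "p \<in> fst c" and V: "open V" "V \<subseteq> chart_image c" "snd c p \<in> V"
    and e: "\<forall>i. smooth_on V (e i)"
    and n: "\<And>y. y \<in> V \<Longrightarrow> normal_form (metric_in c F \<xi> y) (K_in c F \<xi> y) (S_in c F \<xi> y) (\<lambda>i. e i y)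
             (lam (param c y)) (mu (param c y)) (a (param c y)) (b (param c y))"
    and eta: "\<And>y. y \<in> V \<Longrightarrow> eta (param c y) =
             metric_in c F \<xi> y (levi_civita (metric_in c F \<xi>) (e 2) (e 1) y) (e 2 y)"
      "\<And>y. y \<in> V \<Longrightarrow> eta (param c y) =
             metric_in c F \<xi> y (levi_civita (metric_in c F \<xi>) (e 3) (e 1) y) (e 3 y)"
  proof -
    from bspec[OF conjunct2[OF sf[unfolded symmetry_functions_def]] p]
    obtain c V e where "c \<in> A" "p \<in> fst c" "open V" "V \<subseteq> chart_image c" "snd c p \<in> V" "\<forall>i. smooth_on V (e i)"
      "\<forall>y\<in>V. normal_form (metric_in c F \<xi> y) (K_in c F \<xi> y) (S_in c F \<xi> y) (\<lambda>i. e i y)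
             (lam (param c y)) (mu (param c y)) (a (param c y)) (b (param c y)) \<and>
           eta (param c y) =
             metric_in c F \<xi> y (levi_civita (metric_in c F \<xi>) (e 2) (e 1) y) (e 2 y) \<and>
           eta (param c y) =
             metric_in c F \<xi> y (levi_civita (metric_in c F \<xi>) (e 3) (e 1) y) (e 3 y)"
      by (elim bexE exE conjE) (rule that)
    then show thesis by (intro that[of c V e]) blast+
  qed
  interpret std: patch V "\<lambda>i _. axis i 1" "F \<circ> param c" "\<xi> \<circ> param c"
    by (rule hypersurface_patch[OF A c(1) V(1,2) frame_on_axes[OF V(1)]])
  have on: "metric_in c F \<xi> y (e i y) (e j y) = (if i = j then 1 else 0)" if "y \<in> V" for y i j
    using n[OF that] by (simp add: normal_form_def orthonormal_frame_def)
  have fr: "frame_on V e"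
  proof
    show "open V" "smooth_on V (e i)" for i using V e by auto
    fix y d and j :: 3 assume y: "y \<in> V" and z: "(\<Sum>i\<in>UNIV. d i *\<^sub>R e i y) = 0"
    have "metric_in c F \<xi> y (\<Sum>i\<in>UNIV. d i *\<^sub>R e i y) (e j y) = d j"
      unfolding linear_sum[OF std.h_linear_left[OF y]] linear_scale[OF std.h_linear_left[OF y]]
      by (simp add: on[OF y] if_distrib cong: if_cong)
    then show "d j = 0" unfolding z linear_0[OF std.h_linear_left[OF y]] by simp
  qed
  interpret patch V e "F \<circ> param c" "\<xi> \<circ> param c"
    by (rule hypersurface_patch[OF A c(1) V(1,2) fr])
  have "symmetry_frame V e (F \<circ> param c) (\<xi> \<circ> param c) (lam \<circ> param c) (mu \<circ> param c) (a \<circ> param c)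
       (b \<circ> param c) (eta \<circ> param c)"
  proof unfold_locales
    fix y assume y: "y \<in> V"
    have "param c y \<in> carrier A"
      using hypersurface_chart(3)[OF A c(1)] V(2) y c(1) unfolding homeomorphism_def carrier_def by blast
    then show "(lam \<circ> param c) y > 0" "(b \<circ> param c) y = - ((eta \<circ> param c) y)\<^sup>2 + ((lam \<circ> param c) y)\<^sup>2"
      using sf b by (auto simp: symmetry_functions_def)
  qed (use on n eta in auto)
  then show ?thesis using that c V by blast
qed

text \<open>The truth value of eta = lam is locally constant by \<open>del_dichotomy\<close>, hence
  constant on the connected carrier. It is false at a point with b nonzero, because eta - lam
  divides b.\<close>

lemma eta_ne_lam:
  assumes A: "affine_hypersurface A F \<xi>" and conn: "connected (carrier A)"
    and sf: "symmetry_functions A F \<xi> lam mu a b eta"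
    and b: "\<forall>p\<in>carrier A. b p = - (eta p)\<^sup>2 + (lam p)\<^sup>2" and nz: "\<exists>p\<in>carrier A. b p \<noteq> 0"
    and p: "p \<in> carrier A"
  shows "eta p \<noteq> lam p"
proof -
  obtain q where q: "q \<in> carrier A" "b q \<noteq> 0" using nz by blast
  have "(eta p = lam p) = (eta q = lam q)"
  proof (rule connected_local_const[OF conn p q(1), of "\<lambda>p. eta p = lam p"], intro ballI)
    fix r assume r: "r \<in> carrier A"
    obtain c V e where c: "c \<in> A" "r \<in> fst c" and V: "open V" "V \<subseteq> chart_image c" "snd c r \<in> V"
      and "symmetry_frame V e (F \<circ> param c) (\<xi> \<circ> param c) (lam \<circ> param c) (mu \<circ> param c) (a \<circ> param c)
       (b \<circ> param c) (eta \<circ> param c)"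
      using hypersurface_symmetry_frame[OF A sf b r] .
    then interpret symmetry_frame V e "F \<circ> param c" "\<xi> \<circ> param c" "lam \<circ> param c" "mu \<circ> param c" "a \<circ> param c"
       "b \<circ> param c" "eta \<circ> param c" by simp
    obtain V' where V': "open V'" "snd c r \<in> V'" "V' \<subseteq> V" "\<And>y. y \<in> V' \<Longrightarrow> del y = 0 \<longleftrightarrow> del (snd c r) = 0"
      by (rule del_dichotomy[OF V(3)]) (rule that)
    note ch = hypersurface_chart[OF A c(1)]
    have pc: "param c (snd c s) = s" if "s \<in> fst c" for s
      using ch(3) that by (simp add: homeomorphism_def)
    have "continuous_on (fst c) (snd c)" using ch(3) by (simp add: homeomorphism_def)
    then have "open (fst c \<inter> snd c -` V')" using ch(1) V'(1) continuous_open_preimage by blast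
    moreover have "(eta r = lam r) = (eta s = lam s)" if "s \<in> fst c \<inter> snd c -` V'" for s
      using V'(4)[of "snd c s"] that pc[of s] pc[OF c(2)] by (simp add: del_def)
    ultimately show "\<forall>\<^sub>F s in at r within carrier A. (eta r = lam r) = (eta s = lam s)"
      unfolding eventually_at_topological using c V' by blast
  qed
  moreover have "eta q \<noteq> lam q" using q b by auto
  ultimately show ?thesis by simp
qed

text \<open>The paraboloid clause assumes only SO(2)-symmetry, while mu = 0 belongs to one
  alternative of the hypothesis, so the other alternative has to be excluded.\<close>

lemma SO2_excludes_Z3_symmetry:
  assumes A: "affine_hypersurface A F \<xi>" and p: "p \<in> carrier A"
    and SO2: "pointwise_SO2_symmetry A F \<xi>"
  shows "\<not> pointwise_Z3_symmetry A F \<xi>"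
proof
  assume Z3: "pointwise_Z3_symmetry A F \<xi>"
  obtain c where c: "c \<in> A" "p \<in> fst c" using p by (auto simp: carrier_def)
  define y where "y = snd c p"
  let ?g = "metric_in c F \<xi> y"
  have y: "y \<in> chart_image c" using c by (simp add: y_def chart_image_def)
  interpret patch "chart_image c" "\<lambda>i _. axis i 1" "F \<circ> param c" "\<xi> \<circ> param c"
    using hypersurface_patch[OF A c(1) _ _ frame_on_axes] hypersurface_chart(2)[OF A c(1)] by blast
  obtain e e' where e: "orthonormal_frame ?g e"
    and "range (rotation ?g e) = rotation ?g e' ` {0, 2 * pi / 3, 4 * pi / 3}"
    using SO2 Z3 c(1) y unfolding pointwise_SO2_symmetry_def pointwise_Z3_symmetry_def by metis
  \<comment> \<open>Pairing the rotated \<open>e 2\<close> with \<open>e 2\<close> gives the cosine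
    of the angle. Over all rotations it takes every value in [-1, 1], over three rotations only
    finitely many.\<close>
  then have fin: "finite ((\<lambda>R. ?g (R (e 2)) (e 2)) ` range (rotation ?g e))" by simp
  have "?g (rotation ?g e \<theta> (e 2)) (e 2) = cos \<theta>" for \<theta>
    using e by (simp add: rotation_def orthonormal_frame_def linear_add[OF h_linear_left[OF y]]
        linear_scale[OF h_linear_left[OF y]])
  then have "(\<lambda>R. ?g (R (e 2)) (e 2)) ` range (rotation ?g e) = range cos"
    by (simp add: image_image)
  moreover have "{-1..1} \<subseteq> range (cos :: real \<Rightarrow> real)"
  proof
    fix x :: real assume "x \<in> {-1..1}"
    then have "x = cos (arccos x)" by simp
    then show "x \<in> range cos" by blast
  qed
  ultimately have "finite {-1..1 :: real}" using fin finite_subset by metis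
  then show False using infinite_Icc[of "-1" "1 :: real"] by simp
qed

text \<open>Each transition map with a chart of the atlas factors through \<open>c\<close>; one
  direction adds the smooth map \<psi>, the other the smooth map \<phi>.\<close>

lemma smooth_chart_compose:
  assumes A: "smooth_atlas A" and c: "c \<in> A" and V: "open V" "V \<subseteq> chart_image c"
    and B: "open B" and hom: "homeomorphism V B \<phi> \<psi>" and s\<phi>: "smooth_on V \<phi>" and s\<psi>: "smooth_on B \<psi>"
  shows "smooth_chart A (fst c \<inter> snd c -` V, \<phi> \<circ> snd c)" "(\<phi> \<circ> snd c) ` (fst c \<inter> snd c -` V) = B"
proof -
  let ?U = "fst c" and ?W = "fst c \<inter> snd c -` V" and ?\<theta> = "\<phi> \<circ> snd c"
  let ?d = "(?W, ?\<theta>)"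
  have ch: "open ?U" "open (chart_image c)" "homeomorphism ?U (chart_image c) (snd c) (param c)"
    using A c by (auto simp: smooth_atlas_def is_chart_def)
  have "continuous_on ?U (snd c)" using ch(3) by (simp add: homeomorphism_def)
  then have oW: "open ?W" using ch(1) V(1) continuous_open_preimage by blast
  have "snd c ` ?W = V"
  proof (intro equalityI subsetI)
    fix y assume y: "y \<in> V"
    then have "y \<in> chart_image c" using V(2) by blast
    then have "snd c (param c y) = y" "param c y \<in> ?U"
      using ch(3) unfolding homeomorphism_def by blast+
    then show "y \<in> snd c ` ?W" using y by (intro image_eqI[of _ _ "param c y"]) auto
  qed auto
  then have "homeomorphism ?W V (snd c) (param c)"
    by (rule homeomorphism_of_subsets[OF ch(3) Int_lower1 V(2)])
  from homeomorphism_compose[OF this hom] have h: "homeomorphism ?W B ?\<theta> (param c \<circ> \<psi>)" .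
  then show im: "?\<theta> ` ?W = B" by (simp add: homeomorphism_def)
  \<comment> \<open>\<open>param\<close> is an inverse by choice; injectivity on the domain
    identifies it with the composed inverse.\<close>
  have par: "param ?d z = param c (\<psi> z)" if "z \<in> B" for z
  proof -
    have "inj_on ?\<theta> ?W" using homeomorphism_apply1[OF h] by (rule inj_on_inverseI)
    moreover have "?\<theta> (param c (\<psi> z)) = z" "param c (\<psi> z) \<in> ?W"
      using homeomorphism_apply2[OF h that] homeomorphism_image2[OF h] that by auto
    ultimately show ?thesis unfolding param_def[of ?d] fst_conv snd_conv
      using inv_into_f_f[of ?\<theta> ?W "param c (\<psi> z)"] by simp
  qed
  have ci: "chart_image ?d = B" using im by (simp add: chart_image_def)
  have "homeomorphism ?W B ?\<theta> (param ?d)"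
    by (rule homeomorphism_cong[OF h]) (auto simp: par)
  then have "is_chart ?d" unfolding is_chart_def ci using oW B by simp
  moreover have "fst ?d \<subseteq> carrier A" using c by (auto simp: carrier_def)
  moreover have "compatible ?d c'" if c': "c' \<in> A" for c'
  proof -
    have cc: "smooth_on (snd c ` (fst c \<inter> fst c')) (snd c' \<circ> param c)" "smooth_on (snd c' ` (fst c \<inter> fst c')) (snd c \<circ> param c')"
      using A c c' by (auto simp: smooth_atlas_def compatible_def)
    have ch': "open (fst c')" "open (chart_image c')" "homeomorphism (fst c') (chart_image c') (snd c') (param c')"
      using A c' by (auto simp: smooth_atlas_def is_chart_def)
    let ?S = "?\<theta> ` (?W \<inter> fst c')" and ?S' = "snd c' ` (?W \<inter> fst c')"
    have "openin (top_of_set B) ?S"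
      by (rule homeomorphism_imp_open_map[OF h openin_open_Int[OF ch'(1)]])
    then have oS: "open ?S" unfolding openin_open_eq[OF B] by (rule conjunct1)
    have "openin (top_of_set (chart_image c')) (snd c' ` (fst c' \<inter> ?W))"
      by (rule homeomorphism_imp_open_map[OF ch'(3) openin_open_Int[OF oW]])
    moreover have "fst c' \<inter> ?W = ?W \<inter> fst c'" by (rule Int_commute)
    ultimately have "openin (top_of_set (chart_image c')) ?S'" by (rule back_subst[of "\<lambda>X. openin _ (_ ` X)"])
    then have oS': "open ?S'" unfolding openin_open_eq[OF ch'(2)] by (rule conjunct1)
    have SB: "?S \<subseteq> B" using im by blast
    have 1: "smooth_on ?S (\<lambda>z. (snd c' \<circ> param c) (\<psi> z))"
    proof (rule smooth_on_compose[OF oS cc(1) smooth_on_subset[OF s\<psi> SB]])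
      show "\<psi> ` ?S \<subseteq> snd c ` (fst c \<inter> fst c')"
        using hom by (auto simp: homeomorphism_def)
    qed
    have 2: "smooth_on ?S' (\<lambda>z. \<phi> ((snd c \<circ> param c') z))"
    proof (rule smooth_on_compose[OF oS' s\<phi> smooth_on_subset[OF cc(2)]])
      show "?S' \<subseteq> snd c' ` (fst c \<inter> fst c')" by blast
      show "(snd c \<circ> param c') ` ?S' \<subseteq> V" using ch'(3) by (auto simp: homeomorphism_def)
    qed
    have "smooth_on ?S (snd c' \<circ> param ?d)"
    proof (rule smooth_on_cong[OF oS, THEN iffD2, OF _ 1])
      fix z assume "z \<in> ?S"
      then have "z \<in> B" using SB by blast
      then show "(snd c' \<circ> param ?d) z = (snd c' \<circ> param c) (\<psi> z)" using par by (simp only: comp_apply)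
    qed
    then show ?thesis using 2 by (simp add: compatible_def o_def)
  qed
  ultimately show "smooth_chart A ?d" unfolding smooth_chart_def by blast
qed

theorem theorem4p3:
  fixes A :: "('m::{t2_space,second_countable_topology}, 3) chart set"
    and F \<xi> :: "'m \<Rightarrow> real^4"
    and lam mu a b eta :: "'m \<Rightarrow> real"
  assumes "affine_hypersurface A F \<xi>"
    and "connected (carrier A)"
    and "positive_definite A F \<xi>"
    and "symmetry_functions A F \<xi> lam mu a b eta"
    and "(pointwise_SO2_symmetry A F \<xi> \<and> (\<forall>p\<in>carrier A. mu p = 0)) \<or>
         (pointwise_Z3_symmetry A F \<xi> \<and>
            (\<forall>p\<in>carrier A. mu p > 0 \<and> (mu p = sqrt 2 * lam p \<longrightarrow> a p \<noteq> b p)))"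
    and "\<forall>p\<in>carrier A. b p = - (eta p)\<^sup>2 + (lam p)\<^sup>2"
    and "\<exists>p\<in>carrier A. b p \<noteq> 0"
  shows "\<forall>p\<in>carrier A. \<exists>W \<phi> I N f \<gamma> T.
     smooth_chart A (W, \<phi>) \<and> p \<in> W \<and> \<phi> ` W = prod_domain I N \<and>
     open I \<and> is_interval I \<and> open N \<and>
     smooth_on I \<gamma> \<and>
     improper_affine_sphere_on N (graph_surface f) (vector [0, 0, 1]) \<and>
     affine_iso T \<and> (\<forall>q\<in>W. F q = T (model_hypersurface \<gamma> f (\<phi> q))) \<and>
     (pointwise_SO2_symmetry A F \<xi> \<longrightarrow>
        (\<exists>Q. elliptic_paraboloid Q \<and> graph_surface f ` N \<subseteq> Q \<and>
             openin (top_of_set Q) (graph_surface f ` N)))"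
proof
  fix p assume p: "p \<in> carrier A"
  obtain c V e where c: "c \<in> A" "p \<in> fst c" and V: "open V" "V \<subseteq> chart_image c" "snd c p \<in> V"
    and "symmetry_frame V e (F \<circ> param c) (\<xi> \<circ> param c) (lam \<circ> param c) (mu \<circ> param c) (a \<circ> param c)
       (b \<circ> param c) (eta \<circ> param c)"
    using hypersurface_symmetry_frame[OF assms(1,4,6) p] .
  then interpret symmetry_frame V e "F \<circ> param c" "\<xi> \<circ> param c" "lam \<circ> param c" "mu \<circ> param c" "a \<circ> param c"
     "b \<circ> param c" "eta \<circ> param c" by simp
  note ch = hypersurface_chart(3)[OF assms(1) c(1)]
  have pV: "param c y \<in> carrier A" if "y \<in> V" for y
  proof -
    have "y \<in> chart_image c" using that V(2) by blast
    then have "param c y \<in> fst c" using homeomorphism_image2[OF ch] by blast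
    then show ?thesis using c(1) unfolding carrier_def by blast
  qed
  have del: "del y \<noteq> 0" if "y \<in> V" for y
    using eta_ne_lam[OF assms(1,2,4,6,7) pV[OF that]] by (simp add: del_def)
  obtain V' \<phi> \<psi> I N f \<gamma> T where V': "open V'" "V' \<subseteq> V" "snd c p \<in> V'"
    and IN: "open I" "is_interval I" "open N"
    and \<phi>: "homeomorphism V' (prod_domain I N) \<phi> \<psi>" "smooth_on V' \<phi>" "smooth_on (prod_domain I N) \<psi>"
    and model: "smooth_on I \<gamma>" "improper_affine_sphere_on N (graph_surface f) (vector [0, 0, 1])" "affine_iso T"
      "\<forall>y\<in>V'. (F \<circ> param c) y = T (model_hypersurface \<gamma> f (\<phi> y))"
    and para: "(\<forall>y\<in>V. (mu \<circ> param c) y = 0) \<longrightarrow> (\<exists>Q. elliptic_paraboloid Q \<and> graph_surface f ` N \<subseteq> Q \<and>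
       openin (top_of_set Q) (graph_surface f ` N))"
  proof -
    note ex = local_model_exists[OF V(3)]
    show thesis by (rule ex[THEN exE], rule del, assumption) (elim exE conjE, rule that)
  qed
  have atlas: "smooth_atlas A" using assms(1) by (simp add: affine_hypersurface_def)
  let ?W = "fst c \<inter> snd c -` V'"
  have chart: "smooth_chart A (?W, \<phi> \<circ> snd c)" "(\<phi> \<circ> snd c) ` ?W = prod_domain I N"
    using smooth_chart_compose[OF atlas c(1) V'(1) subset_trans[OF V'(2) V(2)] open_prod_domain[OF IN(1,3)] \<phi>] .
  have F: "\<forall>q\<in>?W. F q = T (model_hypersurface \<gamma> f ((\<phi> \<circ> snd c) q))"
  proof
    fix q assume q: "q \<in> ?W"
    have "param c (snd c q) = q" by (rule homeomorphism_apply1[OF ch]) (use q in blast)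
    then show "F q = T (model_hypersurface \<gamma> f ((\<phi> \<circ> snd c) q))" using model(4) q by auto
  qed
  have SO2: "\<exists>Q. elliptic_paraboloid Q \<and> graph_surface f ` N \<subseteq> Q \<and> openin (top_of_set Q) (graph_surface f ` N)"
    if "pointwise_SO2_symmetry A F \<xi>"
  proof -
    have "\<forall>p\<in>carrier A. mu p = 0"
      using assms(5) SO2_excludes_Z3_symmetry[OF assms(1) p that] by blast
    then show ?thesis using para pV by simp
  qed
  show "\<exists>W \<phi> I N f \<gamma> T.
     smooth_chart A (W, \<phi>) \<and> p \<in> W \<and> \<phi> ` W = prod_domain I N \<and>
     open I \<and> is_interval I \<and> open N \<and>
     smooth_on I \<gamma> \<and>
     improper_affine_sphere_on N (graph_surface f) (vector [0, 0, 1]) \<and>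
     affine_iso T \<and> (\<forall>q\<in>W. F q = T (model_hypersurface \<gamma> f (\<phi> q))) \<and>
     (pointwise_SO2_symmetry A F \<xi> \<longrightarrow>
        (\<exists>Q. elliptic_paraboloid Q \<and> graph_surface f ` N \<subseteq> Q \<and>
             openin (top_of_set Q) (graph_surface f ` N)))"
    by (rule exI[of _ ?W], rule exI[of _ "\<phi> \<circ> snd c"], rule exI[of _ I], rule exI[of _ N],
        rule exI[of _ f], rule exI[of _ \<gamma>], rule exI[of _ T], intro conjI impI)
      (rule chart IN model(1-3) F | erule SO2 | use c V' in blast)+
qed

end
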